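(* Let $\gamma\in\mathbb R$ be such that $|\gamma|\ne1$ and $\gamma\neq0$. Then for any $b,b_1,c,c_1\in(\frac14,\frac12)$ we have $$\|uv\|_{X^{0,-c_1}}\lesssim\|u\|_{Y^{-\frac12,b}_\gamma}\|v\|_{X^{0,b_1}}\quad\text{if } b+b_1+c_1\ge1,$$ $$\|\partial_x(u\bar v)\|_{Y^{-\frac12,-c}_\gamma}\lesssim\|u\|_{X^{0,b_1}}\|v\|_{X^{0,b_1}}\quad\text{if } 2b_1+c\ge1,$$ where the implicit constants depend on $\gamma$ (and on the exponents) but not on $u,v$.
   Context: Functions are complex-valued on $\mathbb R_t\times\mathbb R_x$, with space-time Fourier transform $\widehat u(\tau,\xi)=\frac1{2\pi}\int_{\mathbb R^2}u(t,x)e^{-i(x\xi+t\tau)}dtdx$. With $\langle x\rangle=1+|x|$, $$\|u\|_{X^{s,b}}=\Big(\int_{\mathbb R}\int_{\mathbb R}\langle\tau+\xi^2\rangle^{2b}\langle\xi\rangle^{2s}|\widehat u(\tau,\xi)|^2d\xi d\tau\Big)^{1/2},$$ $$\|u\|_{Y^{s,b}_\gamma}=\Big(\int_{\mathbb R}\int_{\mathbb R}\langle\tau+\gamma|\xi|\xi\rangle^{2b}\langle\xi\rangle^{2s}|\widehat u(\tau,\xi)|^2d\xi d\tau\Big)^{1/2}.$$ $A\lesssim B$ means $A\le CB$ with a constant $C>0$. As usual, the bilinear estimates are understood as holding for all Schwartz functions $u,v$ on $\mathbb R^2$ (and hence by density). *)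

theory Defs
  imports "HOL-Analysis.Analysis"
begin

text \<open>Points of space-time are pairs \<open>(t, x)\<close>, frequencies are pairs \<open>(\<tau>, \<xi>)\<close>.\<close>

definition dir_deriv ::
  "'a::real_normed_vector \<Rightarrow> ('a \<Rightarrow> 'b::real_normed_vector) \<Rightarrow> 'a \<Rightarrow> 'b" where
  "dir_deriv v f z = vector_derivative (\<lambda>h. f (z + h *\<^sub>R v)) (at 0)"

text \<open>Iterated partial derivatives are indexed by arbitrary words \<open>vs\<close> of basis vectors.  Requiring
  all of them to be (Frechet) differentiable everywhere is smoothness.\<close>

definition schwartz :: "('a::euclidean_space \<Rightarrow> complex) \<Rightarrow> bool" where
  "schwartz f \<longleftrightarrow>
    (\<forall>vs. set vs \<subseteq> Basis \<longrightarrow>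
      (\<forall>z. foldr dir_deriv vs f differentiable (at z)) \<and>
      (\<forall>k::nat. bounded (range (\<lambda>z. norm z ^ k *\<^sub>R foldr dir_deriv vs f z))))"

abbreviation partial_x :: "(real \<times> real \<Rightarrow> complex) \<Rightarrow> real \<times> real \<Rightarrow> complex" where
  "partial_x \<equiv> dir_deriv (0, 1)"

definition fourier :: "(real \<times> real \<Rightarrow> complex) \<Rightarrow> real \<times> real \<Rightarrow> complex" where
  "fourier u = (\<lambda>(\<tau>, \<xi>). complex_of_real (1 / (2 * pi)) *
     (\<integral>(t, x). u (t, x) * exp (- (\<i> * complex_of_real (x * \<xi> + t * \<tau>))) \<partial>lborel))"

definition bracket :: "real \<Rightarrow> real" where
  "bracket x = 1 + \<bar>x\<bar>"

text \<open>The norms take values in \<open>[0, \<infinity>]\<close>, so that a divergent integral gives the norm \<open>\<infinity>\<close>.\<close>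

definition ennreal_sqrt :: "ennreal \<Rightarrow> ennreal" where
  "ennreal_sqrt a = (if a = top then top else ennreal (sqrt (enn2real a)))"

definition X_norm :: "real \<Rightarrow> real \<Rightarrow> (real \<times> real \<Rightarrow> complex) \<Rightarrow> ennreal" where
  "X_norm s b u = ennreal_sqrt
     (\<integral>\<^sup>+\<tau>. \<integral>\<^sup>+\<xi>. ennreal (bracket (\<tau> + \<xi>\<^sup>2) powr (2 * b) * bracket \<xi> powr (2 * s) *
        (cmod (fourier u (\<tau>, \<xi>)))\<^sup>2) \<partial>lborel \<partial>lborel)"

definition Y_norm :: "real \<Rightarrow> real \<Rightarrow> real \<Rightarrow> (real \<times> real \<Rightarrow> complex) \<Rightarrow> ennreal" where
  "Y_norm \<gamma> s b u = ennreal_sqrt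
     (\<integral>\<^sup>+\<tau>. \<integral>\<^sup>+\<xi>. ennreal (bracket (\<tau> + \<gamma> * \<bar>\<xi>\<bar> * \<xi>) powr (2 * b) * bracket \<xi> powr (2 * s) *
        (cmod (fourier u (\<tau>, \<xi>)))\<^sup>2) \<partial>lborel \<partial>lborel)"

end

theory Submission
  imports Defs "HOL-Probability.Probability"
begin

text \<open>Taking Fourier transforms and dualising, both estimates become bounds for one trilinear form
  \<open>\<integral>\<integral> h z * f w * g (z - w) * kern z w\<close>, whose kernel is \<open>bracket \<xi>\<^sub>1 powr (1/2)\<close> divided by powers
  (with exponents in \<open>(1/4, 1/2)\<close> and, after decreasing them, of sum 1) of the three modulations
  \<open>\<sigma>\<^sub>0 = \<tau> + \<xi>\<^sup>2\<close>, \<open>\<sigma>\<^sub>1 = \<tau>\<^sub>1 + \<gamma> * \<bar>\<xi>\<^sub>1\<bar> * \<xi>\<^sub>1\<close>, \<open>\<sigma>\<^sub>2 = (\<tau> - \<tau>\<^sub>1) + (\<xi> - \<xi>\<^sub>1)\<^sup>2\<close>.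

  The region where \<open>\<sigma>\<^sub>i\<close> is the largest modulation is treated by Cauchy--Schwarz with the variable
  belonging to \<open>\<sigma>\<^sub>i\<close> held fixed, so that the other two modulations become the integration variables. If
  the Jacobian is at least of size \<open>\<bar>\<xi>\<^sub>1\<bar>\<close>, it absorbs the weight and the exponents balance exactly. For
  \<open>i = 1\<close> the Jacobian is \<open>2 * \<bar>\<xi>\<^sub>1\<bar>\<close>. For \<open>i = 0, 2\<close> the resonance function is a quadratic polynomial in
  \<open>\<xi>\<^sub>1\<close> on each half line, with leading coefficient \<open>1 \<plusminus> \<gamma> \<noteq> 0\<close>; where its derivative is small,
  \<open>\<bar>\<xi>\<^sub>1\<bar>\<^sup>2\<close> is bounded by the largest modulation and it suffices to integrate
  \<open>bracket (quadratic) powr (- k)\<close> with \<open>k < 1/2\<close>, which is where the exponents have to exceed \<open>1/4\<close>.\<close>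

section \<open>Integrals of powers of the bracket\<close>

text \<open>Why the exponents balance: let p, q, r be the doubled exponents, so p + q + r = 2, with
  r at the largest modulation, of size S. Integrating the other two modulations up to size S costs
  S^((1-p) + (1-q)) = S^r, which the factor S^(-r) cancels exactly. The obstacle is the critical
  point of the resonance function \<phi>, where the Jacobian vanishes. It is overcome because the
  fixed, largest modulation m is also the constant term of \<phi>: hence |\<phi> x - m| \<le> 3 |m|,
  and near the critical point this forces x^2 to be at most a multiple of \<open>bracket m\<close>.
  For |\<gamma>| = 1 a leading coefficient would vanish on a half line and this argument would break
  down. One form serves both estimates, since conjugation reflects the frequency and the derivative
  turns the weight exponent -1/2 into 1/2; they differ in the slot taken by the dual function. On
  the Fourier side all quantities are nonnegative and live in [0, \<infinity>], so no convergence
  question arises there. The passage to that side needs the convolution formula for a product, which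
  rests on Fourier inversion, obtained here from Gaussians.\<close>

lemma bracket_ge_1: "1 \<le> bracket x"
  and bracket_pos: "0 < bracket x"
  and bracket_minus [simp]: "bracket (- x) = bracket x"
  and bracket_diff_commute: "bracket (x - y) = bracket (y - x)"
  by (auto simp: bracket_def)

lemma bracket_mono: "\<bar>x\<bar> \<le> \<bar>y\<bar> \<Longrightarrow> bracket x \<le> bracket y"
  by (simp add: bracket_def)

lemma borel_measurable_bracket [measurable]: "bracket \<in> borel_measurable borel"
  unfolding bracket_def by measurable

lemma bracket_powr_le_1: "0 \<le> p \<Longrightarrow> bracket x powr (- p) \<le> 1"
  using bracket_ge_1[of x] powr_mono[of "-p" 0 "bracket x"] bracket_pos[of x] by simp

lemma bracket_powr_antimono:
  assumes "\<bar>x\<bar> \<le> \<bar>y\<bar>" "0 \<le> p"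
  shows "bracket y powr (- p) \<le> bracket x powr (- p)"
  using assms bracket_mono bracket_pos by (intro powr_mono2') auto

lemma ennreal_mult_numeral: "numeral n * ennreal x = ennreal (numeral n * x)"
  by (metis ennreal_mult' ennreal_numeral zero_le_numeral)

lemma nn_integral_even:
  fixes G :: "real \<Rightarrow> ennreal"
  assumes [measurable]: "G \<in> borel_measurable borel"
  shows "(\<integral>\<^sup>+s. G \<bar>s\<bar> \<partial>lborel) \<le> 2 * (\<integral>\<^sup>+s. G s * indicator {0..} s \<partial>lborel)"
proof -
  \<comment> \<open>At s = 0 both summands on the right are present, so the integrands are compared
    by an inequality only.\<close>
  have "(\<integral>\<^sup>+s. G \<bar>s\<bar> \<partial>lborel) \<le> (\<integral>\<^sup>+s. G s * indicator {0..} s + G (- s) * indicator {0..} (- s) \<partial>lborel)"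
    by (intro nn_integral_mono) (auto simp: indicator_def)
  also have "\<dots> = (\<integral>\<^sup>+s. G s * indicator {0..} s \<partial>lborel) + (\<integral>\<^sup>+s. G (- s) * indicator {0..} (- s) \<partial>lborel)"
    by (intro nn_integral_add) auto
  also have "(\<integral>\<^sup>+s. G (- s) * indicator {0..} (- s) \<partial>lborel) = (\<integral>\<^sup>+s. G s * indicator {0..} s \<partial>lborel)"
    using nn_integral_real_affine[of "\<lambda>s. G s * indicator {0..} s" "-1" 0] by simp
  finally show ?thesis by (simp add: mult_2)
qed

lemma nn_integral_bracket_powr_Icc:
  assumes p: "p < 1" and S: "0 \<le> S"
  shows "(\<integral>\<^sup>+s. ennreal (bracket s powr (- p)) * indicator {-S..S} s \<partial>lborel)
    \<le> ennreal (2 / (1 - p) * bracket S powr (1 - p))"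
proof -
  have "(\<integral>\<^sup>+s. ennreal (bracket s powr (- p)) * indicator {-S..S} s \<partial>lborel)
      = (\<integral>\<^sup>+s. (\<lambda>s. ennreal ((1 + s) powr (- p)) * indicator {..S} s) \<bar>s\<bar> \<partial>lborel)"
    by (intro nn_integral_cong) (auto simp: indicator_def bracket_def)
  also have "\<dots> \<le> 2 * (\<integral>\<^sup>+s. ennreal ((1 + s) powr (- p)) * indicator {..S} s * indicator {0..} s \<partial>lborel)"
    by (rule nn_integral_even) auto
  also have "(\<integral>\<^sup>+s. ennreal ((1 + s) powr (- p)) * indicator {..S} s * indicator {0..} s \<partial>lborel)
     = (\<integral>\<^sup>+s. ennreal ((1 + s) powr (- p)) * indicator {0..S} s \<partial>lborel)"
    by (intro nn_integral_cong) (auto simp: indicator_def)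
  also have "\<dots> = ennreal ((1 + S) powr (1 - p) / (1 - p) - (1 + 0) powr (1 - p) / (1 - p))"
    using p S by (intro nn_integral_FTC_Icc) (auto intro!: derivative_eq_intros)
  also have "\<dots> \<le> ennreal ((1 + S) powr (1 - p) / (1 - p))"
    using p by (intro ennreal_leI) auto
  finally have "(\<integral>\<^sup>+s. ennreal (bracket s powr (- p)) * indicator {-S..S} s \<partial>lborel)
    \<le> 2 * ennreal ((1 + S) powr (1 - p) / (1 - p))"
    by (simp add: mult_left_mono)
  then show ?thesis
    using p S by (simp add: bracket_def ennreal_mult_numeral)
qed

lemma nn_integral_bracket_powr:
  assumes r: "1 < r"
  shows "(\<integral>\<^sup>+s. ennreal (bracket s powr (- r)) \<partial>lborel) \<le> ennreal (2 / (r - 1))"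
proof -
  have "(\<integral>\<^sup>+s. ennreal (bracket s powr (- r)) \<partial>lborel)
      = (\<integral>\<^sup>+s. (\<lambda>s. ennreal ((1 + s) powr (- r))) \<bar>s\<bar> \<partial>lborel)"
    by (intro nn_integral_cong) (auto simp: indicator_def bracket_def)
  also have "\<dots> \<le> 2 * (\<integral>\<^sup>+s. ennreal ((1 + s) powr (- r)) * indicator {0..} s \<partial>lborel)"
    by (rule nn_integral_even) auto
  also have "(\<integral>\<^sup>+s. ennreal ((1 + s) powr (- r)) * indicator {0..} s \<partial>lborel)
     = ennreal (0 - (1 + 0) powr (1 - r) / (1 - r))"
  proof (rule nn_integral_FTC_atLeast)
    show "((\<lambda>s. (1 + s) powr (1 - r) / (1 - r)) \<longlongrightarrow> 0) at_top"
      using r by real_asymp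
  qed (use r in \<open>auto intro!: derivative_eq_intros\<close>)
  finally show ?thesis
    using r by (simp add: ennreal_mult_numeral minus_divide_right del: minus_divide_left)
qed

text \<open>Uniformity in the centre y is the point. Where |x - y| \<le> R, the integral centred at
  0 applies after a translation; elsewhere the integrand is at most
  \<open>bracket R powr (- p)\<close>, on an interval of length 2 R. The two pieces give the two
  summands of the constant.\<close>

lemma nn_integral_bracket_powr_Icc_shift:
  assumes p: "0 \<le> p" "p < 1" and R: "0 \<le> R"
  shows "(\<integral>\<^sup>+x. ennreal (bracket (x - y) powr (- p)) * indicator {-R..R} x \<partial>lborel)
    \<le> ennreal ((2 / (1 - p) + 2) * bracket R powr (1 - p))"
proof -
  have "(\<integral>\<^sup>+x. ennreal (bracket (x - y) powr (- p)) * indicator {-R..R} x \<partial>lborel)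
     \<le> (\<integral>\<^sup>+x. ennreal (bracket (x - y) powr (- p)) * indicator {-R..R} (x - y)
           + ennreal (bracket R powr (- p)) * indicator {-R..R} x \<partial>lborel)"
    using bracket_powr_antimono[OF _ p(1), of R]
    by (intro nn_integral_mono) (auto simp: indicator_def R intro!: ennreal_leI)
  also have "\<dots> = (\<integral>\<^sup>+x. ennreal (bracket (x - y) powr (- p)) * indicator {-R..R} (x - y) \<partial>lborel)
     + (\<integral>\<^sup>+x. ennreal (bracket R powr (- p)) * indicator {-R..R} x \<partial>lborel)"
    by (intro nn_integral_add) auto
  also have "(\<integral>\<^sup>+x. ennreal (bracket (x - y) powr (- p)) * indicator {-R..R} (x - y) \<partial>lborel)
     = (\<integral>\<^sup>+x. ennreal (bracket x powr (- p)) * indicator {-R..R} x \<partial>lborel)"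
    using nn_integral_real_affine[of "\<lambda>x. ennreal (bracket x powr (- p)) * indicator {-R..R} x" 1 "- y"] by simp
  also have "(\<integral>\<^sup>+x. ennreal (bracket R powr (- p)) * indicator {-R..R} x \<partial>lborel)
     = ennreal (bracket R powr (- p)) * ennreal (2 * R)"
    using R by (simp add: nn_integral_cmult_indicator)
  also have "\<dots> \<le> ennreal (2 * bracket R powr (1 - p))"
  proof -
    have "bracket R powr (- p) * (2 * R) \<le> 2 * (bracket R powr (- p) * bracket R powr 1)"
      using R bracket_pos[of R] by (auto simp: bracket_def intro!: mult_left_mono)
    then show ?thesis
      using R unfolding powr_add[symmetric] by (simp flip: ennreal_mult' add: ennreal_leI)
  qed
  finally show ?thesis
    using nn_integral_bracket_powr_Icc[OF p(2) R] p
    by (auto simp: distrib_right ennreal_plus intro: order_trans add_mono)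
qed

section \<open>Quadratic phases\<close>

text \<open>The half line is exhausted by the intervals [0, n], on which y \<mapsto> a y^2 + m is
  increasing. Only an upper bound results, because the image of the half line is part of the
  line.\<close>

lemma nn_integral_square_subst_aux:
  fixes H :: "real \<Rightarrow> ennreal"
  assumes [measurable]: "H \<in> borel_measurable borel" and a: "0 < a"
  shows "(\<integral>\<^sup>+y. ennreal (2 * a * y) * H (a * y\<^sup>2 + m) * indicator {0..} y \<partial>lborel) \<le> (\<integral>\<^sup>+y. H y \<partial>lborel)"
proof -
  let ?F = "\<lambda>y. ennreal (2 * a * y) * H (a * y\<^sup>2 + m)"
  have "(\<integral>\<^sup>+y. ?F y * indicator {0..} y \<partial>lborel) = (\<integral>\<^sup>+y. (SUP n::nat. ?F y * indicator {0..real n} y) \<partial>lborel)"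
  proof (intro nn_integral_cong antisym)
    fix y :: real
    obtain n where "y \<le> real n" using real_arch_simple by blast
    then have "?F y * indicator {0..} y \<le> ?F y * indicator {0..real n} y"
      by (auto simp: indicator_def)
    then show "?F y * indicator {0..} y \<le> (SUP n::nat. ?F y * indicator {0..real n} y)"
      by (rule SUP_upper2[OF UNIV_I])
    show "(SUP n::nat. ?F y * indicator {0..real n} y) \<le> ?F y * indicator {0..} y"
      by (intro SUP_least) (auto simp: indicator_def)
  qed
  also have "\<dots> = (SUP n::nat. \<integral>\<^sup>+y. ?F y * indicator {0..real n} y \<partial>lborel)"
    by (intro nn_integral_monotone_convergence_SUP) (auto simp: incseq_def le_fun_def indicator_def)
  also have "\<dots> \<le> (\<integral>\<^sup>+y. H y \<partial>lborel)"
  proof (intro SUP_least)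
    fix n :: nat
    show "(\<integral>\<^sup>+y. ?F y * indicator {0..real n} y \<partial>lborel) \<le> (\<integral>\<^sup>+y. H y \<partial>lborel)"
    \<comment> \<open>The change of variables needs a nondegenerate interval, so n = 0 is treated
      apart.\<close>
    proof (cases "n = 0")
      case True
      have "(\<integral>\<^sup>+y. ?F y * indicator {0..real n} y \<partial>lborel) = (\<integral>\<^sup>+(y::real). 0 \<partial>lborel)"
        using True by (intro nn_integral_cong) (auto simp: indicator_def)
      then show ?thesis by simp
    next
      case False
      have "(\<integral>\<^sup>+y. H y * indicator {a * 0\<^sup>2 + m..a * (real n)\<^sup>2 + m} y \<partial>lborel)
        = (\<integral>\<^sup>+y. H (a * y\<^sup>2 + m) * ennreal (2 * a * y) * indicator {0..real n} y \<partial>lborel)"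
        using a False
        by (intro nn_integral_substitution_aux[where g = "\<lambda>y. a * y\<^sup>2 + m"])
           (auto intro!: derivative_eq_intros continuous_intros)
      then have "(\<integral>\<^sup>+y. ?F y * indicator {0..real n} y \<partial>lborel)
          = (\<integral>\<^sup>+y. H y * indicator {a * 0\<^sup>2 + m..a * (real n)\<^sup>2 + m} y \<partial>lborel)"
        by (simp add: mult_ac)
      also have "\<dots> \<le> (\<integral>\<^sup>+y. H y \<partial>lborel)"
        by (intro nn_integral_mono) (auto simp: indicator_def)
      finally show ?thesis .
    qed
  qed
  finally show ?thesis .
qed

text \<open>For a < 0 the reflection of H reduces the claim to the leading coefficient - a >
  0.\<close>

lemma nn_integral_square_subst:
  fixes H :: "real \<Rightarrow> ennreal"
  assumes [measurable]: "H \<in> borel_measurable borel" and a: "a \<noteq> 0"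
  shows "(\<integral>\<^sup>+y. ennreal \<bar>2 * a * y\<bar> * H (a * y\<^sup>2 + m) * indicator {0..} y \<partial>lborel) \<le> (\<integral>\<^sup>+y. H y \<partial>lborel)"
proof (cases "0 < a")
  case True
  have "(\<integral>\<^sup>+y. ennreal \<bar>2 * a * y\<bar> * H (a * y\<^sup>2 + m) * indicator {0..} y \<partial>lborel)
    = (\<integral>\<^sup>+y. ennreal (2 * a * y) * H (a * y\<^sup>2 + m) * indicator {0..} y \<partial>lborel)"
    using True by (intro nn_integral_cong) (auto simp: indicator_def)
  then show ?thesis using nn_integral_square_subst_aux[of H a m] True by simp
next
  case False
  have "(\<integral>\<^sup>+y. ennreal \<bar>2 * a * y\<bar> * H (a * y\<^sup>2 + m) * indicator {0..} y \<partial>lborel)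
    = (\<integral>\<^sup>+y. ennreal (2 * (- a) * y) * H (- ((- a) * y\<^sup>2 + (- m))) * indicator {0..} y \<partial>lborel)"
    using False by (intro nn_integral_cong) (auto simp: indicator_def abs_mult add.commute)
  also have "\<dots> \<le> (\<integral>\<^sup>+y. H (- y) \<partial>lborel)"
    using nn_integral_square_subst_aux[of "\<lambda>y. H (- y)" "- a" "- m"] False a by simp
  also have "\<dots> = (\<integral>\<^sup>+y. H y \<partial>lborel)"
    using nn_integral_real_affine[of H "-1" 0] by simp
  finally show ?thesis .
qed

lemma nn_integral_quadratic_subst:
  fixes H :: "real \<Rightarrow> ennreal"
  assumes [measurable]: "H \<in> borel_measurable borel" and a: "a \<noteq> 0"
  shows "(\<integral>\<^sup>+x. ennreal \<bar>2 * a * x + b\<bar> * H (a * x\<^sup>2 + b * x + m) \<partial>lborel) \<le> 2 * (\<integral>\<^sup>+y. H y \<partial>lborel)"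
proof -
  define m' where "m' = m - b\<^sup>2 / (4 * a)"
  have "(\<integral>\<^sup>+x. ennreal \<bar>2 * a * x + b\<bar> * H (a * x\<^sup>2 + b * x + m) \<partial>lborel)
     = (\<integral>\<^sup>+x. ennreal \<bar>2 * a * (- b / (2 * a) + 1 * x) + b\<bar>
            * H (a * (- b / (2 * a) + 1 * x)\<^sup>2 + b * (- b / (2 * a) + 1 * x) + m) \<partial>lborel)"
    by (subst nn_integral_real_affine[where c = 1 and t = "- b / (2 * a)"]) auto
  also have "\<dots> = (\<integral>\<^sup>+x. (\<lambda>x. ennreal \<bar>2 * a * x\<bar> * H (a * x\<^sup>2 + m')) \<bar>x\<bar> \<partial>lborel)"
  proof (intro nn_integral_cong)
    fix x :: real
    have 1: "2 * a * (- b / (2 * a) + 1 * x) + b = 2 * a * x"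
      using a by (simp add: field_simps)
    have 2: "a * (- b / (2 * a) + 1 * x)\<^sup>2 + b * (- b / (2 * a) + 1 * x) + m = a * x\<^sup>2 + m'"
      using a by (simp add: field_simps power2_eq_square m'_def)
    show "ennreal \<bar>2 * a * (- b / (2 * a) + 1 * x) + b\<bar>
            * H (a * (- b / (2 * a) + 1 * x)\<^sup>2 + b * (- b / (2 * a) + 1 * x) + m)
        = (\<lambda>x. ennreal \<bar>2 * a * x\<bar> * H (a * x\<^sup>2 + m')) \<bar>x\<bar>"
      unfolding 1 2 by (simp add: abs_mult)
  qed
  also have "\<dots> \<le> 2 * (\<integral>\<^sup>+x. ennreal \<bar>2 * a * x\<bar> * H (a * x\<^sup>2 + m') * indicator {0..} x \<partial>lborel)"
    by (rule nn_integral_even) auto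
  also have "\<dots> \<le> 2 * (\<integral>\<^sup>+y. H y \<partial>lborel)"
    by (intro mult_left_mono nn_integral_square_subst a) auto
  finally show ?thesis .
qed

text \<open>Without two distinct real roots, the quadratic dominates the square centred at its
  vertex. With two roots it is |a| times the product of the distances to them, which is at least the
  square of the smaller distance. The points y1 and y2 depend on b and m, but bounds uniform in the
  centre do not notice this.\<close>

lemma quadratic_ge_square_dist:
  fixes a b m :: real
  assumes a: "a \<noteq> 0"
  obtains y1 y2 where
    "\<And>x. \<bar>a\<bar> * (x - y1)\<^sup>2 \<le> \<bar>a * x\<^sup>2 + b * x + m\<bar> \<or> \<bar>a\<bar> * (x - y2)\<^sup>2 \<le> \<bar>a * x\<^sup>2 + b * x + m\<bar>"
proof -
  \<comment> \<open>\<open>x0\<close> is the vertex and \<open>D\<close> the discriminant divided by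
    4 a^2.\<close>
  define x0 where "x0 = - b / (2 * a)"
  define D where "D = (b / (2 * a))\<^sup>2 - m / a"
  have *: "a * x\<^sup>2 + b * x + m = a * ((x - x0)\<^sup>2 - D)" for x
    using a by (simp add: x0_def D_def field_simps power2_eq_square)
  show ?thesis
  proof (cases "D \<le> 0")
    case True
    then have "\<bar>a\<bar> * (x - x0)\<^sup>2 \<le> \<bar>a * x\<^sup>2 + b * x + m\<bar>" for x
      unfolding * abs_mult by (intro mult_left_mono) auto
    then show ?thesis using that by blast
  next
    case False
    define y1 where "y1 = x0 + sqrt D"
    define y2 where "y2 = x0 - sqrt D"
    have "(x - x0)\<^sup>2 - D = (x - y1) * (x - y2)" for x
      using False by (simp add: y1_def y2_def algebra_simps power2_eq_square)
    then have **: "\<bar>a * x\<^sup>2 + b * x + m\<bar> = \<bar>a\<bar> * (\<bar>x - y1\<bar> * \<bar>x - y2\<bar>)" for x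
      unfolding * by (simp add: abs_mult)
    have "(x - y1)\<^sup>2 \<le> \<bar>x - y1\<bar> * \<bar>x - y2\<bar> \<or> (x - y2)\<^sup>2 \<le> \<bar>x - y1\<bar> * \<bar>x - y2\<bar>" for x
    proof (cases "\<bar>x - y1\<bar> \<le> \<bar>x - y2\<bar>")
      case True
      then have "\<bar>x - y1\<bar> * \<bar>x - y1\<bar> \<le> \<bar>x - y1\<bar> * \<bar>x - y2\<bar>" by (intro mult_left_mono) auto
      then show ?thesis by (simp add: power2_eq_square abs_mult_self_eq)
    next
      case False
      then have "\<bar>x - y2\<bar> * \<bar>x - y2\<bar> \<le> \<bar>x - y1\<bar> * \<bar>x - y2\<bar>" by (intro mult_right_mono) auto
      then show ?thesis by (simp add: power2_eq_square abs_mult_self_eq)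
    qed
    then show ?thesis using that[of y1 y2] unfolding ** by (meson abs_ge_zero mult_left_mono)
  qed
qed

text \<open>From (1 + |d|)^2 \<le> 2 (1 + d^2). The minimum with 1 lets one constant serve both the
  summand 1 and the quadratic summand of the bracket.\<close>

lemma bracket_ge_bracket_square:
  assumes "\<bar>a\<bar> * d\<^sup>2 \<le> \<bar>z\<bar>"
  shows "min 1 \<bar>a\<bar> / 2 * (bracket d)\<^sup>2 \<le> bracket z"
proof -
  have "(bracket d)\<^sup>2 \<le> 2 * (1 + d\<^sup>2)"
    using sum_squares_ge_zero[of "\<bar>d\<bar> - 1" 0] by (simp add: bracket_def power2_eq_square algebra_simps)
  then have "min 1 \<bar>a\<bar> / 2 * (bracket d)\<^sup>2 \<le> min 1 \<bar>a\<bar> / 2 * (2 * (1 + d\<^sup>2))"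
    by (intro mult_left_mono) auto
  also have "\<dots> = min 1 \<bar>a\<bar> + min 1 \<bar>a\<bar> * d\<^sup>2" by (simp add: algebra_simps)
  also have "\<dots> \<le> 1 + \<bar>a\<bar> * d\<^sup>2" by (intro add_mono mult_right_mono) auto
  finally show ?thesis using assms by (simp add: bracket_def)
qed

text \<open>By the distance bound, the power - k of the bracket of a quadratic is controlled by the
  power - 2k of a bracket centred at one of two points. As 2k < 1, this grows like R^(1 - 2k) when
  integrated up to R, with a constant independent of b and m.\<close>

lemma nn_integral_quadratic_bracket:
  assumes a: "a \<noteq> 0" and k: "0 < k" "k < 1/2"
  shows "\<exists>C>0. \<forall>b m R. 0 \<le> R \<longrightarrow>
    (\<integral>\<^sup>+x. ennreal (bracket (a * x\<^sup>2 + b * x + m) powr (- k)) * indicator {-R..R} x \<partial>lborel)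
      \<le> ennreal (C * bracket R powr (1 - 2 * k))"
proof -
  define c where "c = min 1 \<bar>a\<bar> / 2"
  have c: "0 < c" using a by (simp add: c_def)
  \<comment> \<open>\<open>c powr (- k)\<close> comes from the square bound, the factor 2 from the
    two centres, the rest from the translated integral.\<close>
  define C where "C = c powr (- k) * (2 * (2 / (1 - 2 * k) + 2))"
  have pw: "bracket z powr (- k) \<le> c powr (- k) * bracket d powr (- (2 * k))"
    if "\<bar>a\<bar> * d\<^sup>2 \<le> \<bar>z\<bar>" for z d
  proof -
    have "bracket z powr (- k) \<le> (c * (bracket d)\<^sup>2) powr (- k)"
      using bracket_ge_bracket_square[OF that] k c bracket_pos[of d] unfolding c_def[symmetric]
      by (intro powr_mono2') auto
    also have "\<dots> = c powr (- k) * bracket d powr (- (2 * k))"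
      using c bracket_pos[of d] by (simp add: powr_mult powr_powr flip: powr_numeral)
    finally show ?thesis .
  qed
  show ?thesis
  proof (intro exI[of _ C] conjI allI impI)
    show "0 < C" using c k by (simp add: C_def add_pos_pos)
    fix b m R :: real assume R: "0 \<le> R"
    obtain y1 y2 where y: "\<And>x. \<bar>a\<bar> * (x - y1)\<^sup>2 \<le> \<bar>a * x\<^sup>2 + b * x + m\<bar> \<or> \<bar>a\<bar> * (x - y2)\<^sup>2 \<le> \<bar>a * x\<^sup>2 + b * x + m\<bar>"
      by (rule quadratic_ge_square_dist[OF a, of b m]) blast
    let ?J = "\<lambda>y. (\<integral>\<^sup>+x. ennreal (bracket (x - y) powr (- (2 * k))) * indicator {-R..R} x \<partial>lborel)"
    have "bracket (a * x\<^sup>2 + b * x + m) powr (- k)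
        \<le> c powr (- k) * (bracket (x - y1) powr (- (2 * k)) + bracket (x - y2) powr (- (2 * k)))" for x
      using y[of x]
    proof
      assume "\<bar>a\<bar> * (x - y1)\<^sup>2 \<le> \<bar>a * x\<^sup>2 + b * x + m\<bar>"
      then have "bracket (a * x\<^sup>2 + b * x + m) powr (- k) \<le> c powr (- k) * bracket (x - y1) powr (- (2 * k))"
        by (rule pw)
      also have "\<dots> \<le> c powr (- k) * (bracket (x - y1) powr (- (2 * k)) + bracket (x - y2) powr (- (2 * k)))"
        by (intro mult_left_mono) auto
      finally show ?thesis .
    next
      assume "\<bar>a\<bar> * (x - y2)\<^sup>2 \<le> \<bar>a * x\<^sup>2 + b * x + m\<bar>"
      then have "bracket (a * x\<^sup>2 + b * x + m) powr (- k) \<le> c powr (- k) * bracket (x - y2) powr (- (2 * k))"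
        by (rule pw)
      also have "\<dots> \<le> c powr (- k) * (bracket (x - y1) powr (- (2 * k)) + bracket (x - y2) powr (- (2 * k)))"
        by (intro mult_left_mono) auto
      finally show ?thesis .
    qed
    then have "(\<integral>\<^sup>+x. ennreal (bracket (a * x\<^sup>2 + b * x + m) powr (- k)) * indicator {-R..R} x \<partial>lborel)
      \<le> (\<integral>\<^sup>+x. ennreal (c powr (- k)) * (ennreal (bracket (x - y1) powr (- (2 * k))) * indicator {-R..R} x
            + ennreal (bracket (x - y2) powr (- (2 * k))) * indicator {-R..R} x) \<partial>lborel)"
      by (intro nn_integral_mono) (auto simp: indicator_def simp flip: ennreal_mult' ennreal_plus intro!: ennreal_leI)
    also have "\<dots> = ennreal (c powr (- k)) * (?J y1 + ?J y2)"
      by (simp add: nn_integral_cmult nn_integral_add)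
    also have "\<dots> \<le> ennreal (c powr (- k)) * (ennreal ((2 / (1 - 2 * k) + 2) * bracket R powr (1 - 2 * k))
        + ennreal ((2 / (1 - 2 * k) + 2) * bracket R powr (1 - 2 * k)))"
      using k R by (intro mult_left_mono add_mono nn_integral_bracket_powr_Icc_shift) auto
    also have "\<dots> = ennreal (C * bracket R powr (1 - 2 * k))"
      using k by (simp add: C_def algebra_simps flip: ennreal_mult' ennreal_plus)
    finally show "(\<integral>\<^sup>+x. ennreal (bracket (a * x\<^sup>2 + b * x + m) powr (- k)) * indicator {-R..R} x \<partial>lborel)
      \<le> ennreal (C * bracket R powr (1 - 2 * k))" .
  qed
qed

text \<open>The constraint on x^2 makes it affordable to bound the weight \<open>bracket x\<close>
  by a multiple of S^(1/2), with no help from a Jacobian. With the inner integral this gives S^(1/2)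
  S^((1 - 2k)/2) = S^(1 - k), and the integral over s contributes S^(1 - p).\<close>

lemma double_integral_small:
  assumes a: "a \<noteq> 0" and p: "p < 1" and k: "0 < k" "k < 1/2" and K: "0 \<le> K"
  shows "\<exists>C>0. \<forall>b m S. 0 \<le> S \<longrightarrow>
    (\<integral>\<^sup>+s. \<integral>\<^sup>+x. (if \<bar>s\<bar> \<le> S \<and> x\<^sup>2 \<le> K * bracket S
        then ennreal (bracket x * bracket s powr (- p) * bracket (s - (a * x\<^sup>2 + b * x + m)) powr (- k)) else 0) \<partial>lborel \<partial>lborel)
      \<le> ennreal (C * bracket S powr (2 - p - k))"
proof -
  obtain C0 where C0: "0 < C0" and Q: "\<And>b m R. 0 \<le> R \<Longrightarrow>
    (\<integral>\<^sup>+x. ennreal (bracket ((- a) * x\<^sup>2 + b * x + m) powr (- k)) * indicator {-R..R} x \<partial>lborel)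
      \<le> ennreal (C0 * bracket R powr (1 - 2 * k))"
    using nn_integral_quadratic_bracket[of "- a" k] a k by auto
  \<comment> \<open>\<open>L\<close> absorbs the passage from \<open>bracket R\<close> to
    \<open>B powr (1/2)\<close>, where \<open>R\<close> is the square root of K B and 1 \<le>
    B.\<close>
  define L where "L = 1 + sqrt K"
  have L: "1 \<le> L" using K by (simp add: L_def)
  define C where "C = L * C0 * L powr (1 - 2 * k) * (2 / (1 - p))"
  show ?thesis
  proof (intro exI[of _ C] conjI allI impI)
    show "0 < C" using C0 L p by (simp add: C_def)
    fix b m S :: real assume S: "0 \<le> S"
    define B where "B = bracket S"
    define R where "R = sqrt (K * B)"
    have B: "1 \<le> B" by (simp add: B_def bracket_ge_1)
    have R0: "0 \<le> R" using K B by (simp add: R_def)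
    have BR: "bracket R \<le> L * B powr (1/2)"
    proof -
      have "1 \<le> B powr (1/2)" using B by (simp add: ge_one_powr_ge_zero)
      then show ?thesis
        using K B R0 by (simp add: bracket_def R_def L_def powr_half_sqrt real_sqrt_mult algebra_simps)
    qed
    have inner: "(\<integral>\<^sup>+x. (if x\<^sup>2 \<le> K * B then ennreal (bracket x * bracket (s - (a * x\<^sup>2 + b * x + m)) powr (- k)) else 0) \<partial>lborel)
      \<le> ennreal (L * C0 * L powr (1 - 2 * k) * B powr (1 - k))" (is "?I \<le> _") for s
    proof -
      have "?I \<le> (\<integral>\<^sup>+x. ennreal (bracket R) * (ennreal (bracket ((- a) * x\<^sup>2 + (- b) * x + (s - m)) powr (- k)) * indicator {-R..R} x) \<partial>lborel)"
      proof (intro nn_integral_mono)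
        fix x :: real
        show "(if x\<^sup>2 \<le> K * B then ennreal (bracket x * bracket (s - (a * x\<^sup>2 + b * x + m)) powr (- k)) else 0)
          \<le> ennreal (bracket R) * (ennreal (bracket ((- a) * x\<^sup>2 + (- b) * x + (s - m)) powr (- k)) * indicator {-R..R} x)"
        proof (cases "x\<^sup>2 \<le> K * B")
          case True
          then have xR: "\<bar>x\<bar> \<le> R" unfolding R_def by (metis real_sqrt_abs real_sqrt_le_iff)
          have "bracket x \<le> bracket R" using xR R0 by (intro bracket_mono) simp
          moreover have eq: "s - (a * x\<^sup>2 + b * x + m) = (- a) * x\<^sup>2 + (- b) * x + (s - m)" by simp
          ultimately have "bracket x * bracket (s - (a * x\<^sup>2 + b * x + m)) powr (- k)
              \<le> bracket R * bracket ((- a) * x\<^sup>2 + (- b) * x + (s - m)) powr (- k)"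
            unfolding eq by (intro mult_right_mono) auto
          from ennreal_leI[OF this] show ?thesis using True xR bracket_pos[of R]
            by (auto simp: indicator_def ennreal_mult')
        qed simp
      qed
      also have "\<dots> \<le> ennreal (bracket R) * ennreal (C0 * bracket R powr (1 - 2 * k))"
        using Q[OF R0, of "- b" "s - m"] by (subst nn_integral_cmult) (auto intro!: mult_left_mono)
      also have "\<dots> = ennreal (bracket R * (C0 * bracket R powr (1 - 2 * k)))"
        using bracket_pos[of R] by (simp add: ennreal_mult')
      also have "\<dots> \<le> ennreal ((L * B powr (1/2)) * (C0 * (L * B powr (1/2)) powr (1 - 2 * k)))"
        using BR bracket_pos[of R] k C0 by (intro ennreal_leI mult_mono powr_mono2) auto
      also have "(L * B powr (1/2)) * (C0 * (L * B powr (1/2)) powr (1 - 2 * k))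
          = L * C0 * L powr (1 - 2 * k) * (B powr (1/2) * B powr (1/2 * (1 - 2 * k)))"
        using L by (simp add: powr_mult powr_powr)
      also have "B powr (1/2) * B powr (1/2 * (1 - 2 * k)) = B powr (1 - k)"
        unfolding powr_add[symmetric] by (simp add: algebra_simps)
      finally show ?thesis .
    qed
    have "(\<integral>\<^sup>+s. \<integral>\<^sup>+x. (if \<bar>s\<bar> \<le> S \<and> x\<^sup>2 \<le> K * bracket S
        then ennreal (bracket x * bracket s powr (- p) * bracket (s - (a * x\<^sup>2 + b * x + m)) powr (- k)) else 0) \<partial>lborel \<partial>lborel)
      \<le> (\<integral>\<^sup>+s. ennreal (L * C0 * L powr (1 - 2 * k) * B powr (1 - k)) * (ennreal (bracket s powr (- p)) * indicator {-S..S} s) \<partial>lborel)"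
    proof (intro nn_integral_mono)
      fix s :: real
      have "(\<integral>\<^sup>+x. (if \<bar>s\<bar> \<le> S \<and> x\<^sup>2 \<le> K * bracket S
        then ennreal (bracket x * bracket s powr (- p) * bracket (s - (a * x\<^sup>2 + b * x + m)) powr (- k)) else 0) \<partial>lborel)
        = (\<integral>\<^sup>+x. ennreal (bracket s powr (- p)) * indicator {-S..S} s
           * (if x\<^sup>2 \<le> K * B then ennreal (bracket x * bracket (s - (a * x\<^sup>2 + b * x + m)) powr (- k)) else 0) \<partial>lborel)"
        unfolding B_def[symmetric]
        by (intro nn_integral_cong) (auto simp: indicator_def mult_ac simp flip: ennreal_mult')
      also have "\<dots> = ennreal (bracket s powr (- p)) * indicator {-S..S} s
           * (\<integral>\<^sup>+x. (if x\<^sup>2 \<le> K * B then ennreal (bracket x * bracket (s - (a * x\<^sup>2 + b * x + m)) powr (- k)) else 0) \<partial>lborel)"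
        by (subst nn_integral_cmult) auto
      also have "\<dots> \<le> ennreal (bracket s powr (- p)) * indicator {-S..S} s * ennreal (L * C0 * L powr (1 - 2 * k) * B powr (1 - k))"
        by (intro mult_left_mono inner) auto
      finally show "(\<integral>\<^sup>+x. (if \<bar>s\<bar> \<le> S \<and> x\<^sup>2 \<le> K * bracket S
        then ennreal (bracket x * bracket s powr (- p) * bracket (s - (a * x\<^sup>2 + b * x + m)) powr (- k)) else 0) \<partial>lborel)
        \<le> ennreal (L * C0 * L powr (1 - 2 * k) * B powr (1 - k)) * (ennreal (bracket s powr (- p)) * indicator {-S..S} s)"
        by (simp add: mult_ac)
    qed
    also have "\<dots> = ennreal (L * C0 * L powr (1 - 2 * k) * B powr (1 - k))
        * (\<integral>\<^sup>+s. ennreal (bracket s powr (- p)) * indicator {-S..S} s \<partial>lborel)"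
      by (subst nn_integral_cmult) auto
    also have "\<dots> \<le> ennreal (L * C0 * L powr (1 - 2 * k) * B powr (1 - k)) * ennreal (2 / (1 - p) * B powr (1 - p))"
      unfolding B_def by (intro mult_left_mono nn_integral_bracket_powr_Icc p S) auto
    also have "\<dots> = ennreal (C * (B powr (1 - k) * B powr (1 - p)))"
      using L C0 by (subst ennreal_mult'[symmetric]) (auto simp: C_def mult_ac)
    also have "B powr (1 - k) * B powr (1 - p) = B powr (2 - p - k)"
      unfolding powr_add[symmetric] by (simp add: algebra_simps)
    finally show "(\<integral>\<^sup>+s. \<integral>\<^sup>+x. (if \<bar>s\<bar> \<le> S \<and> x\<^sup>2 \<le> K * bracket S
        then ennreal (bracket x * bracket s powr (- p) * bracket (s - (a * x\<^sup>2 + b * x + m)) powr (- k)) else 0) \<partial>lborel \<partial>lborel)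
      \<le> ennreal (C * bracket S powr (2 - p - k))" unfolding B_def .
  qed
qed

text \<open>Away from the critical point of the phase, the weight \<open>bracket x\<close> is absorbed into the Jacobian of the
  substitution.\<close>

lemma double_integral_jacobian:
  fixes \<phi> \<phi>' w :: "real \<Rightarrow> real"
  assumes [measurable]: "\<phi> \<in> borel_measurable borel" "\<phi>' \<in> borel_measurable borel" "w \<in> borel_measurable borel"
    and subst: "\<And>G :: real \<Rightarrow> ennreal. G \<in> borel_measurable borel \<Longrightarrow>
      (\<integral>\<^sup>+x. ennreal \<bar>\<phi>' x\<bar> * G (\<phi> x) \<partial>lborel) \<le> 2 * (\<integral>\<^sup>+y. G y \<partial>lborel)"
    and p: "p < 1" and q: "q < 1" and S: "0 \<le> S" and D: "0 \<le> D"
    and w: "\<And>x. P x \<Longrightarrow> w x \<le> D * \<bar>\<phi>' x\<bar>"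
    and P[measurable]: "Measurable.pred borel P"
  shows "(\<integral>\<^sup>+s. \<integral>\<^sup>+x. (if \<bar>s\<bar> \<le> S \<and> \<bar>s - \<phi> x\<bar> \<le> S \<and> P x
        then ennreal (w x * bracket s powr (- p) * bracket (s - \<phi> x) powr (- q)) else 0) \<partial>lborel \<partial>lborel)
      \<le> ennreal (8 * D / ((1 - p) * (1 - q)) * bracket S powr (2 - p - q))"
proof -
  define B where "B = bracket S"
  have inner: "(\<integral>\<^sup>+x. (if \<bar>s - \<phi> x\<bar> \<le> S \<and> P x
        then ennreal (w x * bracket (s - \<phi> x) powr (- q)) else 0) \<partial>lborel)
      \<le> ennreal (4 * D / (1 - q) * B powr (1 - q))" (is "?I \<le> _") for s
  proof -
    \<comment> \<open>As a function of the phase value y, this is a truncated bracket centred at s;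
      after the substitution its integral no longer depends on s.\<close>
    let ?G = "\<lambda>y. ennreal (bracket (y - s) powr (- q)) * indicator {-S..S} (y - s)"
    have "?I \<le> (\<integral>\<^sup>+x. ennreal D * (ennreal \<bar>\<phi>' x\<bar> * ?G (\<phi> x)) \<partial>lborel)"
    proof (intro nn_integral_mono)
      fix x
      show "(if \<bar>s - \<phi> x\<bar> \<le> S \<and> P x then ennreal (w x * bracket (s - \<phi> x) powr (- q)) else 0)
        \<le> ennreal D * (ennreal \<bar>\<phi>' x\<bar> * ?G (\<phi> x))"
      proof (cases "\<bar>s - \<phi> x\<bar> \<le> S \<and> P x")
        case True
        then have "\<phi> x - s \<in> {-S..S}" by auto
        moreover have "ennreal (w x * bracket (s - \<phi> x) powr (- q)) \<le> ennreal (D * \<bar>\<phi>' x\<bar> * bracket (s - \<phi> x) powr (- q))"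
          using True w[of x] by (intro ennreal_leI mult_right_mono) auto
        ultimately show ?thesis using True D
          by (simp add: bracket_diff_commute[of s] mult.assoc ennreal_mult')
      next
        case False
        then show ?thesis by (simp only: if_False) simp
      qed
    qed
    also have "\<dots> = ennreal D * (\<integral>\<^sup>+x. ennreal \<bar>\<phi>' x\<bar> * ?G (\<phi> x) \<partial>lborel)"
      by (subst nn_integral_cmult) auto
    also have "\<dots> \<le> ennreal D * (2 * (\<integral>\<^sup>+y. ?G y \<partial>lborel))"
      by (intro mult_left_mono subst) auto
    also have "(\<integral>\<^sup>+y. ?G y \<partial>lborel) = (\<integral>\<^sup>+y. ennreal (bracket y powr (- q)) * indicator {-S..S} y \<partial>lborel)"
      using nn_integral_real_affine[of "\<lambda>y. ennreal (bracket y powr (- q)) * indicator {-S..S} y" 1 "- s"] by simp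
    also have "\<dots> \<le> ennreal (2 / (1 - q) * B powr (1 - q))"
      unfolding B_def by (rule nn_integral_bracket_powr_Icc[OF q S])
    finally have "?I \<le> ennreal D * (2 * ennreal (2 / (1 - q) * B powr (1 - q)))"
      by (simp add: mult_left_mono)
    then show ?thesis using D by (simp add: ennreal_mult_numeral mult_ac flip: ennreal_mult')
  qed
  have "(\<integral>\<^sup>+s. \<integral>\<^sup>+x. (if \<bar>s\<bar> \<le> S \<and> \<bar>s - \<phi> x\<bar> \<le> S \<and> P x
        then ennreal (w x * bracket s powr (- p) * bracket (s - \<phi> x) powr (- q)) else 0) \<partial>lborel \<partial>lborel)
     \<le> (\<integral>\<^sup>+s. ennreal (4 * D / (1 - q) * B powr (1 - q)) * (ennreal (bracket s powr (- p)) * indicator {-S..S} s) \<partial>lborel)"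
  proof (intro nn_integral_mono)
    fix s :: real
    have "(\<integral>\<^sup>+x. (if \<bar>s\<bar> \<le> S \<and> \<bar>s - \<phi> x\<bar> \<le> S \<and> P x
        then ennreal (w x * bracket s powr (- p) * bracket (s - \<phi> x) powr (- q)) else 0) \<partial>lborel)
        = (\<integral>\<^sup>+x. ennreal (bracket s powr (- p)) * indicator {-S..S} s
           * (if \<bar>s - \<phi> x\<bar> \<le> S \<and> P x then ennreal (w x * bracket (s - \<phi> x) powr (- q)) else 0) \<partial>lborel)"
      by (intro nn_integral_cong) (auto simp: indicator_def mult_ac simp flip: ennreal_mult')
    also have "\<dots> = ennreal (bracket s powr (- p)) * indicator {-S..S} s
           * (\<integral>\<^sup>+x. (if \<bar>s - \<phi> x\<bar> \<le> S \<and> P x then ennreal (w x * bracket (s - \<phi> x) powr (- q)) else 0) \<partial>lborel)"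
      by (subst nn_integral_cmult) auto
    also have "\<dots> \<le> ennreal (bracket s powr (- p)) * indicator {-S..S} s * ennreal (4 * D / (1 - q) * B powr (1 - q))"
      by (intro mult_left_mono inner) auto
    finally show "(\<integral>\<^sup>+x. (if \<bar>s\<bar> \<le> S \<and> \<bar>s - \<phi> x\<bar> \<le> S \<and> P x
        then ennreal (w x * bracket s powr (- p) * bracket (s - \<phi> x) powr (- q)) else 0) \<partial>lborel)
      \<le> ennreal (4 * D / (1 - q) * B powr (1 - q)) * (ennreal (bracket s powr (- p)) * indicator {-S..S} s)"
      by (simp add: mult_ac)
  qed
  also have "\<dots> = ennreal (4 * D / (1 - q) * B powr (1 - q))
      * (\<integral>\<^sup>+s. ennreal (bracket s powr (- p)) * indicator {-S..S} s \<partial>lborel)"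
    by (subst nn_integral_cmult) auto
  also have "\<dots> \<le> ennreal (4 * D / (1 - q) * B powr (1 - q)) * ennreal (2 / (1 - p) * B powr (1 - p))"
    unfolding B_def by (intro mult_left_mono nn_integral_bracket_powr_Icc p S) auto
  also have "\<dots> = ennreal (8 * D / ((1 - p) * (1 - q)) * (B powr (1 - q) * B powr (1 - p)))"
    using D q by (subst ennreal_mult'[symmetric]) (auto simp: mult_ac)
  also have "B powr (1 - q) * B powr (1 - p) = B powr (2 - p - q)"
    unfolding powr_add[symmetric] by (simp add: algebra_simps)
  finally show ?thesis unfolding B_def .
qed

section \<open>The resonant region\<close>

text \<open>The quotient of the two sides is (u / v)^(p' - p), at most 1 because u \<le> v. Decay in
  the larger bracket is traded for decay in the smaller one at constant total exponent.\<close>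

lemma powr_shift_to_smaller:
  fixes u v :: real
  assumes "1 \<le> u" "u \<le> v" "p \<le> p'" "p + q = p' + k"
  shows "u powr (- p) * v powr (- q) \<le> u powr (- p') * v powr (- k)"
proof -
  have q: "q = p' + k - p" using assms by simp
  have "u powr (- p) * v powr (- q) = u powr (- p') * v powr (- k) * (u powr (p' - p) * v powr (- (p' - p)))"
    using powr_add[of u "- p'" "p' - p"] powr_add[of v "- k" "- (p' - p)"] unfolding q by (simp add: algebra_simps)
  also have "\<dots> \<le> u powr (- p') * v powr (- k) * 1"
  proof (intro mult_left_mono)
    have "u powr (p' - p) * v powr (- (p' - p)) \<le> v powr (p' - p) * v powr (- (p' - p))"
      using assms by (intro mult_right_mono powr_mono2) auto
    then show "u powr (p' - p) * v powr (- (p' - p)) \<le> 1"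
      using assms by (simp flip: powr_add)
  qed auto
  finally show ?thesis by simp
qed

section \<open>Linearity and shears of iterated integrals\<close>

lemma nn_integral_iterated_add:
  fixes f g :: "real \<Rightarrow> real \<Rightarrow> ennreal"
  assumes [measurable]: "case_prod f \<in> borel_measurable (lborel \<Otimes>\<^sub>M lborel)"
    "case_prod g \<in> borel_measurable (lborel \<Otimes>\<^sub>M lborel)"
  shows "(\<integral>\<^sup>+s. \<integral>\<^sup>+x. f s x + g s x \<partial>lborel \<partial>lborel)
    = (\<integral>\<^sup>+s. \<integral>\<^sup>+x. f s x \<partial>lborel \<partial>lborel) + (\<integral>\<^sup>+s. \<integral>\<^sup>+x. g s x \<partial>lborel \<partial>lborel)"
proof -
  have [measurable]: "f s \<in> borel_measurable lborel" "g s \<in> borel_measurable lborel" for s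
    using assms[THEN measurable_Pair2] by auto
  show ?thesis by (simp add: nn_integral_add)
qed

lemma nn_integral_iterated_cmult:
  fixes f :: "real \<Rightarrow> real \<Rightarrow> ennreal"
  assumes [measurable]: "case_prod f \<in> borel_measurable (lborel \<Otimes>\<^sub>M lborel)"
  shows "(\<integral>\<^sup>+s. \<integral>\<^sup>+x. c * f s x \<partial>lborel \<partial>lborel) = c * (\<integral>\<^sup>+s. \<integral>\<^sup>+x. f s x \<partial>lborel \<partial>lborel)"
proof -
  have [measurable]: "f s \<in> borel_measurable lborel" for s
    using assms[THEN measurable_Pair2] by auto
  show ?thesis by (simp add: nn_integral_cmult)
qed

text \<open>For fixed x this is a translation in t, so the order of integration is exchanged twice
  around it. Its use is to make the modulation t + A x an integration variable while keeping the
  frequency x.\<close>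

lemma nn_integral_shear:
  fixes F :: "real \<Rightarrow> real \<Rightarrow> ennreal"
  assumes [measurable]: "case_prod F \<in> borel_measurable (lborel \<Otimes>\<^sub>M lborel)" "A \<in> borel_measurable borel"
  shows "(\<integral>\<^sup>+t. \<integral>\<^sup>+x. F (t + A x) x \<partial>lborel \<partial>lborel) = (\<integral>\<^sup>+s. \<integral>\<^sup>+x. F s x \<partial>lborel \<partial>lborel)"
proof -
  have [measurable]: "(\<lambda>s. F s x) \<in> borel_measurable borel" for x
    using measurable_Pair1[OF assms(1), of x] by simp
  have "(\<lambda>u. case_prod F (fst u + A (snd u), snd u)) \<in> borel_measurable (lborel \<Otimes>\<^sub>M lborel)"
    by (rule measurable_compose[OF _ assms(1)]) measurable
  then have [measurable]: "(\<lambda>(t, x). F (t + A x) x) \<in> borel_measurable (lborel \<Otimes>\<^sub>M lborel)"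
    by (simp add: case_prod_beta')
  have "(\<integral>\<^sup>+t. \<integral>\<^sup>+x. F (t + A x) x \<partial>lborel \<partial>lborel) = (\<integral>\<^sup>+x. \<integral>\<^sup>+t. F (t + A x) x \<partial>lborel \<partial>lborel)"
    by (rule lborel_pair.Fubini'[symmetric]) measurable
  also have "\<dots> = (\<integral>\<^sup>+x. \<integral>\<^sup>+s. F s x \<partial>lborel \<partial>lborel)"
  proof (rule nn_integral_cong)
    fix x
    show "(\<integral>\<^sup>+t. F (t + A x) x \<partial>lborel) = (\<integral>\<^sup>+s. F s x \<partial>lborel)"
      using nn_integral_real_affine[of "\<lambda>s. F s x" 1 "A x"] by (simp add: add.commute)
  qed
  also have "\<dots> = (\<integral>\<^sup>+s. \<integral>\<^sup>+x. F s x \<partial>lborel \<partial>lborel)"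
    by (rule lborel_pair.Fubini') measurable
  finally show ?thesis .
qed

text \<open>Where \<open>x\<^sup>2\<close> is at most the largest modulation, part of the exponent of the larger bracket is moved to
  the smaller one, until the latter has exponent \<open>1 - e\<close> and the former exponent \<open>k < 1/2\<close>.\<close>

lemma resonant_double_integral:
  fixes a p q r :: real
  assumes a: "a \<noteq> 0" and pqr: "p \<in> {1/2<..<1}" "q \<in> {1/2<..<1}" "r \<in> {1/2<..<1}" "p + q + r = 2"
  shows "\<exists>C>0. \<forall>b m.
    (\<integral>\<^sup>+s. \<integral>\<^sup>+x. (if \<bar>s\<bar> \<le> \<bar>m\<bar> \<and> \<bar>s - (a * x\<^sup>2 + b * x + m)\<bar> \<le> \<bar>m\<bar>
        then ennreal (bracket x * bracket m powr (- r) * bracket s powr (- p) * bracket (s - (a * x\<^sup>2 + b * x + m)) powr (- q))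
        else 0) \<partial>lborel \<partial>lborel) \<le> ennreal C"
proof -
  \<comment> \<open>The bounds by 1 - p and 1 - q keep 1 - e above both exponents, so decay is only
    ever moved towards the smaller bracket. The bound by r - 1/2 yields k < 1/2; there is room for
    it because r/2, the exponent before doubling, exceeds 1/4.\<close>
  define e where "e = min (min (1 - p) (1 - q)) ((r - 1/2) / 2)"
  have e: "0 < e" "e \<le> 1 - p" "e \<le> 1 - q" "e < r - 1/2"
    using pqr unfolding e_def by auto
  \<comment> \<open>The total exponent is preserved, (1 - e) + k = p + q, which makes k = 1 - r +
    e.\<close>
  define k where "k = p + q - 1 + e"
  have k: "0 < k" "k < 1/2" using e pqr by (auto simp: k_def)
  \<comment> \<open>6 / |a| is the constant of the region around the critical point, found below by
    contradiction; the 1 guarantees |x| > 1 outside x^2 \<le> K B.\<close>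
  define K where "K = max 1 (6 / \<bar>a\<bar>)"
  have K: "1 \<le> K" "6 / \<bar>a\<bar> \<le> K" by (auto simp: K_def)
  have [simp]: "bracket \<bar>m\<bar> = bracket m" for m by (simp add: bracket_def)
  obtain C1 where C1: "0 < C1" and S1: "\<And>b m S. 0 \<le> S \<Longrightarrow>
    (\<integral>\<^sup>+s. \<integral>\<^sup>+x. (if \<bar>s\<bar> \<le> S \<and> x\<^sup>2 \<le> K * bracket S
        then ennreal (bracket x * bracket s powr (- (1 - e)) * bracket (s - (a * x\<^sup>2 + b * x + m)) powr (- k)) else 0) \<partial>lborel \<partial>lborel)
      \<le> ennreal (C1 * bracket S powr (2 - (1 - e) - k))"
    using double_integral_small[of a "1 - e" k K] a e k K by auto
  obtain C2 where C2: "0 < C2" and S2: "\<And>b m S. 0 \<le> S \<Longrightarrow>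
    (\<integral>\<^sup>+s. \<integral>\<^sup>+x. (if \<bar>s\<bar> \<le> S \<and> x\<^sup>2 \<le> K * bracket S
        then ennreal (bracket x * bracket s powr (- (1 - e)) * bracket (s - ((- a) * x\<^sup>2 + b * x + m)) powr (- k)) else 0) \<partial>lborel \<partial>lborel)
      \<le> ennreal (C2 * bracket S powr (2 - (1 - e) - k))"
    using double_integral_small[of "- a" "1 - e" k K] a e k K by auto
  define C3 where "C3 = 8 * (4 / \<bar>a\<bar>) / ((1 - p) * (1 - q))"
  have C3: "0 < C3" using a pqr by (simp add: C3_def)
  have exp: "2 - (1 - e) - k = r" "2 - p - q = r" using pqr by (auto simp: k_def)
  show ?thesis
  proof (intro exI[of _ "C1 + C2 + C3"] conjI allI)
    show "0 < C1 + C2 + C3" using C1 C2 C3 by simp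
    fix b m :: real
    define \<phi> where "\<phi> x = a * x\<^sup>2 + b * x + m" for x
    have \<phi>_meas[measurable]: "\<phi> \<in> borel_measurable borel" unfolding \<phi>_def by measurable
    define B where "B = bracket m"
    have B: "1 \<le> B" by (simp add: B_def bracket_ge_1)
    \<comment> \<open>The points where the Jacobian dominates the weight. The constant is 2 / |a|
      from the lower bound for the derivative, times 2 from bracket x \<le> 2 |x|.\<close>
    define P where "P x \<longleftrightarrow> bracket x \<le> (4 / \<bar>a\<bar>) * \<bar>2 * a * x + b\<bar>" for x
    have P_meas[measurable]: "Measurable.pred borel P" unfolding P_def by measurable
    \<comment> \<open>\<open>?T1\<close> and \<open>?T2\<close> handle x^2 \<le> K B according to
      which of the two free modulations is the smaller; \<open>?T3\<close> handles the remaining x,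
      where the Jacobian will be shown to be large.\<close>
    let ?T1 = "\<lambda>s x. (if \<bar>s\<bar> \<le> \<bar>m\<bar> \<and> x\<^sup>2 \<le> K * B
        then ennreal (bracket x * bracket s powr (- (1 - e)) * bracket (s - \<phi> x) powr (- k)) else 0)"
    let ?T2 = "\<lambda>s x. (if \<bar>s - \<phi> x\<bar> \<le> \<bar>m\<bar> \<and> x\<^sup>2 \<le> K * B
        then ennreal (bracket x * bracket (s - \<phi> x) powr (- (1 - e)) * bracket s powr (- k)) else 0)"
    let ?T3 = "\<lambda>s x. (if \<bar>s\<bar> \<le> \<bar>m\<bar> \<and> \<bar>s - \<phi> x\<bar> \<le> \<bar>m\<bar> \<and> P x
        then ennreal (bracket x * bracket s powr (- p) * bracket (s - \<phi> x) powr (- q)) else 0)"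
    have I1: "(\<integral>\<^sup>+s. \<integral>\<^sup>+x. ?T1 s x \<partial>lborel \<partial>lborel) \<le> ennreal (C1 * B powr r)"
      using S1[of "\<bar>m\<bar>" b m] unfolding exp \<phi>_def B_def by simp
    have I3: "(\<integral>\<^sup>+s. \<integral>\<^sup>+x. ?T3 s x \<partial>lborel \<partial>lborel) \<le> ennreal (C3 * B powr r)"
    proof -
      have "(\<integral>\<^sup>+s. \<integral>\<^sup>+x. ?T3 s x \<partial>lborel \<partial>lborel)
          \<le> ennreal (8 * (4 / \<bar>a\<bar>) / ((1 - p) * (1 - q)) * bracket \<bar>m\<bar> powr (2 - p - q))"
        by (rule double_integral_jacobian[where \<phi>' = "\<lambda>x. 2 * a * x + b"])
           (use pqr a in \<open>auto simp: P_def \<phi>_def nn_integral_quadratic_subst\<close>)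
      then show ?thesis unfolding exp C3_def B_def by simp
    qed
    have I2: "(\<integral>\<^sup>+s. \<integral>\<^sup>+x. ?T2 s x \<partial>lborel \<partial>lborel) \<le> ennreal (C2 * B powr r)"
    proof -
      \<comment> \<open>The shear makes \<open>s - \<phi> x\<close> the integration variable, so the
        other modulation becomes \<open>s + \<phi> x\<close>. The quadratic changes its sign, and
        the bound prepared for - a applies.\<close>
      let ?U = "\<lambda>s x. (if \<bar>s\<bar> \<le> \<bar>m\<bar> \<and> x\<^sup>2 \<le> K * B
        then ennreal (bracket x * bracket s powr (- (1 - e)) * bracket (s + \<phi> x) powr (- k)) else 0)"
      have "(\<integral>\<^sup>+s. \<integral>\<^sup>+x. ?T2 s x \<partial>lborel \<partial>lborel) = (\<integral>\<^sup>+s. \<integral>\<^sup>+x. ?U (s + - \<phi> x) x \<partial>lborel \<partial>lborel)"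
        by (simp only: add_uminus_conv_diff diff_add_cancel)
      also have "\<dots> = (\<integral>\<^sup>+s. \<integral>\<^sup>+x. ?U s x \<partial>lborel \<partial>lborel)"
        by (rule nn_integral_shear[of ?U "\<lambda>x. - \<phi> x"]) measurable
      also have "\<dots> \<le> ennreal (C2 * B powr r)"
      proof -
        have eq: "s - ((- a) * x\<^sup>2 + (- b) * x + (- m)) = s + \<phi> x" for s x by (simp add: \<phi>_def)
        show ?thesis
          using S2[of "\<bar>m\<bar>" "- b" "- m"] unfolding exp B_def eq by simp
      qed
      finally show ?thesis .
    qed
    have sum3: "u \<le> u + v + w" "v \<le> u + v + w" "w \<le> u + v + w" for u v w :: ennreal
      by (simp_all add: add_increasing add_increasing2)
    have pw: "(if \<bar>s\<bar> \<le> \<bar>m\<bar> \<and> \<bar>s - \<phi> x\<bar> \<le> \<bar>m\<bar>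
        then ennreal (bracket x * bracket m powr (- r) * bracket s powr (- p) * bracket (s - \<phi> x) powr (- q)) else 0)
      \<le> ennreal (B powr (- r)) * (?T1 s x + ?T2 s x + ?T3 s x)" for s x
    proof (cases "\<bar>s\<bar> \<le> \<bar>m\<bar> \<and> \<bar>s - \<phi> x\<bar> \<le> \<bar>m\<bar>")
      case True
      have "ennreal (bracket x * (bracket s powr (- p) * bracket (s - \<phi> x) powr (- q))) \<le> ?T1 s x + ?T2 s x + ?T3 s x"
      proof (cases "x\<^sup>2 \<le> K * B")
        case x: True
        show ?thesis
        proof (cases "\<bar>s\<bar> \<le> \<bar>s - \<phi> x\<bar>")
          case le: True
          have "bracket s powr (- p) * bracket (s - \<phi> x) powr (- q) \<le> bracket s powr (- (1 - e)) * bracket (s - \<phi> x) powr (- k)"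
            using le e by (intro powr_shift_to_smaller bracket_ge_1 bracket_mono) (auto simp: k_def)
          then have "ennreal (bracket x * (bracket s powr (- p) * bracket (s - \<phi> x) powr (- q))) \<le> ?T1 s x"
            using True x bracket_pos[of x] by (auto intro!: ennreal_leI mult_left_mono simp: mult.assoc)
          then show ?thesis by (rule order_trans[OF _ sum3(1)])
        next
          case le: False
          have "bracket s powr (- p) * bracket (s - \<phi> x) powr (- q) \<le> bracket (s - \<phi> x) powr (- (1 - e)) * bracket s powr (- k)"
            using le e by (subst mult.commute, intro powr_shift_to_smaller bracket_ge_1 bracket_mono) (auto simp: k_def)
          then have "ennreal (bracket x * (bracket s powr (- p) * bracket (s - \<phi> x) powr (- q))) \<le> ?T2 s x"
            using True x bracket_pos[of x] by (auto intro!: ennreal_leI mult_left_mono simp: mult.assoc)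
          then show ?thesis by (rule order_trans[OF _ sum3(2)])
        qed
      next
        case False
        have xx: "K * B < x\<^sup>2" using False by simp
        have "1 * 1 \<le> K * B" using K B by (intro mult_mono) auto
        then have "1 < \<bar>x\<bar>\<^sup>2" using xx by simp
        then have x1: "1 < \<bar>x\<bar>" by (intro power2_less_imp_less[of 1]) auto
        \<comment> \<open>If the derivative 2 a x + b is small compared with a x, then a x + b,
          which differs from it by a x, is comparable to a x. Hence x (a x + b) = \<phi> x - m has
          size |a| x^2 / 2 at least. But |\<phi> x| \<le> 2 |m|, as a difference of two modulations
          bounded by |m|, so x^2 would fall below K B.\<close>
        have "\<bar>a\<bar> * \<bar>x\<bar> \<le> 2 * \<bar>2 * a * x + b\<bar>"
        proof (rule ccontr)
          assume "\<not> \<bar>a\<bar> * \<bar>x\<bar> \<le> 2 * \<bar>2 * a * x + b\<bar>"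
          then have "\<bar>a\<bar> * \<bar>x\<bar> / 2 \<le> \<bar>a * x\<bar> - \<bar>2 * a * x + b\<bar>" by (simp add: abs_mult)
          also have "\<dots> \<le> \<bar>a * x + b\<bar>" by linarith
          finally have "\<bar>x\<bar> * (\<bar>a\<bar> * \<bar>x\<bar> / 2) \<le> \<bar>x\<bar> * \<bar>a * x + b\<bar>" by (intro mult_left_mono) auto
          also have "\<dots> = \<bar>\<phi> x - m\<bar>" unfolding \<phi>_def abs_mult[symmetric] by (simp add: algebra_simps power2_eq_square)
          also have "\<dots> \<le> 3 * \<bar>m\<bar>" using True by linarith
          also have "\<dots> \<le> 3 * B" by (simp add: B_def bracket_def)
          finally have "\<bar>x\<bar> * (\<bar>a\<bar> * \<bar>x\<bar> / 2) \<le> 3 * B" .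
          moreover have "\<bar>a\<bar> * x\<^sup>2 = 2 * (\<bar>x\<bar> * (\<bar>a\<bar> * \<bar>x\<bar> / 2))"
            by (cases "0 \<le> x") (simp_all add: power2_eq_square)
          ultimately have "\<bar>a\<bar> * x\<^sup>2 \<le> 6 * B" by linarith
          then have "x\<^sup>2 \<le> 6 / \<bar>a\<bar> * B" using a by (simp add: field_simps)
          also have "\<dots> \<le> K * B" using K B by (intro mult_right_mono) auto
          finally show False using xx by simp
        qed
        then have "2 * \<bar>x\<bar> \<le> 4 / \<bar>a\<bar> * \<bar>2 * a * x + b\<bar>"
          using a by (simp add: pos_le_divide_eq mult.commute)
        then have "P x" using x1 unfolding P_def bracket_def by linarith
        then have "ennreal (bracket x * (bracket s powr (- p) * bracket (s - \<phi> x) powr (- q))) \<le> ?T3 s x"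
          using True by (simp add: mult.assoc)
        then show ?thesis by (rule order_trans[OF _ sum3(3)])
      qed
      then have "ennreal (B powr (- r)) * ennreal (bracket x * (bracket s powr (- p) * bracket (s - \<phi> x) powr (- q)))
         \<le> ennreal (B powr (- r)) * (?T1 s x + ?T2 s x + ?T3 s x)"
        by (rule mult_left_mono) simp
      then show ?thesis using True by (simp add: B_def mult_ac flip: ennreal_mult')
    next
      case False
      then show ?thesis by (simp only: if_False) simp
    qed
    have "(\<integral>\<^sup>+s. \<integral>\<^sup>+x. (if \<bar>s\<bar> \<le> \<bar>m\<bar> \<and> \<bar>s - \<phi> x\<bar> \<le> \<bar>m\<bar>
        then ennreal (bracket x * bracket m powr (- r) * bracket s powr (- p) * bracket (s - \<phi> x) powr (- q)) else 0) \<partial>lborel \<partial>lborel)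
      \<le> (\<integral>\<^sup>+s. \<integral>\<^sup>+x. ennreal (B powr (- r)) * (?T1 s x + ?T2 s x + ?T3 s x) \<partial>lborel \<partial>lborel)"
      by (rule nn_integral_mono, rule nn_integral_mono, rule pw)
    also have "\<dots> = ennreal (B powr (- r)) * ((\<integral>\<^sup>+s. \<integral>\<^sup>+x. ?T1 s x \<partial>lborel \<partial>lborel)
       + (\<integral>\<^sup>+s. \<integral>\<^sup>+x. ?T2 s x \<partial>lborel \<partial>lborel) + (\<integral>\<^sup>+s. \<integral>\<^sup>+x. ?T3 s x \<partial>lborel \<partial>lborel))"
      by (subst nn_integral_iterated_cmult nn_integral_iterated_add, measurable)+
    also have "\<dots> \<le> ennreal (B powr (- r)) * (ennreal (C1 * B powr r) + ennreal (C2 * B powr r) + ennreal (C3 * B powr r))"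
      by (rule mult_left_mono[OF add_mono[OF add_mono[OF I1 I2] I3]]) simp
    also have "\<dots> = ennreal (B powr (- r) * (C1 * B powr r + C2 * B powr r + C3 * B powr r))"
      using C1 C2 C3 by (simp add: ennreal_mult')
    also have "B powr (- r) * (C1 * B powr r + C2 * B powr r + C3 * B powr r) = (C1 + C2 + C3) * (B powr (- r) * B powr r)"
      by (simp add: algebra_simps)
    also have "B powr (- r) * B powr r = 1" using B by (simp flip: powr_add)
    finally show "(\<integral>\<^sup>+s. \<integral>\<^sup>+x. (if \<bar>s\<bar> \<le> \<bar>m\<bar> \<and> \<bar>s - (a * x\<^sup>2 + b * x + m)\<bar> \<le> \<bar>m\<bar>
        then ennreal (bracket x * bracket m powr (- r) * bracket s powr (- p) * bracket (s - (a * x\<^sup>2 + b * x + m)) powr (- q))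
        else 0) \<partial>lborel \<partial>lborel) \<le> ennreal (C1 + C2 + C3)"
      unfolding \<phi>_def by simp
  qed
qed

lemma resonant_double_integral_signed:
  fixes a1 a2 p q r :: real
  assumes a: "a1 \<noteq> 0" "a2 \<noteq> 0"
    and pqr: "p \<in> {1/2<..<1}" "q \<in> {1/2<..<1}" "r \<in> {1/2<..<1}" "p + q + r = 2"
  shows "\<exists>C>0. \<forall>b m A \<phi>. A \<in> borel_measurable borel \<longrightarrow> (\<forall>x. \<phi> x = (if 0 \<le> x then a1 else a2) * x\<^sup>2 + b * x + m) \<longrightarrow>
    (\<integral>\<^sup>+t. \<integral>\<^sup>+x. (if \<bar>t + A x\<bar> \<le> \<bar>m\<bar> \<and> \<bar>t + A x - \<phi> x\<bar> \<le> \<bar>m\<bar>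
        then ennreal (bracket x * bracket m powr (- r) * bracket (t + A x) powr (- p) * bracket (t + A x - \<phi> x) powr (- q))
        else 0) \<partial>lborel \<partial>lborel) \<le> ennreal C"
proof -
  obtain C1 where C1: "0 < C1" and B1: "\<And>b m. 
    (\<integral>\<^sup>+s. \<integral>\<^sup>+x. (if \<bar>s\<bar> \<le> \<bar>m\<bar> \<and> \<bar>s - (a1 * x\<^sup>2 + b * x + m)\<bar> \<le> \<bar>m\<bar>
        then ennreal (bracket x * bracket m powr (- r) * bracket s powr (- p) * bracket (s - (a1 * x\<^sup>2 + b * x + m)) powr (- q))
        else 0) \<partial>lborel \<partial>lborel) \<le> ennreal C1"
    using resonant_double_integral[OF a(1) pqr] by auto
  obtain C2 where C2: "0 < C2" and B2: "\<And>b m. 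
    (\<integral>\<^sup>+s. \<integral>\<^sup>+x. (if \<bar>s\<bar> \<le> \<bar>m\<bar> \<and> \<bar>s - (a2 * x\<^sup>2 + b * x + m)\<bar> \<le> \<bar>m\<bar>
        then ennreal (bracket x * bracket m powr (- r) * bracket s powr (- p) * bracket (s - (a2 * x\<^sup>2 + b * x + m)) powr (- q))
        else 0) \<partial>lborel \<partial>lborel) \<le> ennreal C2"
    using resonant_double_integral[OF a(2) pqr] by auto
  show ?thesis
  proof (intro exI[of _ "C1 + C2"] conjI allI impI)
    show "0 < C1 + C2" using C1 C2 by simp
    fix b m :: real and A \<phi> :: "real \<Rightarrow> real"
    assume [measurable]: "A \<in> borel_measurable borel" 
      and \<phi>: "\<forall>x. \<phi> x = (if 0 \<le> x then a1 else a2) * x\<^sup>2 + b * x + m"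
    have "\<phi> = (\<lambda>x. (if 0 \<le> x then a1 else a2) * x\<^sup>2 + b * x + m)" using \<phi> by auto
    then have [measurable]: "\<phi> \<in> borel_measurable borel" by simp
    let ?Z = "\<lambda>\<phi> s x. (if \<bar>s\<bar> \<le> \<bar>m\<bar> \<and> \<bar>s - \<phi>\<bar> \<le> \<bar>m\<bar>
        then ennreal (bracket x * bracket m powr (- r) * bracket s powr (- p) * bracket (s - \<phi>) powr (- q)) else 0)"
    have "(\<integral>\<^sup>+t. \<integral>\<^sup>+x. ?Z (\<phi> x) (t + A x) x \<partial>lborel \<partial>lborel) = (\<integral>\<^sup>+s. \<integral>\<^sup>+x. ?Z (\<phi> x) s x \<partial>lborel \<partial>lborel)"
      by (rule nn_integral_shear[of "\<lambda>s x. ?Z (\<phi> x) s x" A]) measurable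
    also have "\<dots> \<le> (\<integral>\<^sup>+s. \<integral>\<^sup>+x. ?Z (a1 * x\<^sup>2 + b * x + m) s x + ?Z (a2 * x\<^sup>2 + b * x + m) s x \<partial>lborel \<partial>lborel)"
    proof (rule nn_integral_mono, rule nn_integral_mono)
      fix s x
      have *: "u \<le> u + v" "v \<le> u + v" for u v :: ennreal by (simp_all add: add_increasing add_increasing2)
      have "\<phi> x = a1 * x\<^sup>2 + b * x + m \<or> \<phi> x = a2 * x\<^sup>2 + b * x + m" using \<phi> by auto
      then show "?Z (\<phi> x) s x \<le> ?Z (a1 * x\<^sup>2 + b * x + m) s x + ?Z (a2 * x\<^sup>2 + b * x + m) s x"
        by (elim disjE ssubst) (rule *)+
    qed
    also have "\<dots> = (\<integral>\<^sup>+s. \<integral>\<^sup>+x. ?Z (a1 * x\<^sup>2 + b * x + m) s x \<partial>lborel \<partial>lborel)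
        + (\<integral>\<^sup>+s. \<integral>\<^sup>+x. ?Z (a2 * x\<^sup>2 + b * x + m) s x \<partial>lborel \<partial>lborel)"
      by (rule nn_integral_iterated_add) measurable
    also have "\<dots> \<le> ennreal C1 + ennreal C2" by (rule add_mono[OF B1 B2])
    finally show "(\<integral>\<^sup>+t. \<integral>\<^sup>+x. ?Z (\<phi> x) (t + A x) x \<partial>lborel \<partial>lborel) \<le> ennreal (C1 + C2)"
      using C1 C2 by simp
  qed
qed

section \<open>Trilinear forms\<close>

lemma nn_integral_lborel_translate:
  fixes f :: "'a::euclidean_space \<Rightarrow> ennreal"
  assumes [measurable]: "f \<in> borel_measurable borel"
  shows "(\<integral>\<^sup>+x. f (c + x) \<partial>lborel) = (\<integral>\<^sup>+x. f x \<partial>lborel)"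
  by (subst (2) lborel_distr_plus[symmetric, of c]) (simp add: nn_integral_distr)

lemma nn_integral_lborel_reflect:
  fixes f :: "'a::euclidean_space \<Rightarrow> ennreal"
  assumes [measurable]: "f \<in> borel_measurable borel"
  shows "(\<integral>\<^sup>+x. f (c - x) \<partial>lborel) = (\<integral>\<^sup>+x. f x \<partial>lborel)"
  by (subst (2) lborel_affine[of "-1" c]) (simp_all add: nn_integral_density nn_integral_distr)

text \<open>Cauchy-Schwarz on the product space, with p x * W x y against q x y. Since q depends on
  both variables, it can hold the product of the other two functions of a trilinear form.\<close>

lemma schur_test:
  fixes p :: "'a::euclidean_space \<Rightarrow> ennreal" and q W :: "'a \<Rightarrow> 'b::euclidean_space \<Rightarrow> ennreal"
  assumes [measurable]: "p \<in> borel_measurable borel"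
    "case_prod q \<in> borel_measurable (lborel \<Otimes>\<^sub>M lborel)" "case_prod W \<in> borel_measurable (lborel \<Otimes>\<^sub>M lborel)"
    and W: "\<And>x. (\<integral>\<^sup>+y. (W x y)\<^sup>2 \<partial>lborel) \<le> C"
  shows "(\<integral>\<^sup>+x. \<integral>\<^sup>+y. p x * q x y * W x y \<partial>lborel \<partial>lborel)\<^sup>2
    \<le> C * (\<integral>\<^sup>+x. (p x)\<^sup>2 \<partial>lborel) * (\<integral>\<^sup>+x. \<integral>\<^sup>+y. (q x y)\<^sup>2 \<partial>lborel \<partial>lborel)"
proof -
  let ?M = "lborel \<Otimes>\<^sub>M lborel :: ('a \<times> 'b) measure"
  have [measurable]: "q x \<in> borel_measurable lborel" "W x \<in> borel_measurable lborel" for x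
    using assms(2,3)[THEN measurable_Pair2] by auto
  have "(\<integral>\<^sup>+x. \<integral>\<^sup>+y. p x * q x y * W x y \<partial>lborel \<partial>lborel) = (\<integral>\<^sup>+z. (p (fst z) * case_prod W z) * case_prod q z \<partial>?M)"
    by (subst lborel.nn_integral_fst[symmetric]) (simp_all add: mult_ac)
  then have "(\<integral>\<^sup>+x. \<integral>\<^sup>+y. p x * q x y * W x y \<partial>lborel \<partial>lborel)\<^sup>2
      \<le> (\<integral>\<^sup>+z. (p (fst z) * case_prod W z)\<^sup>2 \<partial>?M) * (\<integral>\<^sup>+z. (case_prod q z)\<^sup>2 \<partial>?M)"
    by (simp only:) (rule Cauchy_Schwarz_nn_integral; measurable)
  also have "(\<integral>\<^sup>+z. (case_prod q z)\<^sup>2 \<partial>?M) = (\<integral>\<^sup>+x. \<integral>\<^sup>+y. (q x y)\<^sup>2 \<partial>lborel \<partial>lborel)"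
    by (subst lborel.nn_integral_fst[symmetric]) simp_all
  also have "(\<integral>\<^sup>+z. (p (fst z) * case_prod W z)\<^sup>2 \<partial>?M) = (\<integral>\<^sup>+x. \<integral>\<^sup>+y. (p x * W x y)\<^sup>2 \<partial>lborel \<partial>lborel)"
    by (subst lborel.nn_integral_fst[symmetric]) simp_all
  also have "\<dots> = (\<integral>\<^sup>+x. (p x)\<^sup>2 * (\<integral>\<^sup>+y. (W x y)\<^sup>2 \<partial>lborel) \<partial>lborel)"
    by (simp add: power_mult_distrib nn_integral_cmult)
  also have "\<dots> \<le> (\<integral>\<^sup>+x. (p x)\<^sup>2 * C \<partial>lborel)"
    by (intro nn_integral_mono mult_left_mono W) simp
  also have "\<dots> = C * (\<integral>\<^sup>+x. (p x)\<^sup>2 \<partial>lborel)"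
    by (subst nn_integral_multc) (simp_all add: mult.commute)
  finally show ?thesis by (simp add: mult_right_mono)
qed

text \<open>Boundedness of a trilinear form on three copies of L^2, squared so that no square roots
  in [0, \<infinity>] occur. The argument z of h is the sum of the arguments w and z - w of f and g.
  A real C makes the constant finite; a negative one acts as 0 under \<open>ennreal\<close>.\<close>

definition form_bound :: "('a::euclidean_space \<Rightarrow> 'a \<Rightarrow> ennreal) \<Rightarrow> bool" where
  "form_bound W \<longleftrightarrow> (\<exists>C::real. \<forall>f g h. f \<in> borel_measurable borel \<longrightarrow> g \<in> borel_measurable borel \<longrightarrow>
    h \<in> borel_measurable borel \<longrightarrow>
    (\<integral>\<^sup>+z. \<integral>\<^sup>+w. h z * f w * g (z - w) * W z w \<partial>lborel \<partial>lborel)\<^sup>2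
      \<le> ennreal C * (\<integral>\<^sup>+z. (h z)\<^sup>2 \<partial>lborel) * (\<integral>\<^sup>+z. (f z)\<^sup>2 \<partial>lborel) * (\<integral>\<^sup>+z. (g z)\<^sup>2 \<partial>lborel))"

lemma form_bound_mono:
  assumes "form_bound W'" "\<And>z w. W z w \<le> W' z w"
  shows "form_bound W"
proof -
  obtain C where C: "\<And>f g h. f \<in> borel_measurable borel \<Longrightarrow> g \<in> borel_measurable borel \<Longrightarrow>
    h \<in> borel_measurable borel \<Longrightarrow>
    (\<integral>\<^sup>+z. \<integral>\<^sup>+w. h z * f w * g (z - w) * W' z w \<partial>lborel \<partial>lborel)\<^sup>2
      \<le> ennreal C * (\<integral>\<^sup>+z. (h z)\<^sup>2 \<partial>lborel) * (\<integral>\<^sup>+z. (f z)\<^sup>2 \<partial>lborel) * (\<integral>\<^sup>+z. (g z)\<^sup>2 \<partial>lborel)"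
    using assms(1) unfolding form_bound_def by blast
  show ?thesis unfolding form_bound_def
  proof (intro exI allI impI)
    fix f g h :: "'a \<Rightarrow> ennreal"
    assume m: "f \<in> borel_measurable borel" "g \<in> borel_measurable borel" "h \<in> borel_measurable borel"
    have "(\<integral>\<^sup>+z. \<integral>\<^sup>+w. h z * f w * g (z - w) * W z w \<partial>lborel \<partial>lborel)
        \<le> (\<integral>\<^sup>+z. \<integral>\<^sup>+w. h z * f w * g (z - w) * W' z w \<partial>lborel \<partial>lborel)"
      by (intro nn_integral_mono mult_left_mono assms(2)) simp
    then show "(\<integral>\<^sup>+z. \<integral>\<^sup>+w. h z * f w * g (z - w) * W z w \<partial>lborel \<partial>lborel)\<^sup>2
      \<le> ennreal C * (\<integral>\<^sup>+z. (h z)\<^sup>2 \<partial>lborel) * (\<integral>\<^sup>+z. (f z)\<^sup>2 \<partial>lborel) * (\<integral>\<^sup>+z. (g z)\<^sup>2 \<partial>lborel)"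
      by (rule order_trans[OF power_mono_ennreal C[OF m]])
  qed
qed

lemma ennreal_add_power2_le:
  fixes x y :: ennreal
  shows "(x + y)\<^sup>2 \<le> 4 * x\<^sup>2 + 4 * y\<^sup>2"
proof -
  have "x + y \<le> 2 * max x y" by (simp add: mult_2 add_mono)
  then have "(x + y)\<^sup>2 \<le> (2 * max x y)\<^sup>2" by (rule power_mono_ennreal)
  also have "\<dots> = 4 * (max x y)\<^sup>2" by (simp add: power_mult_distrib)
  also have "\<dots> \<le> 4 * x\<^sup>2 + 4 * y\<^sup>2" by (auto simp: max_def add_increasing add_increasing2)
  finally show ?thesis .
qed

lemma form_bound_add:
  assumes V: "form_bound V" and W: "form_bound W"
    and [measurable]: "case_prod V \<in> borel_measurable (lborel \<Otimes>\<^sub>M lborel)" "case_prod W \<in> borel_measurable (lborel \<Otimes>\<^sub>M lborel)"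
  shows "form_bound (\<lambda>z w. V z w + W z w)"
proof -
  let ?I = "\<lambda>f g h W. (\<integral>\<^sup>+z. \<integral>\<^sup>+w. h z * f w * g (z - w) * W z w \<partial>lborel \<partial>lborel) :: ennreal"
  let ?N = "\<lambda>C f g h. ennreal C * (\<integral>\<^sup>+z. (h z)\<^sup>2 \<partial>lborel) * (\<integral>\<^sup>+z. (f z)\<^sup>2 \<partial>lborel) * (\<integral>\<^sup>+z. (g z)\<^sup>2 \<partial>lborel) :: ennreal"
  obtain C where C: "\<And>f g h. f \<in> borel_measurable borel \<Longrightarrow> g \<in> borel_measurable borel \<Longrightarrow>
    h \<in> borel_measurable borel \<Longrightarrow> (?I f g h V)\<^sup>2 \<le> ?N C f g h"
    using V unfolding form_bound_def by blast
  obtain D where D: "\<And>f g h. f \<in> borel_measurable borel \<Longrightarrow> g \<in> borel_measurable borel \<Longrightarrow>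
    h \<in> borel_measurable borel \<Longrightarrow> (?I f g h W)\<^sup>2 \<le> ?N D f g h"
    using W unfolding form_bound_def by blast
  have [measurable]: "V z \<in> borel_measurable lborel" "W z \<in> borel_measurable lborel" for z
    using assms(3,4)[THEN measurable_Pair2] by auto
  show ?thesis unfolding form_bound_def
  \<comment> \<open>C and D may be negative; the maxima make the sum of constants commute with
    \<open>ennreal\<close>.\<close>
  proof (intro exI[of _ "4 * max 0 C + 4 * max 0 D"] allI impI)
    fix f g h :: "'a \<Rightarrow> ennreal"
    assume m[measurable]: "f \<in> borel_measurable borel" "g \<in> borel_measurable borel" "h \<in> borel_measurable borel"
    have "?I f g h (\<lambda>z w. V z w + W z w) = ?I f g h V + ?I f g h W"
      by (simp add: distrib_left nn_integral_add)
    then have "(?I f g h (\<lambda>z w. V z w + W z w))\<^sup>2 \<le> 4 * (?I f g h V)\<^sup>2 + 4 * (?I f g h W)\<^sup>2"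
      by (simp only: ennreal_add_power2_le)
    also have "\<dots> \<le> 4 * (?N C f g h) + 4 * (?N D f g h)"
      by (intro add_mono mult_left_mono C D m) auto
    also have "\<dots> = (4 * ennreal C + 4 * ennreal D) *
      ((\<integral>\<^sup>+z. (h z)\<^sup>2 \<partial>lborel) * (\<integral>\<^sup>+z. (f z)\<^sup>2 \<partial>lborel) * (\<integral>\<^sup>+z. (g z)\<^sup>2 \<partial>lborel))"
      by (simp only: distrib_right mult.assoc)
    also have "4 * ennreal C + 4 * ennreal D = 4 * ennreal (max 0 C) + 4 * ennreal (max 0 D)"
      by (simp add: max_def ennreal_neg)
    also have "\<dots> = ennreal (4 * max 0 C + 4 * max 0 D)"
      unfolding ennreal_mult_numeral by (rule ennreal_plus[symmetric]) auto
    finally show "(?I f g h (\<lambda>z w. V z w + W z w))\<^sup>2 \<le> ennreal (4 * max 0 C + 4 * max 0 D) *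
      (\<integral>\<^sup>+z. (h z)\<^sup>2 \<partial>lborel) * (\<integral>\<^sup>+z. (f z)\<^sup>2 \<partial>lborel) * (\<integral>\<^sup>+z. (g z)\<^sup>2 \<partial>lborel)"
      by (simp only: mult.assoc)
  qed
qed

text \<open>With z frozen, f w * g (z - w) is the factor depending on both variables; by translation
  invariance its square integral over all pairs is the product of those of f and g.\<close>

lemma form_bound_fix_sum:
  assumes [measurable]: "case_prod W \<in> borel_measurable (lborel \<Otimes>\<^sub>M lborel)"
    and W: "\<And>z. (\<integral>\<^sup>+w. (W z w)\<^sup>2 \<partial>lborel) \<le> ennreal C"
  shows "form_bound W"
  unfolding form_bound_def
proof (intro exI[of _ C] allI impI)
  fix f g h :: "'a \<Rightarrow> ennreal"
  assume [measurable]: "f \<in> borel_measurable borel" "g \<in> borel_measurable borel" "h \<in> borel_measurable borel"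
  have "(\<integral>\<^sup>+z. \<integral>\<^sup>+w. h z * (f w * g (z - w)) * W z w \<partial>lborel \<partial>lborel)\<^sup>2
     \<le> ennreal C * (\<integral>\<^sup>+z. (h z)\<^sup>2 \<partial>lborel) * (\<integral>\<^sup>+z. \<integral>\<^sup>+w. (f w * g (z - w))\<^sup>2 \<partial>lborel \<partial>lborel)"
    by (rule schur_test) (use W in measurable)
  also have "(\<integral>\<^sup>+z. \<integral>\<^sup>+w. (f w * g (z - w))\<^sup>2 \<partial>lborel \<partial>lborel) = (\<integral>\<^sup>+w. \<integral>\<^sup>+z. (f w * g (z - w))\<^sup>2 \<partial>lborel \<partial>lborel)"
    by (rule lborel_pair.Fubini'[symmetric]) measurable
  also have "\<dots> = (\<integral>\<^sup>+w. (f w)\<^sup>2 * (\<integral>\<^sup>+z. (g (z - w))\<^sup>2 \<partial>lborel) \<partial>lborel)"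
    by (simp add: power_mult_distrib nn_integral_cmult)
  also have "\<dots> = (\<integral>\<^sup>+w. (f w)\<^sup>2 * (\<integral>\<^sup>+z. (g z)\<^sup>2 \<partial>lborel) \<partial>lborel)"
    using nn_integral_lborel_translate[of "\<lambda>z. (g z)\<^sup>2" "- w" for w] by simp
  also have "\<dots> = (\<integral>\<^sup>+w. (f w)\<^sup>2 \<partial>lborel) * (\<integral>\<^sup>+z. (g z)\<^sup>2 \<partial>lborel)"
    by (rule nn_integral_multc) measurable
  finally show "(\<integral>\<^sup>+z. \<integral>\<^sup>+w. h z * f w * g (z - w) * W z w \<partial>lborel \<partial>lborel)\<^sup>2
      \<le> ennreal C * (\<integral>\<^sup>+z. (h z)\<^sup>2 \<partial>lborel) * (\<integral>\<^sup>+z. (f z)\<^sup>2 \<partial>lborel) * (\<integral>\<^sup>+z. (g z)\<^sup>2 \<partial>lborel)"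
    by (simp only: mult.assoc)
qed

text \<open>The same argument with w frozen: the integrals are exchanged, and the square integral of
  h z * g (z - w) over all pairs splits by reflection in w.\<close>

lemma form_bound_fix_first:
  assumes [measurable]: "case_prod W \<in> borel_measurable (lborel \<Otimes>\<^sub>M lborel)"
    and W: "\<And>w. (\<integral>\<^sup>+z. (W z w)\<^sup>2 \<partial>lborel) \<le> ennreal C"
  shows "form_bound W"
  unfolding form_bound_def
proof (intro exI[of _ C] allI impI)
  fix f g h :: "'a \<Rightarrow> ennreal"
  assume [measurable]: "f \<in> borel_measurable borel" "g \<in> borel_measurable borel" "h \<in> borel_measurable borel"
  have "(\<integral>\<^sup>+z. \<integral>\<^sup>+w. h z * f w * g (z - w) * W z w \<partial>lborel \<partial>lborel)
      = (\<integral>\<^sup>+w. \<integral>\<^sup>+z. h z * f w * g (z - w) * W z w \<partial>lborel \<partial>lborel)"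
    by (rule lborel_pair.Fubini'[symmetric]) measurable
  also have "\<dots> = (\<integral>\<^sup>+w. \<integral>\<^sup>+z. f w * (h z * g (z - w)) * W z w \<partial>lborel \<partial>lborel)"
    by (simp only: mult.left_commute mult.commute mult.assoc)
  finally have "(\<integral>\<^sup>+z. \<integral>\<^sup>+w. h z * f w * g (z - w) * W z w \<partial>lborel \<partial>lborel)\<^sup>2
      = (\<integral>\<^sup>+w. \<integral>\<^sup>+z. f w * (h z * g (z - w)) * W z w \<partial>lborel \<partial>lborel)\<^sup>2" by simp
  also have "\<dots> \<le> ennreal C * (\<integral>\<^sup>+z. (f z)\<^sup>2 \<partial>lborel) * (\<integral>\<^sup>+w. \<integral>\<^sup>+z. (h z * g (z - w))\<^sup>2 \<partial>lborel \<partial>lborel)"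
    by (rule schur_test) (use W in measurable)
  also have "(\<integral>\<^sup>+w. \<integral>\<^sup>+z. (h z * g (z - w))\<^sup>2 \<partial>lborel \<partial>lborel) = (\<integral>\<^sup>+z. \<integral>\<^sup>+w. (h z * g (z - w))\<^sup>2 \<partial>lborel \<partial>lborel)"
    by (rule lborel_pair.Fubini') measurable
  also have "\<dots> = (\<integral>\<^sup>+z. (h z)\<^sup>2 * (\<integral>\<^sup>+w. (g (z - w))\<^sup>2 \<partial>lborel) \<partial>lborel)"
    by (simp add: power_mult_distrib nn_integral_cmult)
  also have "\<dots> = (\<integral>\<^sup>+z. (h z)\<^sup>2 * (\<integral>\<^sup>+w. (g w)\<^sup>2 \<partial>lborel) \<partial>lborel)"
    using nn_integral_lborel_reflect[of "\<lambda>z. (g z)\<^sup>2"] by simp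
  also have "\<dots> = (\<integral>\<^sup>+z. (h z)\<^sup>2 \<partial>lborel) * (\<integral>\<^sup>+z. (g z)\<^sup>2 \<partial>lborel)"
    by (rule nn_integral_multc) measurable
  finally show "(\<integral>\<^sup>+z. \<integral>\<^sup>+w. h z * f w * g (z - w) * W z w \<partial>lborel \<partial>lborel)\<^sup>2
      \<le> ennreal C * (\<integral>\<^sup>+z. (h z)\<^sup>2 \<partial>lborel) * (\<integral>\<^sup>+z. (f z)\<^sup>2 \<partial>lborel) * (\<integral>\<^sup>+z. (g z)\<^sup>2 \<partial>lborel)"
    by (simp only: mult_ac)
qed

text \<open>Here y = z - w is frozen. The substitution z = w + y makes y the outer variable, at the
  price of having to show that the sheared kernel is measurable.\<close>

lemma form_bound_fix_second:
  assumes [measurable]: "case_prod W \<in> borel_measurable (lborel \<Otimes>\<^sub>M lborel)"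
    and W: "\<And>y. (\<integral>\<^sup>+w. (W (w + y) w)\<^sup>2 \<partial>lborel) \<le> ennreal C"
  shows "form_bound W"
  unfolding form_bound_def
proof (intro exI[of _ C] allI impI)
  fix f g h :: "'a \<Rightarrow> ennreal"
  assume [measurable]: "f \<in> borel_measurable borel" "g \<in> borel_measurable borel" "h \<in> borel_measurable borel"
  have [measurable]: "(\<lambda>z. W z w) \<in> borel_measurable borel" for w
    using measurable_Pair1[OF assms(1), of w] by simp
  have [measurable]: "(\<lambda>(y, w). W (w + y) w) \<in> borel_measurable (lborel \<Otimes>\<^sub>M lborel)"
  proof -
    have "(\<lambda>u. case_prod W (snd u + fst u, snd u)) \<in> borel_measurable (lborel \<Otimes>\<^sub>M lborel)"
      by (rule measurable_compose[OF _ assms(1)]) measurable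
    then show ?thesis by (simp add: case_prod_beta')
  qed
  have [measurable]: "(\<lambda>(w, y). W (w + y) w) \<in> borel_measurable (lborel \<Otimes>\<^sub>M lborel)"
  proof -
    have "(\<lambda>u. case_prod W (fst u + snd u, fst u)) \<in> borel_measurable (lborel \<Otimes>\<^sub>M lborel)"
      by (rule measurable_compose[OF _ assms(1)]) measurable
    then show ?thesis by (simp add: case_prod_beta')
  qed
  have "(\<integral>\<^sup>+z. \<integral>\<^sup>+w. h z * f w * g (z - w) * W z w \<partial>lborel \<partial>lborel)
      = (\<integral>\<^sup>+w. \<integral>\<^sup>+z. h z * f w * g (z - w) * W z w \<partial>lborel \<partial>lborel)"
    by (rule lborel_pair.Fubini'[symmetric]) measurable
  also have "\<dots> = (\<integral>\<^sup>+w. \<integral>\<^sup>+y. g y * (h (w + y) * f w) * W (w + y) w \<partial>lborel \<partial>lborel)"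
  proof (rule nn_integral_cong)
    fix w
    show "(\<integral>\<^sup>+z. h z * f w * g (z - w) * W z w \<partial>lborel) = (\<integral>\<^sup>+y. g y * (h (w + y) * f w) * W (w + y) w \<partial>lborel)"
      using nn_integral_lborel_translate[of "\<lambda>z. h z * f w * g (z - w) * W z w" w] by (simp add: mult_ac)
  qed
  also have "\<dots> = (\<integral>\<^sup>+y. \<integral>\<^sup>+w. g y * (h (w + y) * f w) * W (w + y) w \<partial>lborel \<partial>lborel)"
    by (rule lborel_pair.Fubini'[symmetric]) measurable
  finally have "(\<integral>\<^sup>+z. \<integral>\<^sup>+w. h z * f w * g (z - w) * W z w \<partial>lborel \<partial>lborel)\<^sup>2
      = (\<integral>\<^sup>+y. \<integral>\<^sup>+w. g y * (h (w + y) * f w) * W (w + y) w \<partial>lborel \<partial>lborel)\<^sup>2" by simp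
  also have "\<dots> \<le> ennreal C * (\<integral>\<^sup>+y. (g y)\<^sup>2 \<partial>lborel) * (\<integral>\<^sup>+y. \<integral>\<^sup>+w. (h (w + y) * f w)\<^sup>2 \<partial>lborel \<partial>lborel)"
    by (rule schur_test) (use W in measurable)
  also have "(\<integral>\<^sup>+y. \<integral>\<^sup>+w. (h (w + y) * f w)\<^sup>2 \<partial>lborel \<partial>lborel) = (\<integral>\<^sup>+w. \<integral>\<^sup>+y. (h (w + y) * f w)\<^sup>2 \<partial>lborel \<partial>lborel)"
    by (rule lborel_pair.Fubini'[symmetric]) measurable
  also have "\<dots> = (\<integral>\<^sup>+w. (\<integral>\<^sup>+y. (h (w + y))\<^sup>2 \<partial>lborel) * (f w)\<^sup>2 \<partial>lborel)"
    by (simp add: power_mult_distrib nn_integral_multc)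
  also have "\<dots> = (\<integral>\<^sup>+w. (\<integral>\<^sup>+y. (h y)\<^sup>2 \<partial>lborel) * (f w)\<^sup>2 \<partial>lborel)"
    using nn_integral_lborel_translate[of "\<lambda>z. (h z)\<^sup>2"] by simp
  also have "\<dots> = (\<integral>\<^sup>+z. (h z)\<^sup>2 \<partial>lborel) * (\<integral>\<^sup>+z. (f z)\<^sup>2 \<partial>lborel)"
    by (rule nn_integral_cmult) measurable
  finally show "(\<integral>\<^sup>+z. \<integral>\<^sup>+w. h z * f w * g (z - w) * W z w \<partial>lborel \<partial>lborel)\<^sup>2
      \<le> ennreal C * (\<integral>\<^sup>+z. (h z)\<^sup>2 \<partial>lborel) * (\<integral>\<^sup>+z. (f z)\<^sup>2 \<partial>lborel) * (\<integral>\<^sup>+z. (g z)\<^sup>2 \<partial>lborel)"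
    by (simp only: mult_ac)
qed

section \<open>The kernel of the bilinear estimates\<close>

lemma nn_integral_lborel_pair:
  assumes [measurable]: "f \<in> borel_measurable (borel :: ('a::euclidean_space \<times> 'b::euclidean_space) measure)"
  shows "(\<integral>\<^sup>+z. f z \<partial>lborel) = (\<integral>\<^sup>+t. \<integral>\<^sup>+x. f (t, x) \<partial>lborel \<partial>lborel)"
  unfolding lborel_prod[symmetric]
  by (rule lborel.nn_integral_fst[symmetric]) (simp add: lborel_prod)

context
  fixes \<gamma> a0 a1 a2 :: real
begin

text \<open>The modulations measure the distance in \<tau> to the characteristic curves: \<tau> = -
  \<xi>^2 of the linear Schroedinger equation here, and \<tau> = - \<gamma> |\<xi>| \<xi> of the
  linear Benjamin-Ono equation for \<open>mod_Y\<close>.\<close>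

definition mod_X :: "real \<times> real \<Rightarrow> real" where
  "mod_X z = fst z + (snd z)\<^sup>2"

definition mod_Y :: "real \<times> real \<Rightarrow> real" where
  "mod_Y z = fst z + \<gamma> * \<bar>snd z\<bar> * snd z"

definition kern :: "real \<times> real \<Rightarrow> real \<times> real \<Rightarrow> ennreal" where
  "kern z w = ennreal (bracket (snd w) powr (1/2) * bracket (mod_X z) powr (- a0)
     * bracket (mod_Y w) powr (- a1) * bracket (mod_X (z - w)) powr (- a2))"

lemma borel_measurable_mod [measurable]:
  "mod_X \<in> borel_measurable borel" "mod_Y \<in> borel_measurable borel"
  unfolding mod_X_def mod_Y_def by (simp_all flip: borel_prod)

lemma borel_measurable_snd_prod [measurable]: "(snd :: real \<times> real \<Rightarrow> real) \<in> borel_measurable borel"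
  by (simp flip: borel_prod)

lemma borel_measurable_kern [measurable]: "case_prod kern \<in> borel_measurable (lborel \<Otimes>\<^sub>M lborel)"
  unfolding kern_def by measurable

lemma kern_power2:
  "(kern z w)\<^sup>2 = ennreal (bracket (snd w) * bracket (mod_X z) powr (- (2 * a0))
     * bracket (mod_Y w) powr (- (2 * a1)) * bracket (mod_X (z - w)) powr (- (2 * a2)))"
proof -
  have *: "(b powr e)\<^sup>2 = b powr (2 * e)" if "1 \<le> b" for b e :: real
    using that by (simp add: powr_powr mult.commute flip: powr_numeral)
  show ?thesis
    unfolding kern_def using bracket_pos[of "snd w"]
    by (simp add: ennreal_power power_mult_distrib * bracket_ge_1)
qed

section \<open>The four regions of the kernel\<close>

text \<open>Low frequencies are set apart because the Jacobian 2 |x1| of the region where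
  \<open>mod_Y w\<close> is largest degenerates at x1 = 0. Here the weight in the squared kernel is
  at most 2, and the modulations at w and z - w suffice: their joint exponent r exceeds 1, so either
  of them is integrable in time, over a bounded interval of frequencies.\<close>

lemma form_bound_kern_low:
  assumes a: "a0 \<in> {1/4<..<1/2}" "a1 \<in> {1/4<..<1/2}" "a2 \<in> {1/4<..<1/2}"
  shows "form_bound (\<lambda>z w. if \<bar>snd w\<bar> \<le> 1 then kern z w else 0)"
proof -
  define r where "r = 2 * a1 + 2 * a2"
  have r: "1 < r" using a by (auto simp: r_def)
  define E where "E = 2 / (r - 1)"
  have E: "0 \<le> E" using r by (simp add: E_def)
  show ?thesis
  proof (rule form_bound_fix_sum)
    show "(\<lambda>(z, w). if \<bar>snd w\<bar> \<le> 1 then kern z w else 0) \<in> borel_measurable (lborel \<Otimes>\<^sub>M lborel)"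
      by measurable
    fix z :: "real \<times> real"
    obtain t x where z: "z = (t, x)" by (cases z)
    have [measurable]: "kern z \<in> borel_measurable borel"
      using measurable_Pair2[OF borel_measurable_kern, of z] by simp
    have pw: "(if \<bar>snd w\<bar> \<le> 1 then kern z w else 0)\<^sup>2
      \<le> 2 * indicator {-1..1} (snd w) * (ennreal (bracket (mod_Y w) powr (- r)) + ennreal (bracket (mod_X (z - w)) powr (- r)))" for w
    proof (cases "\<bar>snd w\<bar> \<le> 1")
      case True
      define u where "u = bracket (mod_Y w)"
      define v where "v = bracket (mod_X (z - w))"
      have uv: "1 \<le> u" "1 \<le> v" by (simp_all add: u_def v_def bracket_ge_1)
      \<comment> \<open>The product is at most the power - r of the smaller of u and v.\<close>
      have "u powr (- (2 * a1)) * v powr (- (2 * a2)) \<le> u powr (- r) + v powr (- r)"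
      proof (cases "u \<le> v")
        case True
        have "u powr (- (2 * a1)) * v powr (- (2 * a2)) \<le> u powr (- (2 * a1)) * u powr (- (2 * a2))"
          using a uv True by (intro mult_left_mono powr_mono2') auto
        also have "\<dots> = u powr (- r)" by (simp add: r_def algebra_simps flip: powr_add)
        finally show ?thesis by (simp add: add_increasing2)
      next
        case False
        have "u powr (- (2 * a1)) * v powr (- (2 * a2)) \<le> v powr (- (2 * a1)) * v powr (- (2 * a2))"
          using a uv False by (intro mult_right_mono powr_mono2') auto
        also have "\<dots> = v powr (- r)" by (simp add: r_def algebra_simps flip: powr_add)
        finally show ?thesis by (simp add: add_increasing)
      qed
      then have "bracket (snd w) * bracket (mod_X z) powr (- (2 * a0)) * (u powr (- (2 * a1)) * v powr (- (2 * a2)))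
          \<le> 2 * 1 * (u powr (- r) + v powr (- r))"
        using True a bracket_pos[of "snd w"]
        by (intro mult_mono bracket_powr_le_1) (auto simp: bracket_def)
      then have "(kern z w)\<^sup>2 \<le> ennreal (2 * (u powr (- r) + v powr (- r)))"
        unfolding kern_power2 u_def v_def by (intro ennreal_leI) (simp add: mult.assoc)
      then show ?thesis using True
        by (simp add: u_def v_def abs_le_iff minus_le_iff indicator_def ennreal_mult')
    next
      case False
      then show ?thesis by simp
    qed
    have "(\<integral>\<^sup>+w. (if \<bar>snd w\<bar> \<le> 1 then kern z w else 0)\<^sup>2 \<partial>lborel)
      \<le> (\<integral>\<^sup>+w. 2 * indicator {-1..1} (snd w) * (ennreal (bracket (mod_Y w) powr (- r)) + ennreal (bracket (mod_X (z - w)) powr (- r))) \<partial>lborel)"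
      by (intro nn_integral_mono pw)
    also have "\<dots> = (\<integral>\<^sup>+t1. \<integral>\<^sup>+x1. 2 * indicator {-1..1} x1 * (ennreal (bracket (t1 + \<gamma> * \<bar>x1\<bar> * x1) powr (- r))
          + ennreal (bracket ((t + (x - x1)\<^sup>2) - t1) powr (- r))) \<partial>lborel \<partial>lborel)"
      by (subst nn_integral_lborel_pair, measurable) (simp add: z mod_X_def mod_Y_def diff_add_eq add.commute)
    also have "\<dots> = (\<integral>\<^sup>+x1. \<integral>\<^sup>+t1. 2 * indicator {-1..1} x1 * (ennreal (bracket (t1 + \<gamma> * \<bar>x1\<bar> * x1) powr (- r))
          + ennreal (bracket ((t + (x - x1)\<^sup>2) - t1) powr (- r))) \<partial>lborel \<partial>lborel)"
      by (rule lborel_pair.Fubini'[symmetric]) measurable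
    also have "\<dots> \<le> (\<integral>\<^sup>+(x1::real). indicator {-1..1} x1 * (2 * (ennreal E + ennreal E)) \<partial>lborel)"
    proof (intro nn_integral_mono)
      fix x1 :: real
      have "(\<integral>\<^sup>+t1. 2 * indicator {-1..1} x1 * (ennreal (bracket (t1 + \<gamma> * \<bar>x1\<bar> * x1) powr (- r))
          + ennreal (bracket ((t + (x - x1)\<^sup>2) - t1) powr (- r))) \<partial>lborel)
        = 2 * indicator {-1..1} x1 * ((\<integral>\<^sup>+t1. ennreal (bracket (\<gamma> * \<bar>x1\<bar> * x1 + t1) powr (- r)) \<partial>lborel)
          + (\<integral>\<^sup>+t1. ennreal (bracket ((t + (x - x1)\<^sup>2) - t1) powr (- r)) \<partial>lborel))"
        by (simp add: nn_integral_cmult nn_integral_add add.commute)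
      also have "\<dots> = 2 * indicator {-1..1} x1 * ((\<integral>\<^sup>+s. ennreal (bracket s powr (- r)) \<partial>lborel)
          + (\<integral>\<^sup>+s. ennreal (bracket s powr (- r)) \<partial>lborel))"
        using nn_integral_lborel_translate[of "\<lambda>s. ennreal (bracket s powr (- r))"]
          nn_integral_lborel_reflect[of "\<lambda>s. ennreal (bracket s powr (- r))"] by simp
      also have "\<dots> \<le> 2 * indicator {-1..1} x1 * (ennreal E + ennreal E)"
        unfolding E_def using r by (intro mult_left_mono add_mono nn_integral_bracket_powr) auto
      finally show "(\<integral>\<^sup>+t1. 2 * indicator {-1..1} x1 * (ennreal (bracket (t1 + \<gamma> * \<bar>x1\<bar> * x1) powr (- r))
          + ennreal (bracket ((t + (x - x1)\<^sup>2) - t1) powr (- r))) \<partial>lborel)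
        \<le> indicator {-1..1} x1 * (2 * (ennreal E + ennreal E))"
        by (simp only: mult_ac)
    qed
    also have "\<dots> = 2 * (2 * (ennreal E + ennreal E))"
      by (subst nn_integral_multc) auto
    also have "\<dots> = ennreal (8 * E)"
      using E by (simp add: ennreal_mult_numeral flip: ennreal_plus)
    finally show "(\<integral>\<^sup>+w. (if \<bar>snd w\<bar> \<le> 1 then kern z w else 0)\<^sup>2 \<partial>lborel) \<le> ennreal (8 * E)" .
  qed
qed

text \<open>With w frozen, the difference of the modulations at z and z - w is linear in x, because
  the quadratic terms cancel. Its slope 2 * x1 is a constant Jacobian without critical point, and it
  dominates \<open>bracket x1\<close> as soon as |x1| > 1.\<close>

lemma form_bound_kern_Y:
  assumes a: "a0 \<in> {1/4<..<1/2}" "a1 \<in> {1/4<..<1/2}" "a2 \<in> {1/4<..<1/2}" "a0 + a1 + a2 = 1"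
  shows "form_bound (\<lambda>z w. if 1 < \<bar>snd w\<bar> \<and> \<bar>mod_X z\<bar> \<le> \<bar>mod_Y w\<bar> \<and> \<bar>mod_X (z - w)\<bar> \<le> \<bar>mod_Y w\<bar> then kern z w else 0)"
proof -
  define C where "C = 8 / ((1 - 2 * a0) * (1 - 2 * a2))"
  show ?thesis
  proof (rule form_bound_fix_first)
    show "(\<lambda>(z, w). if 1 < \<bar>snd w\<bar> \<and> \<bar>mod_X z\<bar> \<le> \<bar>mod_Y w\<bar> \<and> \<bar>mod_X (z - w)\<bar> \<le> \<bar>mod_Y w\<bar> then kern z w else 0)
      \<in> borel_measurable (lborel \<Otimes>\<^sub>M lborel)" by measurable
    fix w :: "real \<times> real"
    obtain t1 x1 where w: "w = (t1, x1)" by (cases w)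
    have [measurable]: "(\<lambda>z. kern z w) \<in> borel_measurable borel"
      using measurable_Pair1[OF borel_measurable_kern, of w] by simp
    define m where "m = mod_Y w"
    \<comment> \<open>For z = (t, x) this is \<open>mod_X z\<close> minus
      \<open>mod_X (z - w)\<close>.\<close>
    define \<psi> where "\<psi> x = 2 * x1 * x + (t1 - x1\<^sup>2)" for x
    have [measurable]: "\<psi> \<in> borel_measurable borel" unfolding \<psi>_def by measurable
    \<comment> \<open>The conjunct \<open>True\<close> is the predicate \<open>P\<close> of the
      Jacobian estimate, which needs no restriction here.\<close>
    let ?F = "\<lambda>s x. if \<bar>s\<bar> \<le> \<bar>m\<bar> \<and> \<bar>s - \<psi> x\<bar> \<le> \<bar>m\<bar> \<and> True
        then ennreal (bracket x1 * bracket s powr (- (2 * a0)) * bracket (s - \<psi> x) powr (- (2 * a2))) else 0"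
    have Fm: "case_prod ?F \<in> borel_measurable (lborel \<Otimes>\<^sub>M lborel)" by measurable
    have Fm': "(\<lambda>(t, x). ?F (t + x\<^sup>2) x) \<in> borel_measurable (lborel \<Otimes>\<^sub>M lborel)" by measurable
    show "(\<integral>\<^sup>+z. (if 1 < \<bar>snd w\<bar> \<and> \<bar>mod_X z\<bar> \<le> \<bar>mod_Y w\<bar> \<and> \<bar>mod_X (z - w)\<bar> \<le> \<bar>mod_Y w\<bar> then kern z w else 0)\<^sup>2 \<partial>lborel)
      \<le> ennreal C"
    proof (cases "1 < \<bar>x1\<bar>")
      case True
      have I: "(\<integral>\<^sup>+t. \<integral>\<^sup>+x. ?F (t + x\<^sup>2) x \<partial>lborel \<partial>lborel) \<le> ennreal (C * bracket m powr (2 * a1))"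
      proof -
        have "(\<integral>\<^sup>+t. \<integral>\<^sup>+x. ?F (t + x\<^sup>2) x \<partial>lborel \<partial>lborel) = (\<integral>\<^sup>+s. \<integral>\<^sup>+x. ?F s x \<partial>lborel \<partial>lborel)"
          by (rule nn_integral_shear[OF Fm]) measurable
        also have "\<dots> \<le> ennreal (8 * 1 / ((1 - 2 * a0) * (1 - 2 * a2)) * bracket \<bar>m\<bar> powr (2 - 2 * a0 - 2 * a2))"
        proof (rule double_integral_jacobian[where \<phi> = \<psi> and \<phi>' = "\<lambda>x. 2 * x1" and w = "\<lambda>_. bracket x1"
              and P = "\<lambda>_. True" and D = 1 and p = "2 * a0" and q = "2 * a2" and S = "\<bar>m\<bar>"])
          fix G :: "real \<Rightarrow> ennreal"
          assume [measurable]: "G \<in> borel_measurable borel"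
          have \<psi>: "\<psi> = (\<lambda>x. (t1 - x1\<^sup>2) + 2 * x1 * x)" by (auto simp: \<psi>_def)
          have "(\<integral>\<^sup>+y. G y \<partial>lborel) = ennreal \<bar>2 * x1\<bar> * (\<integral>\<^sup>+x. G (\<psi> x) \<partial>lborel)"
            unfolding \<psi> using True by (intro nn_integral_real_affine) auto
          also have "\<dots> = (\<integral>\<^sup>+x. ennreal \<bar>2 * x1\<bar> * G (\<psi> x) \<partial>lborel)"
            by (rule nn_integral_cmult[symmetric]) measurable
          finally have "(\<integral>\<^sup>+x. ennreal \<bar>2 * x1\<bar> * G (\<psi> x) \<partial>lborel) = (\<integral>\<^sup>+y. G y \<partial>lborel)" ..
          then show "(\<integral>\<^sup>+x. ennreal \<bar>2 * x1\<bar> * G (\<psi> x) \<partial>lborel) \<le> 2 * (\<integral>\<^sup>+y. G y \<partial>lborel)"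
            unfolding mult_2 by (metis add_increasing order_refl zero_le)
        next
          show "bracket x1 \<le> 1 * \<bar>2 * x1\<bar>" using True by (simp add: bracket_def abs_mult)
          show "2 * a0 < 1" "2 * a2 < 1" using a(1,3) by auto
        qed simp_all
        also have "bracket \<bar>m\<bar> powr (2 - 2 * a0 - 2 * a2) = bracket m powr (2 * a1)"
        proof -
          have "2 - 2 * a0 - 2 * a2 = 2 * a1" using a(4) by simp
          then show ?thesis by (simp add: bracket_def)
        qed
        finally show ?thesis by (simp only: C_def mult_1_right)
      qed
      have "(\<integral>\<^sup>+z. (if 1 < \<bar>snd w\<bar> \<and> \<bar>mod_X z\<bar> \<le> \<bar>mod_Y w\<bar> \<and> \<bar>mod_X (z - w)\<bar> \<le> \<bar>mod_Y w\<bar> then kern z w else 0)\<^sup>2 \<partial>lborel)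
        = (\<integral>\<^sup>+t. \<integral>\<^sup>+x. ennreal (bracket m powr (- (2 * a1))) * ?F (t + x\<^sup>2) x \<partial>lborel \<partial>lborel)"
      proof (subst nn_integral_lborel_pair, measurable, rule nn_integral_cong, rule nn_integral_cong)
        fix t x :: real
        have "mod_X ((t, x) - w) = t + x\<^sup>2 - \<psi> x"
          by (simp add: w mod_X_def \<psi>_def power2_eq_square algebra_simps)
        moreover have "mod_X (t, x) = t + x\<^sup>2" by (simp add: mod_X_def)
        moreover have "(kern (t, x) w)\<^sup>2 = ennreal (bracket m powr (- (2 * a1)))
            * ennreal (bracket x1 * bracket (t + x\<^sup>2) powr (- (2 * a0)) * bracket (t + x\<^sup>2 - \<psi> x) powr (- (2 * a2)))"
          unfolding kern_power2 calculation m_def[symmetric]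
          by (subst ennreal_mult'[symmetric]) (simp_all add: w mult_ac)
        ultimately show "(if 1 < \<bar>snd w\<bar> \<and> \<bar>mod_X (t, x)\<bar> \<le> \<bar>mod_Y w\<bar> \<and> \<bar>mod_X ((t, x) - w)\<bar> \<le> \<bar>mod_Y w\<bar> then kern (t, x) w else 0)\<^sup>2
          = ennreal (bracket m powr (- (2 * a1))) * ?F (t + x\<^sup>2) x"
          using True unfolding m_def[symmetric] by (simp add: w)
      qed
      also have "\<dots> = ennreal (bracket m powr (- (2 * a1))) * (\<integral>\<^sup>+t. \<integral>\<^sup>+x. ?F (t + x\<^sup>2) x \<partial>lborel \<partial>lborel)"
        by (rule nn_integral_iterated_cmult[OF Fm'])
      also have "\<dots> \<le> ennreal (bracket m powr (- (2 * a1))) * ennreal (C * bracket m powr (2 * a1))"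
        by (rule mult_left_mono[OF I]) simp
      also have "\<dots> = ennreal (C * (bracket m powr (- (2 * a1)) * bracket m powr (2 * a1)))"
        by (simp add: mult_ac flip: ennreal_mult')
      also have "bracket m powr (- (2 * a1)) * bracket m powr (2 * a1) = 1"
        using bracket_pos[of m] by (simp flip: powr_add)
      finally show ?thesis by simp
    next
      case False
      then show ?thesis by (simp add: w)
    qed
  qed
qed

text \<open>With z frozen, the modulations at w and z - w add up to a phase in x1. The term \<gamma>
  |x1| x1 makes its leading coefficient 1 + \<gamma> for x1 \<ge> 0 and 1 - \<gamma> for x1 < 0, and
  its value at 0 is \<open>mod_X z\<close>, the largest modulation.\<close>

lemma form_bound_kern_sum:
  assumes a: "a0 \<in> {1/4<..<1/2}" "a1 \<in> {1/4<..<1/2}" "a2 \<in> {1/4<..<1/2}" "a0 + a1 + a2 = 1" and \<gamma>: "\<bar>\<gamma>\<bar> \<noteq> 1"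
  shows "form_bound (\<lambda>z w. if \<bar>mod_Y w\<bar> \<le> \<bar>mod_X z\<bar> \<and> \<bar>mod_X (z - w)\<bar> \<le> \<bar>mod_X z\<bar> then kern z w else 0)"
proof -
  have \<gamma>': "1 + \<gamma> \<noteq> 0" "1 - \<gamma> \<noteq> 0" using \<gamma> by auto
  have "2 * a1 \<in> {1/2<..<1}" "2 * a2 \<in> {1/2<..<1}" "2 * a0 \<in> {1/2<..<1}" "2 * a1 + 2 * a2 + 2 * a0 = 2"
    using a by auto
  from resonant_double_integral_signed[OF \<gamma>' this]
  obtain C where C: "\<forall>b m A \<phi>. A \<in> borel_measurable borel \<longrightarrow>
      (\<forall>x. \<phi> x = (if 0 \<le> x then 1 + \<gamma> else 1 - \<gamma>) * x\<^sup>2 + b * x + m) \<longrightarrow>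
    (\<integral>\<^sup>+t. \<integral>\<^sup>+x. (if \<bar>t + A x\<bar> \<le> \<bar>m\<bar> \<and> \<bar>t + A x - \<phi> x\<bar> \<le> \<bar>m\<bar>
        then ennreal (bracket x * bracket m powr (- (2 * a0)) * bracket (t + A x) powr (- (2 * a1)) * bracket (t + A x - \<phi> x) powr (- (2 * a2)))
        else 0) \<partial>lborel \<partial>lborel) \<le> ennreal C"
    by (elim exE conjE) (rule that)
  show ?thesis
  proof (rule form_bound_fix_sum)
    show "(\<lambda>(z, w). if \<bar>mod_Y w\<bar> \<le> \<bar>mod_X z\<bar> \<and> \<bar>mod_X (z - w)\<bar> \<le> \<bar>mod_X z\<bar> then kern z w else 0)
      \<in> borel_measurable (lborel \<Otimes>\<^sub>M lborel)" by measurable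
    fix z :: "real \<times> real"
    obtain t x where z: "z = (t, x)" by (cases z)
    have [measurable]: "kern z \<in> borel_measurable borel"
      using measurable_Pair2[OF borel_measurable_kern, of z] by simp
    define m where "m = mod_X z"
    define A where "A x1 = \<gamma> * \<bar>x1\<bar> * x1" for x1
    define \<phi> where "\<phi> x1 = \<gamma> * \<bar>x1\<bar> * x1 + t + (x - x1)\<^sup>2" for x1
    have "(\<integral>\<^sup>+w. (if \<bar>mod_Y w\<bar> \<le> \<bar>mod_X z\<bar> \<and> \<bar>mod_X (z - w)\<bar> \<le> \<bar>mod_X z\<bar> then kern z w else 0)\<^sup>2 \<partial>lborel)
      = (\<integral>\<^sup>+t. \<integral>\<^sup>+x. (if \<bar>t + A x\<bar> \<le> \<bar>m\<bar> \<and> \<bar>t + A x - \<phi> x\<bar> \<le> \<bar>m\<bar>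
        then ennreal (bracket x * bracket m powr (- (2 * a0)) * bracket (t + A x) powr (- (2 * a1)) * bracket (t + A x - \<phi> x) powr (- (2 * a2)))
        else 0) \<partial>lborel \<partial>lborel)"
    proof (subst nn_integral_lborel_pair, measurable, rule nn_integral_cong, rule nn_integral_cong)
      fix t1 x1 :: real
      have 1: "mod_X (z - (t1, x1)) = - (t1 + A x1 - \<phi> x1)"
        by (simp add: z mod_X_def \<phi>_def A_def)
      have 2: "mod_Y (t1, x1) = t1 + A x1" by (simp add: mod_Y_def A_def)
      show "(if \<bar>mod_Y (t1, x1)\<bar> \<le> \<bar>mod_X z\<bar> \<and> \<bar>mod_X (z - (t1, x1))\<bar> \<le> \<bar>mod_X z\<bar> then kern z (t1, x1) else 0)\<^sup>2
        = (if \<bar>t1 + A x1\<bar> \<le> \<bar>m\<bar> \<and> \<bar>t1 + A x1 - \<phi> x1\<bar> \<le> \<bar>m\<bar>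
        then ennreal (bracket x1 * bracket m powr (- (2 * a0)) * bracket (t1 + A x1) powr (- (2 * a1)) * bracket (t1 + A x1 - \<phi> x1) powr (- (2 * a2)))
        else 0)"
        unfolding if_distrib[of "\<lambda>u. u\<^sup>2"] kern_power2 1 2 m_def[symmetric] bracket_minus abs_minus_cancel by simp
    qed
    also have "\<dots> \<le> ennreal C"
    proof (rule C[rule_format, of _ _ "- 2 * x"])
      show "A \<in> borel_measurable borel" unfolding A_def by measurable
      show "\<phi> x1 = (if 0 \<le> x1 then 1 + \<gamma> else 1 - \<gamma>) * x1\<^sup>2 + - 2 * x * x1 + m" for x1
        by (simp add: \<phi>_def m_def z mod_X_def power2_eq_square algebra_simps)
    qed
    finally show "(\<integral>\<^sup>+w. (if \<bar>mod_Y w\<bar> \<le> \<bar>mod_X z\<bar> \<and> \<bar>mod_X (z - w)\<bar> \<le> \<bar>mod_X z\<bar> then kern z w else 0)\<^sup>2 \<partial>lborel) \<le> ennreal C" .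
  qed
qed

text \<open>With y = z - w frozen, the phase is the modulation at z minus the one at w. The minus
  sign exchanges the leading coefficients of the two half lines, and the value at 0 is
  \<open>mod_X y\<close>, again the largest modulation.\<close>

lemma form_bound_kern_X:
  assumes a: "a0 \<in> {1/4<..<1/2}" "a1 \<in> {1/4<..<1/2}" "a2 \<in> {1/4<..<1/2}" "a0 + a1 + a2 = 1" and \<gamma>: "\<bar>\<gamma>\<bar> \<noteq> 1"
  shows "form_bound (\<lambda>z w. if \<bar>mod_X z\<bar> \<le> \<bar>mod_X (z - w)\<bar> \<and> \<bar>mod_Y w\<bar> \<le> \<bar>mod_X (z - w)\<bar> then kern z w else 0)"
proof -
  have \<gamma>': "1 - \<gamma> \<noteq> 0" "1 + \<gamma> \<noteq> 0" using \<gamma> by auto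
  have "2 * a0 \<in> {1/2<..<1}" "2 * a1 \<in> {1/2<..<1}" "2 * a2 \<in> {1/2<..<1}" "2 * a0 + 2 * a1 + 2 * a2 = 2"
    using a by auto
  from resonant_double_integral_signed[OF \<gamma>' this]
  obtain C where C: "\<forall>b m A \<phi>. A \<in> borel_measurable borel \<longrightarrow>
      (\<forall>x. \<phi> x = (if 0 \<le> x then 1 - \<gamma> else 1 + \<gamma>) * x\<^sup>2 + b * x + m) \<longrightarrow>
    (\<integral>\<^sup>+t. \<integral>\<^sup>+x. (if \<bar>t + A x\<bar> \<le> \<bar>m\<bar> \<and> \<bar>t + A x - \<phi> x\<bar> \<le> \<bar>m\<bar>
        then ennreal (bracket x * bracket m powr (- (2 * a2)) * bracket (t + A x) powr (- (2 * a0)) * bracket (t + A x - \<phi> x) powr (- (2 * a1)))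
        else 0) \<partial>lborel \<partial>lborel) \<le> ennreal C"
    by (elim exE conjE) (rule that)
  show ?thesis
  proof (rule form_bound_fix_second)
    show meas: "(\<lambda>(z, w). if \<bar>mod_X z\<bar> \<le> \<bar>mod_X (z - w)\<bar> \<and> \<bar>mod_Y w\<bar> \<le> \<bar>mod_X (z - w)\<bar> then kern z w else 0)
      \<in> borel_measurable (lborel \<Otimes>\<^sub>M lborel)" by measurable
    fix y :: "real \<times> real"
    obtain t x where y: "y = (t, x)" by (cases y)
    have [measurable]: "(\<lambda>w. kern (w + y) w) \<in> borel_measurable borel"
      unfolding kern_def by measurable
    define m where "m = mod_X y"
    define A where "A x1 = t + (x1 + x)\<^sup>2" for x1
    define \<phi> where "\<phi> x1 = t + (x1 + x)\<^sup>2 - \<gamma> * \<bar>x1\<bar> * x1" for x1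
    have "(\<integral>\<^sup>+w. (if \<bar>mod_X (w + y)\<bar> \<le> \<bar>mod_X (w + y - w)\<bar> \<and> \<bar>mod_Y w\<bar> \<le> \<bar>mod_X (w + y - w)\<bar> then kern (w + y) w else 0)\<^sup>2 \<partial>lborel)
      = (\<integral>\<^sup>+t. \<integral>\<^sup>+x. (if \<bar>t + A x\<bar> \<le> \<bar>m\<bar> \<and> \<bar>t + A x - \<phi> x\<bar> \<le> \<bar>m\<bar>
        then ennreal (bracket x * bracket m powr (- (2 * a2)) * bracket (t + A x) powr (- (2 * a0)) * bracket (t + A x - \<phi> x) powr (- (2 * a1)))
        else 0) \<partial>lborel \<partial>lborel)"
    proof (subst nn_integral_lborel_pair, measurable, rule nn_integral_cong, rule nn_integral_cong)
      fix t1 x1 :: real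
      have 1: "mod_X ((t1, x1) + y) = t1 + A x1"
        by (simp add: y mod_X_def A_def)
      have 2: "mod_Y (t1, x1) = t1 + A x1 - \<phi> x1" by (simp add: mod_Y_def A_def \<phi>_def)
      show "(if \<bar>mod_X ((t1, x1) + y)\<bar> \<le> \<bar>mod_X ((t1, x1) + y - (t1, x1))\<bar> \<and> \<bar>mod_Y (t1, x1)\<bar> \<le> \<bar>mod_X ((t1, x1) + y - (t1, x1))\<bar>
           then kern ((t1, x1) + y) (t1, x1) else 0)\<^sup>2
        = (if \<bar>t1 + A x1\<bar> \<le> \<bar>m\<bar> \<and> \<bar>t1 + A x1 - \<phi> x1\<bar> \<le> \<bar>m\<bar>
        then ennreal (bracket x1 * bracket m powr (- (2 * a2)) * bracket (t1 + A x1) powr (- (2 * a0)) * bracket (t1 + A x1 - \<phi> x1) powr (- (2 * a1)))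
        else 0)"
        unfolding if_distrib[of "\<lambda>u. u\<^sup>2"] kern_power2 1 2 add_diff_cancel_left' m_def[symmetric] by (simp add: mult_ac)
    qed
    also have "\<dots> \<le> ennreal C"
    proof (rule C[rule_format, of _ _ "2 * x"])
      show "A \<in> borel_measurable borel" unfolding A_def by measurable
      show "\<phi> x1 = (if 0 \<le> x1 then 1 - \<gamma> else 1 + \<gamma>) * x1\<^sup>2 + 2 * x * x1 + m" for x1
        by (simp add: \<phi>_def m_def y mod_X_def power2_eq_square algebra_simps)
    qed
    finally show "(\<integral>\<^sup>+w. (if \<bar>mod_X (w + y)\<bar> \<le> \<bar>mod_X (w + y - w)\<bar> \<and> \<bar>mod_Y w\<bar> \<le> \<bar>mod_X (w + y - w)\<bar> then kern (w + y) w else 0)\<^sup>2 \<partial>lborel) \<le> ennreal C" .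
  qed
qed

text \<open>The regions overlap, but covering is enough since the kernel is nonnegative: it is
  dominated by the sum of its restrictions.\<close>

lemma form_bound_kern_critical:
  assumes a: "a0 \<in> {1/4<..<1/2}" "a1 \<in> {1/4<..<1/2}" "a2 \<in> {1/4<..<1/2}" "a0 + a1 + a2 = 1" and \<gamma>: "\<bar>\<gamma>\<bar> \<noteq> 1"
  shows "form_bound kern"
proof (rule form_bound_mono)
  have if_cover: "k \<le> ((if P then k else 0) + (if Q then k else 0)) + ((if R then k else 0) + (if S then k else 0))"
    if "P \<or> Q \<or> R \<or> S" for k :: ennreal and P Q R S
    using that by (auto simp: add_increasing add_increasing2)
  show "form_bound (\<lambda>z w. ((if \<bar>snd w\<bar> \<le> 1 then kern z w else 0)
     + (if 1 < \<bar>snd w\<bar> \<and> \<bar>mod_X z\<bar> \<le> \<bar>mod_Y w\<bar> \<and> \<bar>mod_X (z - w)\<bar> \<le> \<bar>mod_Y w\<bar> then kern z w else 0))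
     + ((if \<bar>mod_Y w\<bar> \<le> \<bar>mod_X z\<bar> \<and> \<bar>mod_X (z - w)\<bar> \<le> \<bar>mod_X z\<bar> then kern z w else 0)
     + (if \<bar>mod_X z\<bar> \<le> \<bar>mod_X (z - w)\<bar> \<and> \<bar>mod_Y w\<bar> \<le> \<bar>mod_X (z - w)\<bar> then kern z w else 0)))"
    by (rule form_bound_add[OF form_bound_add[OF form_bound_kern_low[OF a(1-3)] form_bound_kern_Y[OF a]]
          form_bound_add[OF form_bound_kern_sum[OF a \<gamma>] form_bound_kern_X[OF a \<gamma>]]]) measurable
  fix z w
  show "kern z w \<le> ((if \<bar>snd w\<bar> \<le> 1 then kern z w else 0)
     + (if 1 < \<bar>snd w\<bar> \<and> \<bar>mod_X z\<bar> \<le> \<bar>mod_Y w\<bar> \<and> \<bar>mod_X (z - w)\<bar> \<le> \<bar>mod_Y w\<bar> then kern z w else 0))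
     + ((if \<bar>mod_Y w\<bar> \<le> \<bar>mod_X z\<bar> \<and> \<bar>mod_X (z - w)\<bar> \<le> \<bar>mod_X z\<bar> then kern z w else 0)
     + (if \<bar>mod_X z\<bar> \<le> \<bar>mod_X (z - w)\<bar> \<and> \<bar>mod_Y w\<bar> \<le> \<bar>mod_X (z - w)\<bar> then kern z w else 0))"
  proof (rule if_cover)
    show "\<bar>snd w\<bar> \<le> 1 \<or> (1 < \<bar>snd w\<bar> \<and> \<bar>mod_X z\<bar> \<le> \<bar>mod_Y w\<bar> \<and> \<bar>mod_X (z - w)\<bar> \<le> \<bar>mod_Y w\<bar>)
      \<or> (\<bar>mod_Y w\<bar> \<le> \<bar>mod_X z\<bar> \<and> \<bar>mod_X (z - w)\<bar> \<le> \<bar>mod_X z\<bar>)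
      \<or> (\<bar>mod_X z\<bar> \<le> \<bar>mod_X (z - w)\<bar> \<and> \<bar>mod_Y w\<bar> \<le> \<bar>mod_X (z - w)\<bar>)"
      by linarith
  qed
qed

end

text \<open>The excesses over 1/4 are scaled by a common factor \<theta>, which keeps every exponent
  in (1/4, 1/2) and brings the sum down to exactly 1. Brackets are at least 1, so smaller exponents
  only enlarge the kernel.\<close>

theorem form_bound_kern:
  assumes a: "a0 \<in> {1/4<..<1/2}" "a1 \<in> {1/4<..<1/2}" "a2 \<in> {1/4<..<1/2}" "1 \<le> a0 + a1 + a2" and \<gamma>: "\<bar>\<gamma>\<bar> \<noteq> 1"
  shows "form_bound (kern \<gamma> a0 a1 a2)"
proof -
  \<comment> \<open>The solution of 3/4 + \<theta> (a0 + a1 + a2 - 3/4) = 1; \<theta> \<le> 1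
    expresses that the sum is at least 1.\<close>
  define \<theta> where "\<theta> = (1/4) / (a0 + a1 + a2 - 3/4)"
  have \<theta>: "0 < \<theta>" "\<theta> \<le> 1" using a by (auto simp: \<theta>_def)
  define c where "c x = 1/4 + \<theta> * (x - 1/4)" for x
  have c: "c x \<in> {1/4<..<1/2}" "c x \<le> x" if "x \<in> {1/4<..<1/2}" for x
  proof -
    have "\<theta> * (x - 1/4) \<le> 1 * (x - 1/4)" using that \<theta> by (intro mult_right_mono) auto
    moreover have "0 < \<theta> * (x - 1/4)" using that \<theta> by simp
    ultimately show "c x \<in> {1/4<..<1/2}" "c x \<le> x" using that by (auto simp: c_def)
  qed
  have "c a0 + c a1 + c a2 = 3/4 + \<theta> * (a0 + a1 + a2 - 3/4)" by (simp add: c_def algebra_simps)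
  also have "\<theta> * (a0 + a1 + a2 - 3/4) = 1/4"
    unfolding \<theta>_def by (rule nonzero_eq_divide_eq[THEN iffD1]) (use a in auto)
  finally have sum: "c a0 + c a1 + c a2 = 1" by simp
  show ?thesis
  proof (rule form_bound_mono)
    show "form_bound (kern \<gamma> (c a0) (c a1) (c a2))"
      by (intro form_bound_kern_critical c a sum \<gamma>)
    fix z w
    show "kern \<gamma> a0 a1 a2 z w \<le> kern \<gamma> (c a0) (c a1) (c a2) z w"
      unfolding kern_def using c a bracket_ge_1
      by (intro ennreal_leI mult_mono powr_mono) auto
  qed
qed

section \<open>Fourier transforms of rapidly decreasing functions\<close>

lemma fourier_eq_cis:
  "fourier w \<zeta> = complex_of_real (1 / (2 * pi)) * (\<integral>z. w z * cis (- (z \<bullet> \<zeta>)) \<partial>lborel)"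
  by (cases \<zeta>) (simp add: fourier_def cis_conv_exp case_prod_beta' inner_prod_def algebra_simps)

lemma borel_measurable_cis [measurable]: "cis \<in> borel_measurable borel"
  by (intro borel_measurable_continuous_onI continuous_intros)

lemma integrable_mult_cis:
  fixes w :: "'a::euclidean_space \<Rightarrow> complex"
  assumes "integrable lborel w" and [measurable]: "\<theta> \<in> borel_measurable borel"
  shows "integrable lborel (\<lambda>z. w z * cis (\<theta> z))"
proof -
  have [measurable]: "w \<in> borel_measurable borel" using assms(1) by auto
  show ?thesis
    by (rule Bochner_Integration.integrable_bound[OF assms(1)]) (auto simp: norm_mult)
qed

lemma integral_lborel_pair:
  fixes f :: "real \<times> real \<Rightarrow> complex"
  assumes f: "integrable lborel f"
  shows "(\<integral>z. f z \<partial>lborel) = (\<integral>t. \<integral>x. f (t, x) \<partial>lborel \<partial>lborel)"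
    and "(\<integral>z. f z \<partial>lborel) = (\<integral>x. \<integral>t. f (t, x) \<partial>lborel \<partial>lborel)"
proof -
  have f': "integrable (lborel \<Otimes>\<^sub>M lborel) f" using f by (simp add: lborel_prod)
  show *: "(\<integral>z. f z \<partial>lborel) = (\<integral>t. \<integral>x. f (t, x) \<partial>lborel \<partial>lborel)"
    using lborel_pair.integral_fst'[OF f'] by (simp add: lborel_prod)
  show "(\<integral>z. f z \<partial>lborel) = (\<integral>x. \<integral>t. f (t, x) \<partial>lborel \<partial>lborel)"
    unfolding * using lborel_pair.Fubini_integral[of "\<lambda>t x. f (t, x)"] f' by simp
qed

lemma has_vector_derivative_cis:
  "((\<lambda>x. cis (- (x * \<xi>))) has_vector_derivative (- (\<i> * complex_of_real \<xi>) * cis (- (x * \<xi>)))) (at x)"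
  unfolding has_vector_derivative_complex_iff by (auto intro!: derivative_eq_intros)

text \<open>Integration by parts, as the fundamental theorem on the whole line for the product of g
  with the oscillation: the product vanishes at both ends, so its derivative has integral 0.\<close>

lemma integral_deriv_mult_cis:
  fixes g g' :: "real \<Rightarrow> complex"
  assumes g: "\<And>x. (g has_vector_derivative g' x) (at x)" and g'_cont: "continuous_on UNIV g'"
    and int: "integrable lborel g" "integrable lborel g'"
    and lim: "(g \<longlongrightarrow> 0) at_top" "(g \<longlongrightarrow> 0) at_bot"
  shows "(\<integral>x. g' x * cis (- (x * \<xi>)) \<partial>lborel) = \<i> * complex_of_real \<xi> * (\<integral>x. g x * cis (- (x * \<xi>)) \<partial>lborel)"
proof -
  define F where "F x = g x * cis (- (x * \<xi>))" for x
  define f where "f x = g' x * cis (- (x * \<xi>)) - \<i> * complex_of_real \<xi> * (g x * cis (- (x * \<xi>)))" for x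
  have g_cont: "continuous_on UNIV g"
    using g by (auto simp: continuous_on_eq_continuous_at intro: has_vector_derivative_continuous)
  have intc: "integrable lborel (\<lambda>x. g' x * cis (- (x * \<xi>)))" "integrable lborel (\<lambda>x. g x * cis (- (x * \<xi>)))"
    using int by (auto intro!: integrable_mult_cis)
  have f_int: "integrable lborel f" unfolding f_def using intc by auto
  have F: "(F has_vector_derivative f x) (at x)" for x
    unfolding F_def f_def
    by (rule has_vector_derivative_eq_rhs[OF has_vector_derivative_mult[OF g has_vector_derivative_cis]])
       (simp add: algebra_simps)
  have f_cont: "continuous_on UNIV f"
    unfolding f_def by (intro continuous_intros g_cont g'_cont)
  have limF: "(F \<longlongrightarrow> 0) A" if "(g \<longlongrightarrow> 0) A" for A
    by (rule Lim_null_comparison[where g = "\<lambda>x. cmod (g x)"])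
       (use that in \<open>auto simp: F_def norm_mult tendsto_norm_zero_iff\<close>)
  have "(LBINT x=-\<infinity>..\<infinity>. f x) = 0 - 0"
  proof (rule interval_integral_FTC_integrable)
    show "set_integrable lborel (einterval (- \<infinity>) \<infinity>) f"
      using f_int by (simp add: set_integrable_def)
    show "isCont f x" for x using f_cont by (simp add: continuous_on_eq_continuous_at)
    show "((F \<circ> real_of_ereal) \<longlongrightarrow> 0) (at_right (- \<infinity>))" "((F \<circ> real_of_ereal) \<longlongrightarrow> 0) (at_left \<infinity>)"
      using limF lim by (simp_all add: ereal_tendsto_simps)
  qed (use F in auto)
  then have "(\<integral>x. f x \<partial>lborel) = 0"
    by (simp add: interval_lebesgue_integral_def set_lebesgue_integral_def)
  then show ?thesis unfolding f_def using intc by simp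
qed

text \<open>A working class between Schwartz and integrable functions. Its bound survives sums,
  products and conjugation, and already yields integrability on the plane and on every coordinate
  line. For u times the conjugate of v it then suffices to control the function and one derivative,
  instead of all of them.\<close>

definition rapid :: "(real \<times> real \<Rightarrow> complex) \<Rightarrow> bool" where
  "rapid w \<longleftrightarrow> continuous_on UNIV w \<and>
     (\<exists>C. \<forall>t x. cmod (w (t, x)) \<le> C * (bracket t powr (-2) * bracket x powr (-2)))"

lemma integrable_bracket_powr: "integrable lborel (\<lambda>x. bracket x powr (-2))"
proof (rule integrableI_nonneg)
  have "(\<integral>\<^sup>+x. ennreal (bracket x powr (-2)) \<partial>lborel) \<le> ennreal (2 / (2 - 1))"
    by (rule nn_integral_bracket_powr) simp
  then show "(\<integral>\<^sup>+x. ennreal (bracket x powr (-2)) \<partial>lborel) < \<infinity>"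
    by (rule order_le_less_trans) simp
qed auto

lemma integrable_bracket_powr_pair:
  "integrable lborel (\<lambda>z :: real \<times> real. bracket (fst z) powr (-2) * bracket (snd z) powr (-2))"
proof (rule integrableI_nonneg)
  show meas: "(\<lambda>z :: real \<times> real. bracket (fst z) powr (-2) * bracket (snd z) powr (-2)) \<in> borel_measurable lborel"
    by (simp flip: borel_prod)
  have "(\<integral>\<^sup>+z. ennreal (bracket (fst z) powr (-2) * bracket (snd z) powr (-2)) \<partial>(lborel :: (real \<times> real) measure))
     = (\<integral>\<^sup>+t. \<integral>\<^sup>+x. ennreal (bracket t powr (-2)) * ennreal (bracket x powr (-2)) \<partial>lborel \<partial>lborel)"
    by (subst nn_integral_lborel_pair) (use measurable_compose[OF meas measurable_ennreal] in \<open>simp_all flip: ennreal_mult'\<close>)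
  also have "\<dots> = (\<integral>\<^sup>+t. ennreal (bracket t powr (-2)) \<partial>lborel) * (\<integral>\<^sup>+x. ennreal (bracket x powr (-2)) \<partial>lborel)"
    by (simp add: nn_integral_cmult nn_integral_multc)
  also have "\<dots> < \<infinity>"
    using integrable_bracket_powr by (simp add: integrable_iff_bounded ennreal_mult_less_top)
  finally show "(\<integral>\<^sup>+z. ennreal (bracket (fst z) powr (-2) * bracket (snd z) powr (-2)) \<partial>(lborel :: (real \<times> real) measure)) < \<infinity>" .
qed auto

lemma rapid_integrable:
  assumes "rapid w"
  shows "integrable lborel w"
proof -
  obtain C where C: "\<And>t x. cmod (w (t, x)) \<le> C * (bracket t powr (-2) * bracket x powr (-2))"
    using assms by (auto simp: rapid_def)
  show ?thesis
  proof (rule Bochner_Integration.integrable_bound)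
    show "integrable lborel (\<lambda>z :: real \<times> real. C * (bracket (fst z) powr (-2) * bracket (snd z) powr (-2)))"
      by (intro integrable_mult_right integrable_bracket_powr_pair)
    show "w \<in> borel_measurable lborel"
      using assms by (simp add: rapid_def borel_measurable_continuous_onI)
    show "AE z in lborel. norm (w z) \<le> norm (C * (bracket (fst z) powr (-2) * bracket (snd z) powr (-2)))"
      using C by (auto intro!: AE_I2 order_trans[OF _ abs_ge_self])
  qed
qed

lemma tendsto_bracket_powr: "((\<lambda>x. bracket x powr (-2)) \<longlongrightarrow> 0) at_top" "((\<lambda>x. bracket x powr (-2)) \<longlongrightarrow> 0) at_bot"
  unfolding bracket_def by real_asymp+

lemma rapid_section:
  assumes "rapid w"
  shows "integrable lborel (\<lambda>x. w (t, x))" "integrable lborel (\<lambda>t. w (t, x))"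
    "((\<lambda>x. w (t, x)) \<longlongrightarrow> 0) at_top" "((\<lambda>x. w (t, x)) \<longlongrightarrow> 0) at_bot"
    "((\<lambda>t. w (t, x)) \<longlongrightarrow> 0) at_top" "((\<lambda>t. w (t, x)) \<longlongrightarrow> 0) at_bot"
    "continuous_on UNIV (\<lambda>x. w (t, x))" "continuous_on UNIV (\<lambda>t. w (t, x))"
proof -
  obtain C where C: "\<And>t x. cmod (w (t, x)) \<le> C * (bracket t powr (-2) * bracket x powr (-2))"
    using assms by (auto simp: rapid_def)
  have cont: "continuous_on UNIV w" using assms by (simp add: rapid_def)
  show c1: "continuous_on UNIV (\<lambda>x. w (t, x))" and c2: "continuous_on UNIV (\<lambda>t. w (t, x))"
    by (rule continuous_on_compose2[OF cont]; auto intro!: continuous_intros)+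
  have b: "integrable lborel g \<and> (g \<longlongrightarrow> 0) at_top \<and> (g \<longlongrightarrow> 0) at_bot"
    if g: "continuous_on UNIV g" "\<And>x. cmod (g x) \<le> K * bracket x powr (-2)" for g :: "real \<Rightarrow> complex" and K
  proof (intro conjI)
    show "integrable lborel g"
    proof (rule Bochner_Integration.integrable_bound)
      show "integrable lborel (\<lambda>x. K * bracket x powr (-2))"
        by (intro integrable_mult_right integrable_bracket_powr)
      show "g \<in> borel_measurable lborel" using g(1) by (simp add: borel_measurable_continuous_onI)
      show "AE z in lborel. norm (g z) \<le> norm (K * bracket z powr (-2))"
        using g(2) by (auto intro!: AE_I2 order_trans[OF _ abs_ge_self])
    qed
    show "(g \<longlongrightarrow> 0) at_top" "(g \<longlongrightarrow> 0) at_bot"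
      using g(2) by (auto intro!: Lim_null_comparison[where g = "\<lambda>x. K * bracket x powr (-2)"]
          tendsto_mult_right_zero tendsto_bracket_powr always_eventually)
  qed
  from b[OF c1, of "C * bracket t powr (-2)"] C
  show "integrable lborel (\<lambda>x. w (t, x))" "((\<lambda>x. w (t, x)) \<longlongrightarrow> 0) at_top" "((\<lambda>x. w (t, x)) \<longlongrightarrow> 0) at_bot"
    by (simp_all add: mult.assoc)
  from b[OF c2, of "C * bracket x powr (-2)"] C
  show "integrable lborel (\<lambda>t. w (t, x))" "((\<lambda>t. w (t, x)) \<longlongrightarrow> 0) at_top" "((\<lambda>t. w (t, x)) \<longlongrightarrow> 0) at_bot"
    by (simp_all add: mult_ac)
qed

text \<open>Fubini puts the x-integral inside, where integration by parts applies for each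
  t.\<close>

lemma fourier_x_derivative:
  assumes w: "rapid w" "rapid w'" and d: "\<And>t x. ((\<lambda>x. w (t, x)) has_vector_derivative w' (t, x)) (at x)"
  shows "fourier w' (\<tau>, \<xi>) = \<i> * complex_of_real \<xi> * fourier w (\<tau>, \<xi>)"
proof -
  have I: "(\<integral>z. v z * cis (- (z \<bullet> (\<tau>, \<xi>))) \<partial>lborel)
      = (\<integral>t. cis (- (t * \<tau>)) * (\<integral>x. v (t, x) * cis (- (x * \<xi>)) \<partial>lborel) \<partial>lborel)" if "rapid v" for v
  proof -
    have "integrable lborel (\<lambda>z. v z * cis (- (z \<bullet> (\<tau>, \<xi>))))"
      by (intro integrable_mult_cis rapid_integrable that) auto
    then have "(\<integral>z. v z * cis (- (z \<bullet> (\<tau>, \<xi>))) \<partial>lborel) = (\<integral>t. \<integral>x. v (t, x) * cis (- ((t, x) \<bullet> (\<tau>, \<xi>))) \<partial>lborel \<partial>lborel)"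
      by (rule integral_lborel_pair)
    also have "\<dots> = (\<integral>t. \<integral>x. cis (- (t * \<tau>)) * (v (t, x) * cis (- (x * \<xi>))) \<partial>lborel \<partial>lborel)"
      by (intro Bochner_Integration.integral_cong refl) (simp add: inner_prod_def cis_mult algebra_simps)
    finally show ?thesis by simp
  qed
  have "(\<integral>x. w' (t, x) * cis (- (x * \<xi>)) \<partial>lborel) = \<i> * complex_of_real \<xi> * (\<integral>x. w (t, x) * cis (- (x * \<xi>)) \<partial>lborel)" for t
    by (intro integral_deriv_mult_cis d rapid_section w)
  then show ?thesis unfolding fourier_eq_cis I[OF w(1)] I[OF w(2)]
    by (simp add: mult.left_commute)
qed

lemma fourier_t_derivative:
  assumes w: "rapid w" "rapid w'" and d: "\<And>t x. ((\<lambda>t. w (t, x)) has_vector_derivative w' (t, x)) (at t)"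
  shows "fourier w' (\<tau>, \<xi>) = \<i> * complex_of_real \<tau> * fourier w (\<tau>, \<xi>)"
proof -
  have I: "(\<integral>z. v z * cis (- (z \<bullet> (\<tau>, \<xi>))) \<partial>lborel)
      = (\<integral>x. cis (- (x * \<xi>)) * (\<integral>t. v (t, x) * cis (- (t * \<tau>)) \<partial>lborel) \<partial>lborel)" if "rapid v" for v
  proof -
    have "integrable lborel (\<lambda>z. v z * cis (- (z \<bullet> (\<tau>, \<xi>))))"
      by (intro integrable_mult_cis rapid_integrable that) auto
    then have "(\<integral>z. v z * cis (- (z \<bullet> (\<tau>, \<xi>))) \<partial>lborel) = (\<integral>x. \<integral>t. v (t, x) * cis (- ((t, x) \<bullet> (\<tau>, \<xi>))) \<partial>lborel \<partial>lborel)"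
      by (rule integral_lborel_pair)
    also have "\<dots> = (\<integral>x. \<integral>t. cis (- (x * \<xi>)) * (v (t, x) * cis (- (t * \<tau>))) \<partial>lborel \<partial>lborel)"
      by (intro Bochner_Integration.integral_cong refl) (simp add: inner_prod_def cis_mult algebra_simps)
    finally show ?thesis by simp
  qed
  have "(\<integral>t. w' (t, x) * cis (- (t * \<tau>)) \<partial>lborel) = \<i> * complex_of_real \<tau> * (\<integral>t. w (t, x) * cis (- (t * \<tau>)) \<partial>lborel)" for x
    by (intro integral_deriv_mult_cis d rapid_section w)
  then show ?thesis unfolding fourier_eq_cis I[OF w(1)] I[OF w(2)]
    by (simp add: mult.left_commute)
qed

section \<open>Directional derivatives and Schwartz functions\<close>

text \<open>\<open>vector_derivative\<close> is defined by choice, so the value of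
  \<open>dir_deriv\<close> has to be identified before use; Frechet differentiability does this and
  adds linearity in the direction.\<close>

lemma dir_deriv_eq:
  assumes "(w has_derivative D) (at z)"
  shows "dir_deriv v w z = D v"
proof -
  have lin: "linear D" using assms has_derivative_linear by blast
  have "((\<lambda>h. z + h *\<^sub>R v) has_derivative (\<lambda>h. h *\<^sub>R v)) (at 0)"
    by (auto intro!: derivative_eq_intros)
  then have "((\<lambda>h. w (z + h *\<^sub>R v)) has_derivative (\<lambda>h. D (h *\<^sub>R v))) (at 0)"
    by (rule has_derivative_compose) (use assms in simp)
  then have "((\<lambda>h. w (z + h *\<^sub>R v)) has_vector_derivative D v) (at 0)"
    by (simp add: has_vector_derivative_def linear_cmul[OF lin])
  then show ?thesis unfolding dir_deriv_def by (rule vector_derivative_at)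
qed

lemma dir_deriv_section:
  fixes w :: "real \<times> real \<Rightarrow> complex"
  assumes "w differentiable (at (t, x))"
  shows "((\<lambda>x. w (t, x)) has_vector_derivative dir_deriv (0, 1) w (t, x)) (at x)"
    "((\<lambda>t. w (t, x)) has_vector_derivative dir_deriv (1, 0) w (t, x)) (at t)"
proof -
  obtain D where D: "(w has_derivative D) (at (t, x))" using assms by (auto simp: differentiable_def)
  have lin: "linear D" using D has_derivative_linear by blast
  have "((\<lambda>s. (t, s)) has_derivative (\<lambda>h. h *\<^sub>R (0, 1))) (at x)"
    by (auto intro!: derivative_eq_intros)
  then have "((\<lambda>s. w (t, s)) has_derivative (\<lambda>h. D (h *\<^sub>R (0, 1)))) (at x)"
    by (rule has_derivative_compose) (use D in simp)
  then show "((\<lambda>x. w (t, x)) has_vector_derivative dir_deriv (0, 1) w (t, x)) (at x)"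
    unfolding dir_deriv_eq[OF D] has_vector_derivative_def by (simp add: linear_cmul[OF lin] del: scaleR_Pair)
  have "((\<lambda>s. (s, x)) has_derivative (\<lambda>h. h *\<^sub>R (1, 0))) (at t)"
    by (auto intro!: derivative_eq_intros)
  then have "((\<lambda>s. w (s, x)) has_derivative (\<lambda>h. D (h *\<^sub>R (1, 0)))) (at t)"
    by (rule has_derivative_compose) (use D in simp)
  then show "((\<lambda>t. w (t, x)) has_vector_derivative dir_deriv (1, 0) w (t, x)) (at t)"
    unfolding dir_deriv_eq[OF D] has_vector_derivative_def by (simp add: linear_cmul[OF lin] del: scaleR_Pair)
qed

lemma Basis_real_pair: "(0, 1) \<in> (Basis :: (real \<times> real) set)" "(1, 0) \<in> (Basis :: (real \<times> real) set)"
  by (auto simp: Basis_prod_def)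

lemma schwartz_differentiable:
  assumes "schwartz u" "set vs \<subseteq> Basis"
  shows "foldr dir_deriv vs u differentiable (at z)"
  using assms by (auto simp: schwartz_def)

text \<open>The moments of order 0 and 4 are enough: the product of the squared brackets of t and x
  is at most (1 + |z|)^4 \<le> 16 (1 + |z|^4).\<close>

lemma schwartz_rapid:
  assumes "schwartz u" "set vs \<subseteq> Basis"
  shows "rapid (foldr dir_deriv vs u)"
proof -
  define w where "w = foldr dir_deriv vs u"
  have "\<And>z. w differentiable (at z)" unfolding w_def using assms by (rule schwartz_differentiable)
  then have cont: "continuous_on UNIV w"
    by (auto simp: continuous_on_eq_continuous_at intro!: differentiable_imp_continuous_within)
  have bd: "bounded (range (\<lambda>z. norm z ^ k *\<^sub>R w z))" for k
    using assms unfolding schwartz_def w_def by blast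
  obtain C0 where C0: "\<And>z. cmod (w z) \<le> C0"
    using bd[of 0] unfolding bounded_iff by auto
  obtain C4 where C4: "\<And>z. norm z ^ 4 * cmod (w z) \<le> C4"
    using bd[of 4] unfolding bounded_iff by auto
  have "cmod (w (t, x)) \<le> 16 * (C0 + C4) * (bracket t powr (-2) * bracket x powr (-2))" for t x
  proof -
    define n where "n = norm (t, x)"
    have n: "\<bar>t\<bar> \<le> n" "\<bar>x\<bar> \<le> n" "0 \<le> n"
      using norm_fst_le[of t x] norm_snd_le[of x t] by (auto simp: n_def)
    have "(bracket t)\<^sup>2 * (bracket x)\<^sup>2 \<le> (1 + n)\<^sup>2 * (1 + n)\<^sup>2"
      using n by (intro mult_mono power_mono) (auto simp: bracket_def)
    also have "\<dots> = (1 + n) ^ 4" by (simp flip: power_add)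
    also have "\<dots> \<le> (2 * max 1 n) ^ 4" using n by (intro power_mono) auto
    also have "\<dots> \<le> 16 * (1 + n ^ 4)" using n by (auto simp: max_def power_mult_distrib)
    finally have "(bracket t)\<^sup>2 * (bracket x)\<^sup>2 * cmod (w (t, x)) \<le> 16 * (1 + n ^ 4) * cmod (w (t, x))"
      by (intro mult_right_mono) auto
    also have "\<dots> \<le> 16 * (C0 + C4)"
      using C0[of "(t, x)"] C4[of "(t, x)"] by (simp add: n_def algebra_simps)
    finally have "cmod (w (t, x)) \<le> 16 * (C0 + C4) / ((bracket t)\<^sup>2 * (bracket x)\<^sup>2)"
      using bracket_pos[of t] bracket_pos[of x] by (simp add: field_simps)
    then show ?thesis
      using bracket_pos[of t] bracket_pos[of x] by (simp add: powr_minus divide_inverse)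
  qed
  then show ?thesis unfolding rapid_def w_def[symmetric] using cont by blast
qed

text \<open>The arbitrary word \<open>vs\<close> lets the formula be iterated, one derivative at a
  time.\<close>

lemma fourier_schwartz_derivative:
  assumes u: "schwartz u" "set vs \<subseteq> Basis"
  shows "fourier (dir_deriv (0, 1) (foldr dir_deriv vs u)) (\<tau>, \<xi>) = \<i> * complex_of_real \<xi> * fourier (foldr dir_deriv vs u) (\<tau>, \<xi>)"
    and "fourier (dir_deriv (1, 0) (foldr dir_deriv vs u)) (\<tau>, \<xi>) = \<i> * complex_of_real \<tau> * fourier (foldr dir_deriv vs u) (\<tau>, \<xi>)"
proof -
  have *: "rapid (dir_deriv b (foldr dir_deriv vs u))" if "b \<in> Basis" for b
    using schwartz_rapid[OF u(1), of "b # vs"] u(2) that by simp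
  show "fourier (dir_deriv (0, 1) (foldr dir_deriv vs u)) (\<tau>, \<xi>) = \<i> * complex_of_real \<xi> * fourier (foldr dir_deriv vs u) (\<tau>, \<xi>)"
    by (intro fourier_x_derivative schwartz_rapid u * Basis_real_pair dir_deriv_section schwartz_differentiable)
  show "fourier (dir_deriv (1, 0) (foldr dir_deriv vs u)) (\<tau>, \<xi>) = \<i> * complex_of_real \<tau> * fourier (foldr dir_deriv vs u) (\<tau>, \<xi>)"
    by (intro fourier_t_derivative schwartz_rapid u * Basis_real_pair dir_deriv_section schwartz_differentiable)
qed

lemma cmod_fourier_le: "cmod (fourier w \<zeta>) \<le> 1 / (2 * pi) * (\<integral>z. cmod (w z) \<partial>lborel)"
proof -
  have "cmod (\<integral>z. w z * cis (- (z \<bullet> \<zeta>)) \<partial>lborel) \<le> (\<integral>z. cmod (w z * cis (- (z \<bullet> \<zeta>))) \<partial>lborel)"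
    by (rule integral_norm_bound)
  then show ?thesis
    unfolding fourier_eq_cis norm_mult norm_of_real by (intro mult_mono) (auto simp: norm_mult)
qed

lemma borel_measurable_fourier [measurable (raw)]:
  assumes [measurable]: "w \<in> borel_measurable borel"
  shows "fourier w \<in> borel_measurable borel"
proof -
  have "(\<lambda>\<zeta>. \<integral>z. w z * cis (- (z \<bullet> \<zeta>)) \<partial>lborel) \<in> borel_measurable borel"
    by (rule lborel.borel_measurable_lebesgue_integral) measurable
  then show ?thesis
    unfolding fourier_eq_cis[abs_def] by measurable
qed

text \<open>Up to sign, multiplication by \<tau>^2 or \<xi>^2 corresponds to a second derivative of
  u. So (1 + \<tau>^2) (1 + \<xi>^2) times the transform is bounded by the L^1 norms of u and three
  of its derivatives, which is integrable decay.\<close>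

lemma integrable_fourier_schwartz:
  assumes u: "schwartz u"
  shows "integrable lborel (fourier u)"
proof -
  define N where "N vs = 1 / (2 * pi) * (\<integral>z. cmod (foldr dir_deriv vs u z) \<partial>lborel)" for vs
  let ?x = "(0, 1) :: real \<times> real" and ?t = "(1, 0) :: real \<times> real"
  \<comment> \<open>The 4 is the product of the two constants in (bracket s)^2 \<le> 2 (1 + s^2),
    applied to \<tau> and to \<xi>.\<close>
  define C where "C = 4 * (N [] + N [?t, ?t] + N [?x, ?x] + N [?t, ?t, ?x, ?x])"
  have bd: "cmod (fourier u (\<tau>, \<xi>)) \<le> C * (bracket \<tau> powr (-2) * bracket \<xi> powr (-2))" for \<tau> \<xi>
  proof -
    note b = Basis_real_pair
    have x2: "fourier (foldr dir_deriv [?x, ?x] u) (\<tau>, \<xi>) = (\<i> * complex_of_real \<xi>)\<^sup>2 * fourier u (\<tau>, \<xi>)"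
      using fourier_schwartz_derivative(1)[OF u, of "[?x]"] fourier_schwartz_derivative(1)[OF u, of "[]"] b
      by (simp add: power2_eq_square)
    have t2: "fourier (foldr dir_deriv [?t, ?t] u) (\<tau>, \<xi>) = (\<i> * complex_of_real \<tau>)\<^sup>2 * fourier u (\<tau>, \<xi>)"
      using fourier_schwartz_derivative(2)[OF u, of "[?t]"] fourier_schwartz_derivative(2)[OF u, of "[]"] b
      by (simp add: power2_eq_square)
    have t2x2: "fourier (foldr dir_deriv [?t, ?t, ?x, ?x] u) (\<tau>, \<xi>)
        = (\<i> * complex_of_real \<tau>)\<^sup>2 * fourier (foldr dir_deriv [?x, ?x] u) (\<tau>, \<xi>)"
      using fourier_schwartz_derivative(2)[OF u, of "[?t, ?x, ?x]"] fourier_schwartz_derivative(2)[OF u, of "[?x, ?x]"] b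
      by (simp add: power2_eq_square)
    define a where "a = cmod (fourier u (\<tau>, \<xi>))"
    have "a \<le> N []" using cmod_fourier_le[of u "(\<tau>, \<xi>)"] by (simp add: a_def N_def)
    moreover have "\<xi>\<^sup>2 * a \<le> N [?x, ?x]"
      using cmod_fourier_le[of "foldr dir_deriv [?x, ?x] u" "(\<tau>, \<xi>)"] unfolding x2 N_def[symmetric]
      by (simp add: a_def norm_mult norm_power)
    moreover have "\<tau>\<^sup>2 * a \<le> N [?t, ?t]"
      using cmod_fourier_le[of "foldr dir_deriv [?t, ?t] u" "(\<tau>, \<xi>)"] unfolding t2 N_def[symmetric]
      by (simp add: a_def norm_mult norm_power)
    moreover have "\<tau>\<^sup>2 * (\<xi>\<^sup>2 * a) \<le> N [?t, ?t, ?x, ?x]"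
      using cmod_fourier_le[of "foldr dir_deriv [?t, ?t, ?x, ?x] u" "(\<tau>, \<xi>)"] unfolding t2x2 x2 N_def[symmetric]
      by (simp add: a_def norm_mult norm_power)
    ultimately have 1: "4 * ((1 + \<tau>\<^sup>2) * (1 + \<xi>\<^sup>2) * a) \<le> C"
      by (simp add: C_def algebra_simps)
    have br: "(bracket s)\<^sup>2 \<le> 2 * (1 + s\<^sup>2)" for s
      using sum_squares_ge_zero[of "\<bar>s\<bar> - 1" 0] by (simp add: bracket_def power2_eq_square algebra_simps)
    have "(bracket \<tau>)\<^sup>2 * (bracket \<xi>)\<^sup>2 * a \<le> (2 * (1 + \<tau>\<^sup>2)) * (2 * (1 + \<xi>\<^sup>2)) * a"
      by (intro mult_mono mult_right_mono br) (auto simp: a_def)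
    also have "\<dots> \<le> C" using 1 by (simp add: algebra_simps)
    finally have "a \<le> C / ((bracket \<tau>)\<^sup>2 * (bracket \<xi>)\<^sup>2)"
      using bracket_pos[of \<tau>] bracket_pos[of \<xi>] by (simp add: field_simps)
    then show ?thesis
      using bracket_pos[of \<tau>] bracket_pos[of \<xi>] by (simp add: powr_minus divide_inverse a_def)
  qed
  have [measurable]: "u \<in> borel_measurable borel"
    using schwartz_rapid[OF u, of "[]"] by (auto simp: rapid_def intro: borel_measurable_continuous_onI)
  show ?thesis
  proof (rule Bochner_Integration.integrable_bound)
    show "integrable lborel (\<lambda>z :: real \<times> real. C * (bracket (fst z) powr (-2) * bracket (snd z) powr (-2)))"
      by (intro integrable_mult_right integrable_bracket_powr_pair)
    show "fourier u \<in> borel_measurable lborel" by measurable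
    show "AE z in lborel. norm (fourier u z) \<le> norm (C * (bracket (fst z) powr (-2) * bracket (snd z) powr (-2)))"
      using bd by (auto intro!: AE_I2 order_trans[OF _ abs_ge_self])
  qed
qed

section \<open>Fourier inversion and products\<close>

text \<open>Read off from the characteristic function of the standard normal distribution.\<close>

lemma gaussian_fourier_real:
  "integrable lborel (\<lambda>s :: real. exp (- s\<^sup>2 / 2))"
  "(\<integral>s. cis (s * a) * complex_of_real (exp (- s\<^sup>2 / 2)) \<partial>lborel) = complex_of_real (sqrt (2 * pi) * exp (- a\<^sup>2 / 2))"
proof -
  have nd: "std_normal_density s = exp (- s\<^sup>2 / 2) / sqrt (2 * pi)" for s
    by (simp add: std_normal_density_def)
  have "integrable lborel (\<lambda>s. sqrt (2 * pi) * std_normal_density s)"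
    by (intro integrable_mult_right integrable_normal_density) simp
  then show "integrable lborel (\<lambda>s :: real. exp (- s\<^sup>2 / 2))" by (simp add: nd)
  have "complex_of_real (exp (- a\<^sup>2 / 2)) = (\<integral>s. iexp (a * s) \<partial>std_normal_distribution)"
    using fun_cong[OF char_std_normal_distribution, of a] by (simp add: char_def)
  also have "\<dots> = (\<integral>s. std_normal_density s *\<^sub>R iexp (a * s) \<partial>lborel)"
    by (rule integral_density) (auto simp: normal_density_nonneg)
  also have "\<dots> = (\<integral>s. complex_of_real (1 / sqrt (2 * pi)) * (cis (s * a) * complex_of_real (exp (- s\<^sup>2 / 2))) \<partial>lborel)"
    by (intro Bochner_Integration.integral_cong refl) (simp add: nd cis_conv_exp scaleR_conv_of_real mult_ac)
  also have "\<dots> = complex_of_real (1 / sqrt (2 * pi)) * (\<integral>s. cis (s * a) * complex_of_real (exp (- s\<^sup>2 / 2)) \<partial>lborel)"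
    by simp
  finally show "(\<integral>s. cis (s * a) * complex_of_real (exp (- s\<^sup>2 / 2)) \<partial>lborel) = complex_of_real (sqrt (2 * pi) * exp (- a\<^sup>2 / 2))"
    by (simp add: field_simps)
qed

text \<open>Supplies the integrability that Fubini needs for inversion and convolution, where k is
  an oscillating factor of modulus 1.\<close>

lemma integrable_product:
  fixes f :: "'a::euclidean_space \<Rightarrow> complex" and g :: "'b::euclidean_space \<Rightarrow> complex"
  assumes f: "integrable lborel f" and g: "integrable lborel g"
    and [measurable]: "case_prod k \<in> borel_measurable (lborel \<Otimes>\<^sub>M lborel)" and k: "\<And>x y. cmod (k x y) \<le> 1"
  shows "integrable (lborel \<Otimes>\<^sub>M lborel) (\<lambda>(x, y). f x * g y * k x y)"
proof -
  have [measurable]: "f \<in> borel_measurable lborel" "g \<in> borel_measurable lborel" using f g by auto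
  show ?thesis
  proof (rule integrableI_bounded)
    show "(\<lambda>(x, y). f x * g y * k x y) \<in> borel_measurable (lborel \<Otimes>\<^sub>M lborel)" by measurable
    have "(\<integral>\<^sup>+z. ennreal (norm (case z of (x, y) \<Rightarrow> f x * g y * k x y)) \<partial>(lborel \<Otimes>\<^sub>M lborel))
      \<le> (\<integral>\<^sup>+z. ennreal (cmod (f (fst z))) * ennreal (cmod (g (snd z))) \<partial>(lborel \<Otimes>\<^sub>M lborel))"
    proof (intro nn_integral_mono)
      fix z :: "'a \<times> 'b"
      obtain x y where z: "z = (x, y)" by (cases z)
      have "cmod (f x) * cmod (g y) * cmod (k x y) \<le> cmod (f x) * cmod (g y) * 1"
        by (intro mult_left_mono k) auto
      then show "ennreal (norm (case z of (x, y) \<Rightarrow> f x * g y * k x y)) \<le> ennreal (cmod (f (fst z))) * ennreal (cmod (g (snd z)))"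
        by (simp add: z norm_mult ennreal_leI flip: ennreal_mult')
    qed
    also have "\<dots> = (\<integral>\<^sup>+x. \<integral>\<^sup>+y. ennreal (cmod (f x)) * ennreal (cmod (g y)) \<partial>lborel \<partial>lborel)"
      by (subst lborel.nn_integral_fst[symmetric]) simp_all
    also have "\<dots> = (\<integral>\<^sup>+x. ennreal (cmod (f x)) \<partial>lborel) * (\<integral>\<^sup>+y. ennreal (cmod (g y)) \<partial>lborel)"
      by (simp add: nn_integral_cmult nn_integral_multc)
    also have "\<dots> < \<infinity>"
      using f g by (simp add: integrable_iff_bounded ennreal_mult_less_top)
    finally show "(\<integral>\<^sup>+z. ennreal (norm (case z of (x, y) \<Rightarrow> f x * g y * k x y)) \<partial>(lborel \<Otimes>\<^sub>M lborel)) < \<infinity>" .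
  qed
qed

lemma gaussian_fourier_pair:
  fixes a :: "real \<times> real"
  shows "integrable lborel (\<lambda>z :: real \<times> real. exp (- (z \<bullet> z) / 2))"
    "(\<integral>z. cis (z \<bullet> a) * complex_of_real (exp (- (z \<bullet> z) / 2)) \<partial>lborel) = complex_of_real (2 * pi * exp (- (a \<bullet> a) / 2))"
proof -
  obtain a1 a2 where a: "a = (a1, a2)" by (cases a)
  let ?g = "\<lambda>s :: real. complex_of_real (exp (- s\<^sup>2 / 2))"
  have g: "integrable lborel ?g" using gaussian_fourier_real(1) by simp
  have split: "exp (- ((s, r) \<bullet> (s, r)) / 2) = exp (- s\<^sup>2 / 2) * exp (- r\<^sup>2 / 2)" for s r :: real
    by (simp add: inner_prod_def power2_eq_square diff_divide_distrib flip: exp_add)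
  have int: "integrable lborel (\<lambda>z :: real \<times> real. complex_of_real (exp (- (z \<bullet> z) / 2)))"
  proof -
    have "exp (- (z \<bullet> z) / 2) = exp (- (fst z)\<^sup>2 / 2) * exp (- (snd z)\<^sup>2 / 2)" for z :: "real \<times> real"
      using split[of "fst z" "snd z"] by simp
    then show ?thesis
      using integrable_product[OF g g, of "\<lambda>_ _. 1"] unfolding lborel_prod case_prod_beta' by simp
  qed
  then show "integrable lborel (\<lambda>z :: real \<times> real. exp (- (z \<bullet> z) / 2))"
    unfolding complex_of_real_integrable_eq .
  have "integrable lborel (\<lambda>z. complex_of_real (exp (- (z \<bullet> z) / 2)) * cis (z \<bullet> a))"
    by (intro integrable_mult_cis int) measurable
  then have "(\<integral>z. complex_of_real (exp (- (z \<bullet> z) / 2)) * cis (z \<bullet> a) \<partial>lborel)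
      = (\<integral>s. \<integral>r. complex_of_real (exp (- ((s, r) \<bullet> (s, r)) / 2)) * cis ((s, r) \<bullet> a) \<partial>lborel \<partial>lborel)"
    by (rule integral_lborel_pair)
  also have "\<dots> = (\<integral>s. \<integral>r. (cis (s * a1) * ?g s) * (cis (r * a2) * ?g r) \<partial>lborel \<partial>lborel)"
    unfolding split by (simp add: a inner_prod_def mult_ac flip: cis_mult)
  also have "\<dots> = (\<integral>s. cis (s * a1) * ?g s \<partial>lborel) * (\<integral>r. cis (r * a2) * ?g r \<partial>lborel)"
    by simp
  also have "\<dots> = complex_of_real ((sqrt (2 * pi) * sqrt (2 * pi)) * (exp (- a1\<^sup>2 / 2) * exp (- a2\<^sup>2 / 2)))"
    unfolding gaussian_fourier_real(2) by (simp only: of_real_mult mult_ac)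
  also have "\<dots> = complex_of_real (2 * pi * exp (- (a \<bullet> a) / 2))"
    unfolding a split by simp
  finally show "(\<integral>z. cis (z \<bullet> a) * complex_of_real (exp (- (z \<bullet> z) / 2)) \<partial>lborel) = complex_of_real (2 * pi * exp (- (a \<bullet> a) / 2))"
    by (simp only: mult.commute)
qed

lemma integral_lborel_affine_pair:
  fixes f :: "real \<times> real \<Rightarrow> complex"
  assumes [measurable]: "f \<in> borel_measurable borel" and c: "c \<noteq> 0"
  shows "(\<integral>z. f z \<partial>lborel) = complex_of_real (c\<^sup>2) * (\<integral>z. f (t + c *\<^sub>R z) \<partial>lborel)"
    and "integrable lborel (\<lambda>z. f (t + c *\<^sub>R z)) \<longleftrightarrow> integrable lborel f"
proof -
  have D: "lborel = density (distr lborel borel (\<lambda>z :: real \<times> real. t + c *\<^sub>R z)) (\<lambda>_. ennreal (c\<^sup>2))"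
    using lborel_affine[OF c, of t] by (simp add: power2_eq_square)
  show "(\<integral>z. f z \<partial>lborel) = complex_of_real (c\<^sup>2) * (\<integral>z. f (t + c *\<^sub>R z) \<partial>lborel)"
    by (subst D) (simp add: integral_density integral_distr scaleR_conv_of_real)
  show "integrable lborel (\<lambda>z. f (t + c *\<^sub>R z)) \<longleftrightarrow> integrable lborel f"
  proof -
    have "integrable lborel f \<longleftrightarrow> integrable lborel (\<lambda>z. c\<^sup>2 *\<^sub>R f (t + c *\<^sub>R z))"
      by (subst D) (simp add: integrable_density integrable_distr_eq)
    also have "\<dots> \<longleftrightarrow> integrable lborel (\<lambda>z. f (t + c *\<^sub>R z))"
    proof
      assume "integrable lborel (\<lambda>z. c\<^sup>2 *\<^sub>R f (t + c *\<^sub>R z))"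
      from Bochner_Integration.integrable_scaleR_right[of "inverse (c\<^sup>2)", OF this]
      show "integrable lborel (\<lambda>z. f (t + c *\<^sub>R z))"
        using c by simp
    qed (intro Bochner_Integration.integrable_scaleR_right)
    finally show ?thesis ..
  qed
qed

lemma gaussian_fourier_scaled:
  fixes a :: "real \<times> real"
  assumes e: "0 < e"
  shows "integrable lborel (\<lambda>z :: real \<times> real. exp (- (e\<^sup>2 * (z \<bullet> z)) / 2))"
    "(\<integral>z. cis (z \<bullet> a) * complex_of_real (exp (- (e\<^sup>2 * (z \<bullet> z)) / 2)) \<partial>lborel)
      = complex_of_real (2 * pi / e\<^sup>2 * exp (- (a \<bullet> a) / (2 * e\<^sup>2)))"
proof -
  have sc: "(e *\<^sub>R z) \<bullet> (e *\<^sub>R z) = e\<^sup>2 * (z \<bullet> z)" for z :: "real \<times> real"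
    by (simp add: power2_eq_square)
  have inv: "inverse e * (e * s) = s" for s using e by simp
  let ?G = "\<lambda>z :: real \<times> real. complex_of_real (exp (- (z \<bullet> z) / 2))"
  have "integrable lborel (\<lambda>z. ?G (0 + e *\<^sub>R z))"
    using e gaussian_fourier_pair(1) by (subst integral_lborel_affine_pair(2)) auto
  then show "integrable lborel (\<lambda>z :: real \<times> real. exp (- (e\<^sup>2 * (z \<bullet> z)) / 2))"
    unfolding add_0 sc complex_of_real_integrable_eq .
  have "(\<integral>z. cis (z \<bullet> (a /\<^sub>R e)) * ?G z \<partial>lborel) = complex_of_real (e\<^sup>2) * (\<integral>z. cis ((0 + e *\<^sub>R z) \<bullet> (a /\<^sub>R e)) * ?G (0 + e *\<^sub>R z) \<partial>lborel)"
    using e by (intro integral_lborel_affine_pair(1)) auto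
  also have "\<dots> = complex_of_real (e\<^sup>2) * (\<integral>z. cis (z \<bullet> a) * complex_of_real (exp (- (e\<^sup>2 * (z \<bullet> z)) / 2)) \<partial>lborel)"
    unfolding add_0 sc unfolding inner_scaleR_left inner_scaleR_right inv ..
  finally have "complex_of_real (e\<^sup>2) * (\<integral>z. cis (z \<bullet> a) * complex_of_real (exp (- (e\<^sup>2 * (z \<bullet> z)) / 2)) \<partial>lborel)
      = complex_of_real (2 * pi * exp (- ((a /\<^sub>R e) \<bullet> (a /\<^sub>R e)) / 2))"
    by (simp only: gaussian_fourier_pair(2))
  also have "(a /\<^sub>R e) \<bullet> (a /\<^sub>R e) = (a \<bullet> a) / e\<^sup>2"
    by (simp add: power2_eq_square divide_inverse)
  finally show "(\<integral>z. cis (z \<bullet> a) * complex_of_real (exp (- (e\<^sup>2 * (z \<bullet> z)) / 2)) \<partial>lborel)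
      = complex_of_real (2 * pi / e\<^sup>2 * exp (- (a \<bullet> a) / (2 * e\<^sup>2)))"
    using e by (simp add: field_simps)
qed

section \<open>Inversion and the convolution formula\<close>

text \<open>Gaussian summation: a factor exp (- e^2 |\<eta>|^2 / 2) is inserted and the integral is
  followed in two ways as e tends to 0. Directly it tends to the left side. After Fubini it is a
  Gaussian average of u around z at scale e, of total mass 2 pi, and tends to the right
  side.\<close>

lemma fourier_inversion:
  assumes cont: "continuous_on UNIV u" and bdd: "\<And>z. cmod (u z) \<le> B" and u: "integrable lborel u"
    and fu: "integrable lborel (fourier u)"
  shows "(\<integral>\<eta>. fourier u \<eta> * cis (z \<bullet> \<eta>) \<partial>lborel) = complex_of_real (2 * pi) * u z"
proof -
  have um[measurable]: "u \<in> borel_measurable borel" using u by auto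
  have fm[measurable]: "fourier u \<in> borel_measurable borel" by measurable
  define e where "e n = 1 / real (Suc n)" for n
  have e: "0 < e n" for n by (simp add: e_def)
  have e_lim: "e \<longlonglongrightarrow> 0" unfolding e_def by (rule LIMSEQ_Suc[OF lim_const_over_n])
  define I where "I n = (\<integral>\<eta>. fourier u \<eta> * cis (z \<bullet> \<eta>) * complex_of_real (exp (- ((e n)\<^sup>2 * (\<eta> \<bullet> \<eta>)) / 2)) \<partial>lborel)" for n
  have lim1: "I \<longlonglongrightarrow> (\<integral>\<eta>. fourier u \<eta> * cis (z \<bullet> \<eta>) \<partial>lborel)"
    unfolding I_def
  proof (rule integral_dominated_convergence[where w = "\<lambda>\<eta>. cmod (fourier u \<eta>)"])
    show "AE \<eta> in lborel. (\<lambda>n. fourier u \<eta> * cis (z \<bullet> \<eta>) * complex_of_real (exp (- ((e n)\<^sup>2 * (\<eta> \<bullet> \<eta>)) / 2))) \<longlonglongrightarrow> fourier u \<eta> * cis (z \<bullet> \<eta>)"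
    proof (rule AE_I2)
      fix \<eta>
      have "(\<lambda>n. fourier u \<eta> * cis (z \<bullet> \<eta>) * complex_of_real (exp (- ((e n)\<^sup>2 * (\<eta> \<bullet> \<eta>)) / 2)))
        \<longlonglongrightarrow> fourier u \<eta> * cis (z \<bullet> \<eta>) * complex_of_real (exp (- (0\<^sup>2 * (\<eta> \<bullet> \<eta>)) / 2))"
        by (intro tendsto_intros e_lim) auto
      then show "(\<lambda>n. fourier u \<eta> * cis (z \<bullet> \<eta>) * complex_of_real (exp (- ((e n)\<^sup>2 * (\<eta> \<bullet> \<eta>)) / 2))) \<longlonglongrightarrow> fourier u \<eta> * cis (z \<bullet> \<eta>)"
        by simp
    qed
  qed (use fu in \<open>auto simp: norm_mult mult_left_le\<close>)
  \<comment> \<open>Fubini leaves the transform of the Gaussian centred at z. The substitution w = z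
    + e y brings it to unit scale, and the Jacobian e^2 of the plane cancels its factor 1 /
    e^2.\<close>
  have I_eq: "I n = (\<integral>y. u (z + e n *\<^sub>R y) * complex_of_real (exp (- (y \<bullet> y) / 2)) \<partial>lborel)" for n
  proof -
    let ?G = "\<lambda>\<eta> :: real \<times> real. complex_of_real (exp (- ((e n)\<^sup>2 * (\<eta> \<bullet> \<eta>)) / 2))"
    let ?k = "\<lambda>w \<eta>. cis ((z - w) \<bullet> \<eta>)"
    have G: "integrable lborel ?G" using gaussian_fourier_scaled(1)[OF e] by simp
    have int: "integrable (lborel \<Otimes>\<^sub>M lborel) (\<lambda>(w, \<eta>). u w * ?G \<eta> * ?k w \<eta>)"
    proof (rule integrable_product[OF u G])
      show "case_prod ?k \<in> borel_measurable (lborel \<Otimes>\<^sub>M lborel)" by measurable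
    qed simp
    have "I n = (\<integral>\<eta>. \<integral>w. complex_of_real (1 / (2 * pi)) * (u w * ?G \<eta> * ?k w \<eta>) \<partial>lborel \<partial>lborel)"
      unfolding I_def
    proof (rule Bochner_Integration.integral_cong[OF refl])
      fix \<eta>
      have "fourier u \<eta> * cis (z \<bullet> \<eta>) * ?G \<eta>
         = complex_of_real (1 / (2 * pi)) * ((\<integral>w. u w * cis (- (w \<bullet> \<eta>)) \<partial>lborel) * (cis (z \<bullet> \<eta>) * ?G \<eta>))"
        by (simp add: fourier_eq_cis)
      also have "(\<integral>w. u w * cis (- (w \<bullet> \<eta>)) \<partial>lborel) * (cis (z \<bullet> \<eta>) * ?G \<eta>)
          = (\<integral>w. (u w * cis (- (w \<bullet> \<eta>))) * (cis (z \<bullet> \<eta>) * ?G \<eta>) \<partial>lborel)"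
        by simp
      also have "\<dots> = (\<integral>w. u w * ?G \<eta> * ?k w \<eta> \<partial>lborel)"
        by (intro Bochner_Integration.integral_cong refl) (simp add: cis_mult inner_diff_left mult_ac)
      finally show "fourier u \<eta> * cis (z \<bullet> \<eta>) * ?G \<eta> = (\<integral>w. complex_of_real (1 / (2 * pi)) * (u w * ?G \<eta> * ?k w \<eta>) \<partial>lborel)"
        by simp
    qed
    also have "\<dots> = complex_of_real (1 / (2 * pi)) * (\<integral>\<eta>. \<integral>w. u w * ?G \<eta> * ?k w \<eta> \<partial>lborel \<partial>lborel)"
      by simp
    also have "(\<integral>\<eta>. \<integral>w. u w * ?G \<eta> * ?k w \<eta> \<partial>lborel \<partial>lborel) = (\<integral>w. \<integral>\<eta>. u w * ?G \<eta> * ?k w \<eta> \<partial>lborel \<partial>lborel)"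
      by (rule lborel_pair.Fubini_integral[OF int])
    also have "\<dots> = (\<integral>w. u w * (\<integral>\<eta>. cis (\<eta> \<bullet> (z - w)) * ?G \<eta> \<partial>lborel) \<partial>lborel)"
      by (simp add: mult_ac inner_commute)
    also have "\<dots> = (\<integral>w. u w * complex_of_real (2 * pi / (e n)\<^sup>2 * exp (- ((z - w) \<bullet> (z - w)) / (2 * (e n)\<^sup>2))) \<partial>lborel)"
      by (simp only: gaussian_fourier_scaled(2)[OF e])
    also have "\<dots> = complex_of_real ((e n)\<^sup>2) * (\<integral>y. u (z + e n *\<^sub>R y)
        * complex_of_real (2 * pi / (e n)\<^sup>2 * exp (- ((z - (z + e n *\<^sub>R y)) \<bullet> (z - (z + e n *\<^sub>R y))) / (2 * (e n)\<^sup>2))) \<partial>lborel)"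
      using e[of n] by (intro integral_lborel_affine_pair(1)) auto
    also have "\<dots> = complex_of_real ((e n)\<^sup>2) * (\<integral>y. complex_of_real (2 * pi / (e n)\<^sup>2) * (u (z + e n *\<^sub>R y)
        * complex_of_real (exp (- (y \<bullet> y) / 2))) \<partial>lborel)"
    proof -
      have "- ((z - (z + e n *\<^sub>R y)) \<bullet> (z - (z + e n *\<^sub>R y))) / (2 * (e n)\<^sup>2) = - (y \<bullet> y) / 2" for y
        using e[of n] by (simp add: power2_eq_square)
      then show ?thesis by (simp only: of_real_mult mult_ac)
    qed
    also have "\<dots> = complex_of_real (2 * pi) * (\<integral>y. u (z + e n *\<^sub>R y) * complex_of_real (exp (- (y \<bullet> y) / 2)) \<partial>lborel)"
      using e[of n] by simp
    finally show ?thesis by simp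
  qed
  \<comment> \<open>Boundedness of u supplies the dominating function, continuity the pointwise
    limit.\<close>
  have lim2: "I \<longlonglongrightarrow> (\<integral>(y :: real \<times> real). u z * complex_of_real (exp (- (y \<bullet> y) / 2)) \<partial>lborel)"
    unfolding I_eq
  proof (rule integral_dominated_convergence[where w = "\<lambda>y. B * exp (- (y \<bullet> y) / 2)"])
    show "AE y in lborel. (\<lambda>n. u (z + e n *\<^sub>R y) * complex_of_real (exp (- (y \<bullet> y) / 2))) \<longlonglongrightarrow> u z * complex_of_real (exp (- (y \<bullet> y) / 2))"
    proof (rule AE_I2)
      fix y :: "real \<times> real"
      have "(\<lambda>n. z + e n *\<^sub>R y) \<longlonglongrightarrow> z + 0 *\<^sub>R y" by (intro tendsto_intros e_lim)
      moreover have "isCont u (z + 0 *\<^sub>R y)" using cont unfolding continuous_on_eq_continuous_at[OF open_UNIV] by blast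
      ultimately have "(\<lambda>n. u (z + e n *\<^sub>R y)) \<longlonglongrightarrow> u (z + 0 *\<^sub>R y)" by (rule isCont_tendsto_compose[rotated])
      then show "(\<lambda>n. u (z + e n *\<^sub>R y) * complex_of_real (exp (- (y \<bullet> y) / 2))) \<longlonglongrightarrow> u z * complex_of_real (exp (- (y \<bullet> y) / 2))"
        by (intro tendsto_mult tendsto_const) simp
    qed
    show "integrable lborel (\<lambda>y :: real \<times> real. B * exp (- (y \<bullet> y) / 2))"
      by (intro integrable_mult_right gaussian_fourier_pair(1))
  qed (auto simp: norm_mult bdd)
  have "(\<integral>(y :: real \<times> real). u z * complex_of_real (exp (- (y \<bullet> y) / 2)) \<partial>lborel) = complex_of_real (2 * pi) * u z"
    using gaussian_fourier_pair(2)[of 0] by simp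
  then show ?thesis using LIMSEQ_unique[OF lim1 lim2] by simp
qed

text \<open>Inversion is applied to u alone, followed by Fubini. Hence the asymmetric hypotheses: u
  must have an integrable transform, while w may be any integrable function, such as the conjugate
  of a Schwartz function.\<close>

lemma fourier_mult:
  assumes u: "continuous_on UNIV u" "\<And>z. cmod (u z) \<le> B" "integrable lborel u" "integrable lborel (fourier u)"
    and w: "integrable lborel w"
  shows "fourier (\<lambda>z. u z * w z) \<zeta> = complex_of_real (1 / (2 * pi)) * (\<integral>\<eta>. fourier u \<eta> * fourier w (\<zeta> - \<eta>) \<partial>lborel)"
proof -
  have [measurable]: "w \<in> borel_measurable borel" using w by auto
  let ?k = "\<lambda>\<eta> z. cis (- (z \<bullet> (\<zeta> - \<eta>)))"
  have int: "integrable (lborel \<Otimes>\<^sub>M lborel) (\<lambda>(\<eta>, z). fourier u \<eta> * w z * ?k \<eta> z)"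
  proof (rule integrable_product[OF u(4) w])
    show "case_prod ?k \<in> borel_measurable (lborel \<Otimes>\<^sub>M lborel)" by measurable
  qed simp
  have "(\<integral>\<eta>. fourier u \<eta> * fourier w (\<zeta> - \<eta>) \<partial>lborel)
      = (\<integral>\<eta>. \<integral>z. complex_of_real (1 / (2 * pi)) * (fourier u \<eta> * w z * ?k \<eta> z) \<partial>lborel \<partial>lborel)"
  proof (rule Bochner_Integration.integral_cong[OF refl])
    fix \<eta>
    have "fourier u \<eta> * fourier w (\<zeta> - \<eta>)
      = complex_of_real (1 / (2 * pi)) * (fourier u \<eta> * (\<integral>z. w z * ?k \<eta> z \<partial>lborel))"
      by (simp add: fourier_eq_cis[of w])
    also have "fourier u \<eta> * (\<integral>z. w z * ?k \<eta> z \<partial>lborel) = (\<integral>z. fourier u \<eta> * w z * ?k \<eta> z \<partial>lborel)"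
      by (simp add: mult.assoc)
    finally show "fourier u \<eta> * fourier w (\<zeta> - \<eta>)
      = (\<integral>z. complex_of_real (1 / (2 * pi)) * (fourier u \<eta> * w z * ?k \<eta> z) \<partial>lborel)" by simp
  qed
  also have "\<dots> = complex_of_real (1 / (2 * pi)) * (\<integral>\<eta>. \<integral>z. fourier u \<eta> * w z * ?k \<eta> z \<partial>lborel \<partial>lborel)"
    by simp
  also have "(\<integral>\<eta>. \<integral>z. fourier u \<eta> * w z * ?k \<eta> z \<partial>lborel \<partial>lborel) = (\<integral>z. \<integral>\<eta>. fourier u \<eta> * w z * ?k \<eta> z \<partial>lborel \<partial>lborel)"
    by (rule lborel_pair.Fubini_integral[OF int, symmetric])
  also have "\<dots> = (\<integral>z. (w z * cis (- (z \<bullet> \<zeta>))) * (\<integral>\<eta>. fourier u \<eta> * cis (z \<bullet> \<eta>) \<partial>lborel) \<partial>lborel)"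
  proof (rule Bochner_Integration.integral_cong[OF refl])
    fix z
    have "(\<integral>\<eta>. fourier u \<eta> * w z * ?k \<eta> z \<partial>lborel) = (\<integral>\<eta>. (w z * cis (- (z \<bullet> \<zeta>))) * (fourier u \<eta> * cis (z \<bullet> \<eta>)) \<partial>lborel)"
      by (intro Bochner_Integration.integral_cong refl) (simp add: inner_diff_right cis_mult mult_ac)
    then show "(\<integral>\<eta>. fourier u \<eta> * w z * ?k \<eta> z \<partial>lborel) = (w z * cis (- (z \<bullet> \<zeta>))) * (\<integral>\<eta>. fourier u \<eta> * cis (z \<bullet> \<eta>) \<partial>lborel)"
      by simp
  qed
  also have "\<dots> = (\<integral>z. complex_of_real (2 * pi) * ((u z * w z) * cis (- (z \<bullet> \<zeta>))) \<partial>lborel)"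
    unfolding fourier_inversion[OF u] by (simp only: mult_ac)
  finally show ?thesis by (simp add: fourier_eq_cis[of "\<lambda>z. u z * w z"])
qed

text \<open>The reflection of the frequency is what turns the convolution for the second estimate
  into the shape g (z - w) of the trilinear form.\<close>

lemma fourier_cnj: "fourier (\<lambda>z. cnj (v z)) \<zeta> = cnj (fourier v (- \<zeta>))"
proof -
  have "cnj (\<integral>z. v z * cis (- (z \<bullet> (- \<zeta>))) \<partial>lborel) = (\<integral>z. cnj (v z * cis (- (z \<bullet> (- \<zeta>)))) \<partial>lborel)"
    by (rule Bochner_Integration.integral_cnj[symmetric])
  then show ?thesis unfolding fourier_eq_cis by (simp add: cis_cnj)
qed

section \<open>The bilinear estimates\<close>

lemma ennreal_sqrt_power2: "(ennreal_sqrt a)\<^sup>2 = a"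
  by (cases a) (auto simp: ennreal_sqrt_def ennreal_power)

lemma ennreal_power2_le_imp_le:
  fixes x y :: ennreal
  assumes "x\<^sup>2 \<le> y\<^sup>2"
  shows "x \<le> y"
proof (rule ccontr)
  assume "\<not> x \<le> y"
  then have "y < x" by simp
  then obtain r where r: "y = ennreal r" "0 \<le> r" by (cases y) auto
  have "y\<^sup>2 < x\<^sup>2"
  proof (cases x)
    case (real s)
    then have "r < s" using \<open>y < x\<close> r by (simp add: ennreal_less_iff)
    then have "r\<^sup>2 < s\<^sup>2" using r by (intro power_strict_mono) auto
    then show ?thesis
      unfolding r(1) real(2) ennreal_power[OF r(2)] ennreal_power[OF real(1)] by (subst ennreal_less_iff) auto
  next
    case top
    then show ?thesis by (simp add: r ennreal_power)
  qed
  with assms show False by simp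
qed

text \<open>The constant of a form bound may be zero or negative; the maximum with 1 makes the
  resulting constant positive.\<close>

lemma ennreal_sqrt_le_mult:
  assumes "A \<le> ennreal C * B * D"
  shows "ennreal_sqrt A \<le> ennreal (sqrt (max 1 C)) * ennreal_sqrt B * ennreal_sqrt D"
proof (rule ennreal_power2_le_imp_le)
  have "A \<le> ennreal C * B * D" by fact
  also have "\<dots> \<le> ennreal (max 1 C) * B * D"
    by (intro mult_right_mono ennreal_leI) auto
  also have "ennreal (max 1 C) = (ennreal (sqrt (max 1 C)))\<^sup>2"
    by (subst ennreal_power) auto
  finally show "(ennreal_sqrt A)\<^sup>2 \<le> (ennreal (sqrt (max 1 C)) * ennreal_sqrt B * ennreal_sqrt D)\<^sup>2"
    unfolding power_mult_distrib ennreal_sqrt_power2 .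
qed

text \<open>The converse of Cauchy-Schwarz, by testing with \<phi> itself, truncated in height and
  in space: then its square integral J is finite and can be cancelled in J^2 \<le> K J. The
  truncations increase to \<phi>, and monotone convergence removes them.\<close>

lemma nn_integral_power2_le_dual:
  fixes \<phi> :: "'a::euclidean_space \<Rightarrow> real"
  assumes [measurable]: "\<phi> \<in> borel_measurable borel"
    and dual: "\<And>h :: 'a \<Rightarrow> ennreal. h \<in> borel_measurable borel \<Longrightarrow>
      (\<integral>\<^sup>+z. h z * ennreal (\<phi> z) \<partial>lborel)\<^sup>2 \<le> K * (\<integral>\<^sup>+z. (h z)\<^sup>2 \<partial>lborel)"
  shows "(\<integral>\<^sup>+z. (ennreal (\<phi> z))\<^sup>2 \<partial>lborel) \<le> K"
proof -
  define h where "h n z = ennreal (min (\<phi> z) (real n)) * indicator (cball 0 (real n)) z" for n :: nat and z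
  have [measurable]: "cball (0 :: 'a) (real n) \<in> sets borel" for n by simp
  have h_meas[measurable]: "h n \<in> borel_measurable borel" for n unfolding h_def by measurable
  have h_le: "h n z \<le> ennreal (\<phi> z)" for n z
    by (auto simp: h_def indicator_def intro: ennreal_leI)
  have bound: "(\<integral>\<^sup>+z. (h n z)\<^sup>2 \<partial>lborel) \<le> K" for n
  proof -
    define J where "J = (\<integral>\<^sup>+z. (h n z)\<^sup>2 \<partial>lborel)"
    have "J \<le> (\<integral>\<^sup>+(z :: 'a). ennreal ((real n)\<^sup>2) * indicator (cball 0 (real n)) z \<partial>lborel)"
      unfolding J_def
    proof (rule nn_integral_mono)
      fix z
      have "ennreal (min (\<phi> z) (real n)) \<le> ennreal (real n)" by (rule ennreal_leI) simp
      from power_mono_ennreal[OF this, of 2]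
      show "(h n z)\<^sup>2 \<le> ennreal ((real n)\<^sup>2) * indicator (cball 0 (real n)) z"
        by (auto simp: h_def indicator_def ennreal_power simp del: ennreal_of_nat_eq_real_of_nat)
    qed
    also have "\<dots> = ennreal ((real n)\<^sup>2) * emeasure lborel (cball (0::'a) (real n))"
      by (simp add: nn_integral_cmult_indicator)
    also have "\<dots> < top"
      using emeasure_bounded_finite[OF bounded_cball, of "0::'a" "real n"] by (simp add: ennreal_mult_less_top)
    finally have fin: "J \<noteq> top" by simp
    have "J \<le> (\<integral>\<^sup>+z. h n z * ennreal (\<phi> z) \<partial>lborel)"
      unfolding J_def power2_eq_square by (intro nn_integral_mono mult_left_mono h_le) simp
    then have "J\<^sup>2 \<le> (\<integral>\<^sup>+z. h n z * ennreal (\<phi> z) \<partial>lborel)\<^sup>2" by (rule power_mono_ennreal)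
    also have "\<dots> \<le> K * J" unfolding J_def by (rule dual) measurable
    finally have "J * J \<le> J * K" by (simp add: power2_eq_square mult.commute)
    then have "J \<le> K" using fin by (cases "J = 0") (simp_all add: ennreal_mult_le_mult_iff)
    then show ?thesis by (simp add: J_def)
  qed
  have "(\<integral>\<^sup>+z. (ennreal (\<phi> z))\<^sup>2 \<partial>lborel) = (\<integral>\<^sup>+z. (SUP n. (h n z)\<^sup>2) \<partial>lborel)"
  proof (intro nn_integral_cong antisym)
    fix z
    obtain n where n: "max (\<phi> z) (norm z) \<le> real n" using real_arch_simple by blast
    then have "h n z = ennreal (\<phi> z)" by (simp add: h_def min_def)
    then show "(ennreal (\<phi> z))\<^sup>2 \<le> (SUP n. (h n z)\<^sup>2)" by (intro SUP_upper2[of n]) auto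
    show "(SUP n. (h n z)\<^sup>2) \<le> (ennreal (\<phi> z))\<^sup>2" by (intro SUP_least power_mono_ennreal h_le)
  qed
  also have "\<dots> = (SUP n. \<integral>\<^sup>+z. (h n z)\<^sup>2 \<partial>lborel)"
  proof (rule nn_integral_monotone_convergence_SUP)
    have "h m z \<le> h n z" if "m \<le> n" for m n z
      using that unfolding h_def by (intro mult_mono ennreal_leI) (auto simp: indicator_def)
    then show "incseq (\<lambda>n z. (h n z)\<^sup>2)"
      by (auto simp: incseq_def le_fun_def intro!: power_mono_ennreal)
  qed measurable
  also have "\<dots> \<le> K" by (intro SUP_least bound)
  finally show ?thesis .
qed

text \<open>For a non-integrable f the Bochner integral is 0 by convention, so no integrability has
  to be checked.\<close>

lemma ennreal_norm_integral_le:
  fixes f :: "'a \<Rightarrow> complex"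
  shows "ennreal (cmod (\<integral>x. f x \<partial>M)) \<le> (\<integral>\<^sup>+x. ennreal (cmod (f x)) \<partial>M)"
  by (cases "integrable M f") (simp_all add: integral_norm_bound_ennreal not_integrable_integral_eq)

lemma bracket_powr_power2: "(bracket x powr e)\<^sup>2 = bracket x powr (2 * e)"
  using bracket_pos[of x] by (simp add: powr_powr mult.commute flip: powr_numeral)

text \<open>Tonelli turns the iterated integral into one over the plane, and the integrand is
  written as a square, the shape used by duality and by \<open>form_bound\<close>.\<close>

lemma X_norm_eq:
  assumes [measurable]: "u \<in> borel_measurable borel"
  shows "X_norm s b u = ennreal_sqrt (\<integral>\<^sup>+z. (ennreal (bracket (mod_X z) powr b * bracket (snd z) powr s * cmod (fourier u z)))\<^sup>2 \<partial>lborel)"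
proof -
  have [measurable]: "fourier u \<in> borel_measurable borel" by measurable
  show ?thesis
    unfolding X_norm_def
    by (subst nn_integral_lborel_pair, measurable)
       (simp add: ennreal_power power_mult_distrib bracket_powr_power2 mod_X_def)
qed

lemma Y_norm_eq:
  assumes [measurable]: "u \<in> borel_measurable borel"
  shows "Y_norm \<gamma> s b u = ennreal_sqrt (\<integral>\<^sup>+z. (ennreal (bracket (mod_Y \<gamma> z) powr b * bracket (snd z) powr s * cmod (fourier u z)))\<^sup>2 \<partial>lborel)"
proof -
  have [measurable]: "fourier u \<in> borel_measurable borel" by measurable
  show ?thesis
    unfolding Y_norm_def
    by (subst nn_integral_lborel_pair, measurable)
       (simp add: ennreal_power power_mult_distrib bracket_powr_power2 mod_Y_def)
qed

lemma rapid_bounded: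
  assumes "rapid w"
  obtains B where "0 \<le> B" "\<And>z. cmod (w z) \<le> B"
proof -
  obtain C where C: "\<And>t x. cmod (w (t, x)) \<le> C * (bracket t powr (-2) * bracket x powr (-2))"
    using assms by (auto simp: rapid_def)
  have "cmod (w z) \<le> max 0 C" for z
  proof -
    obtain t x where z: "z = (t, x)" by (cases z)
    have "bracket t powr (-2) * bracket x powr (-2) \<le> 1 * 1"
      using bracket_powr_le_1[of 2 t] bracket_powr_le_1[of 2 x] by (intro mult_mono) auto
    then have "max 0 C * (bracket t powr (-2) * bracket x powr (-2)) \<le> max 0 C * 1"
      by (intro mult_left_mono) auto
    moreover have "C * (bracket t powr (-2) * bracket x powr (-2)) \<le> max 0 C * (bracket t powr (-2) * bracket x powr (-2))"
      by (intro mult_right_mono) auto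
    ultimately show ?thesis using C[of t x] unfolding z by linarith
  qed
  then show ?thesis using that[of "max 0 C"] by auto
qed

lemma rapid_cnj: "rapid w \<Longrightarrow> rapid (\<lambda>z. cnj (w z))"
  unfolding rapid_def by (auto intro!: continuous_intros)

lemma rapid_add:
  assumes "rapid v" "rapid w"
  shows "rapid (\<lambda>z. v z + w z)"
proof -
  obtain C D where C: "\<And>t x. cmod (v (t, x)) \<le> C * (bracket t powr (-2) * bracket x powr (-2))"
    and D: "\<And>t x. cmod (w (t, x)) \<le> D * (bracket t powr (-2) * bracket x powr (-2))"
    using assms by (auto simp: rapid_def)
  have "cmod (v (t, x) + w (t, x)) \<le> (C + D) * (bracket t powr (-2) * bracket x powr (-2))" for t x
    using norm_triangle_mono[OF C D, of t x t x] by (simp add: distrib_right)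
  then show ?thesis using assms unfolding rapid_def by (auto intro!: continuous_intros)
qed

lemma rapid_mult:
  assumes "rapid v" "rapid w"
  shows "rapid (\<lambda>z. v z * w z)"
proof -
  obtain B where B: "0 \<le> B" "\<And>z. cmod (v z) \<le> B" using rapid_bounded[OF assms(1)] by blast
  obtain D where D: "\<And>t x. cmod (w (t, x)) \<le> D * (bracket t powr (-2) * bracket x powr (-2))"
    using assms by (auto simp: rapid_def)
  have "cmod (v (t, x) * w (t, x)) \<le> B * D * (bracket t powr (-2) * bracket x powr (-2))" for t x
    using mult_mono[OF B(2)[of "(t, x)"] D[of t x] B(1) norm_ge_zero] by (simp add: norm_mult mult.assoc)
  then show ?thesis using assms unfolding rapid_def by (auto intro!: continuous_intros)
qed

lemma schwartz_imp_rapid: "schwartz u \<Longrightarrow> rapid u"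
  using schwartz_rapid[of u "[]"] by simp

lemma rapid_measurable: "rapid u \<Longrightarrow> u \<in> borel_measurable borel"
  by (simp add: rapid_def borel_measurable_continuous_onI)

text \<open>The convolution formula with absolute values inside; its factor 1 / (2 pi) is below 1
  and is dropped.\<close>

lemma cmod_fourier_mult_le:
  assumes u: "schwartz u" and w: "rapid w"
  shows "ennreal (cmod (fourier (\<lambda>z. u z * w z) \<zeta>)) \<le> (\<integral>\<^sup>+\<eta>. ennreal (cmod (fourier u \<eta>) * cmod (fourier w (\<zeta> - \<eta>))) \<partial>lborel)"
proof -
  have ru: "rapid u" using u by (rule schwartz_imp_rapid)
  then have cont: "continuous_on UNIV u" by (simp add: rapid_def)
  obtain B where B: "\<And>z. cmod (u z) \<le> B" using rapid_bounded[OF ru] by blast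
  have "cmod (fourier (\<lambda>z. u z * w z) \<zeta>) = cmod (complex_of_real (1 / (2 * pi)) * (\<integral>\<eta>. fourier u \<eta> * fourier w (\<zeta> - \<eta>) \<partial>lborel))"
    by (simp only: fourier_mult[OF cont B rapid_integrable[OF ru] integrable_fourier_schwartz[OF u] rapid_integrable[OF w]])
  also have "\<dots> = 1 / (2 * pi) * cmod (\<integral>\<eta>. fourier u \<eta> * fourier w (\<zeta> - \<eta>) \<partial>lborel)"
    unfolding norm_mult norm_of_real by simp
  also have "\<dots> \<le> 1 * cmod (\<integral>\<eta>. fourier u \<eta> * fourier w (\<zeta> - \<eta>) \<partial>lborel)"
    using pi_ge_two by (intro mult_right_mono) (auto simp: field_simps)
  finally have "ennreal (cmod (fourier (\<lambda>z. u z * w z) \<zeta>)) \<le> ennreal (cmod (\<integral>\<eta>. fourier u \<eta> * fourier w (\<zeta> - \<eta>) \<partial>lborel))"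
    by (intro ennreal_leI) simp
  also have "\<dots> \<le> (\<integral>\<^sup>+\<eta>. ennreal (cmod (fourier u \<eta> * fourier w (\<zeta> - \<eta>))) \<partial>lborel)"
    by (rule ennreal_norm_integral_le)
  finally show ?thesis by (simp add: norm_mult)
qed

text \<open>The product rule expresses the derivative through products of \<open>rapid\<close>
  functions, so it is \<open>rapid\<close> itself and integration by parts is justified.\<close>

lemma fourier_partial_x_mult_cnj:
  assumes u: "schwartz u" and v: "schwartz v"
  shows "rapid (partial_x (\<lambda>z. u z * cnj (v z)))"
    and "fourier (partial_x (\<lambda>z. u z * cnj (v z))) (\<tau>, \<xi>) = \<i> * complex_of_real \<xi> * fourier (\<lambda>z. u z * cnj (v z)) (\<tau>, \<xi>)"
proof -
  have diff: "u differentiable (at z)" "v differentiable (at z)" for z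
    using schwartz_differentiable[OF u, of "[]"] schwartz_differentiable[OF v, of "[]"] by auto
  have r: "rapid u" "rapid v" "rapid (partial_x u)" "rapid (partial_x v)"
    using schwartz_rapid[OF u, of "[]"] schwartz_rapid[OF v, of "[]"]
      schwartz_rapid[OF u, of "[(0, 1)]"] schwartz_rapid[OF v, of "[(0, 1)]"] Basis_real_pair by auto
  have eq: "partial_x (\<lambda>z. u z * cnj (v z)) z = u z * cnj (partial_x v z) + partial_x u z * cnj (v z)"
    and dif: "(\<lambda>z. u z * cnj (v z)) differentiable (at z)" for z
  proof -
    obtain Du Dv where D: "(u has_derivative Du) (at z)" "(v has_derivative Dv) (at z)"
      using diff[of z] by (auto simp: differentiable_def)
    have "((\<lambda>z. cnj (v z)) has_derivative (\<lambda>h. cnj (Dv h))) (at z)"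
      by (rule bounded_linear.has_derivative[OF bounded_linear_cnj D(2)])
    from has_derivative_mult[OF D(1) this]
    have "((\<lambda>z. u z * cnj (v z)) has_derivative (\<lambda>h. u z * cnj (Dv h) + Du h * cnj (v z))) (at z)" .
    then show "partial_x (\<lambda>z. u z * cnj (v z)) z = u z * cnj (partial_x v z) + partial_x u z * cnj (v z)"
      "(\<lambda>z. u z * cnj (v z)) differentiable (at z)"
      using dir_deriv_eq[OF D(1)] dir_deriv_eq[OF D(2)] dir_deriv_eq by (auto simp: differentiable_def)
  qed
  show r': "rapid (partial_x (\<lambda>z. u z * cnj (v z)))"
    unfolding eq[abs_def] by (intro rapid_add rapid_mult rapid_cnj r)
  show "fourier (partial_x (\<lambda>z. u z * cnj (v z))) (\<tau>, \<xi>) = \<i> * complex_of_real \<xi> * fourier (\<lambda>z. u z * cnj (v z)) (\<tau>, \<xi>)"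
    by (intro fourier_x_derivative rapid_mult rapid_cnj r r' dir_deriv_section(1) dif)
qed

section \<open>From the trilinear form to the bilinear estimates\<close>

text \<open>The transforms of u and v, multiplied by the weights of their norms, become f and g, so
  that their square integrals are the squared norms; the kernel carries the inverse weights. The
  dual function h sits at the output frequency z.\<close>

lemma bilinear_X_estimate:
  assumes bound: "form_bound (kern \<gamma> c1 b b1)"
  shows "\<exists>C::real. C > 0 \<and> (\<forall>u v. schwartz u \<longrightarrow> schwartz v \<longrightarrow>
        X_norm 0 (- c1) (\<lambda>z. u z * v z) \<le> ennreal C * Y_norm \<gamma> (- 1/2) b u * X_norm 0 b1 v)"
proof -
  obtain C where C: "\<And>f g h. f \<in> borel_measurable borel \<Longrightarrow> g \<in> borel_measurable borel \<Longrightarrow> h \<in> borel_measurable borel \<Longrightarrow>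
    (\<integral>\<^sup>+z. \<integral>\<^sup>+w. h z * f w * g (z - w) * kern \<gamma> c1 b b1 z w \<partial>lborel \<partial>lborel)\<^sup>2
      \<le> ennreal C * (\<integral>\<^sup>+z. (h z)\<^sup>2 \<partial>lborel) * (\<integral>\<^sup>+z. (f z)\<^sup>2 \<partial>lborel) * (\<integral>\<^sup>+z. (g z)\<^sup>2 \<partial>lborel)"
    using bound unfolding form_bound_def by blast
  show ?thesis
  proof (intro exI[of _ "sqrt (max 1 C)"] conjI allI impI)
    show "0 < sqrt (max 1 C)" by auto
    fix u v :: "real \<times> real \<Rightarrow> complex" assume u: "schwartz u" and v: "schwartz v"
    note r = schwartz_imp_rapid[OF u] schwartz_imp_rapid[OF v]
    have [measurable]: "u \<in> borel_measurable borel" "v \<in> borel_measurable borel"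
      using r by (auto intro: rapid_measurable)
    have [measurable]: "fourier u \<in> borel_measurable borel" "fourier v \<in> borel_measurable borel"
      "fourier (\<lambda>z. u z * v z) \<in> borel_measurable borel"
      by measurable
    \<comment> \<open>The factor \<open>powr 0\<close> keeps the integrand literally in the form in
      which the norm is rewritten for s = 0.\<close>
    define \<phi> where "\<phi> z = bracket (mod_X z) powr (- c1) * bracket (snd z) powr 0 * cmod (fourier (\<lambda>z. u z * v z) z)" for z
    define f where "f z = ennreal (bracket (mod_Y \<gamma> z) powr b * bracket (snd z) powr (- 1/2) * cmod (fourier u z))" for z
    define g where "g z = ennreal (bracket (mod_X z) powr b1 * bracket (snd z) powr 0 * cmod (fourier v z))" for z
    have [measurable]: "\<phi> \<in> borel_measurable borel" "f \<in> borel_measurable borel" "g \<in> borel_measurable borel"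
      unfolding \<phi>_def f_def g_def by measurable
    have [measurable]: "kern \<gamma> c1 b b1 z \<in> borel_measurable borel" for z
      using measurable_Pair2[OF borel_measurable_kern, of z] by simp
    have pw: "ennreal (\<phi> z) \<le> (\<integral>\<^sup>+w. f w * g (z - w) * kern \<gamma> c1 b b1 z w \<partial>lborel)" for z
    proof -
      have "ennreal (\<phi> z) = ennreal (bracket (mod_X z) powr (- c1)) * ennreal (cmod (fourier (\<lambda>z. u z * v z) z))"
        using bracket_pos[of "snd z"] by (simp add: \<phi>_def ennreal_mult')
      also have "\<dots> \<le> ennreal (bracket (mod_X z) powr (- c1)) * (\<integral>\<^sup>+w. ennreal (cmod (fourier u w) * cmod (fourier v (z - w))) \<partial>lborel)"
        by (intro mult_left_mono cmod_fourier_mult_le u r) simp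
      also have "\<dots> = (\<integral>\<^sup>+w. ennreal (bracket (mod_X z) powr (- c1)) * ennreal (cmod (fourier u w) * cmod (fourier v (z - w))) \<partial>lborel)"
        by (rule nn_integral_cmult[symmetric]) measurable
      also have "\<dots> = (\<integral>\<^sup>+w. f w * g (z - w) * kern \<gamma> c1 b b1 z w \<partial>lborel)"
      proof (rule nn_integral_cong)
        fix w
        have "bracket (snd w) powr (- 1/2) * bracket (snd w) powr (1/2) = 1"
          "bracket (mod_Y \<gamma> w) powr b * bracket (mod_Y \<gamma> w) powr (- b) = 1"
          "bracket (mod_X (z - w)) powr b1 * bracket (mod_X (z - w)) powr (- b1) = 1"
          "bracket (snd (z - w)) powr 0 = 1"
          using bracket_pos[of "snd w"] bracket_pos[of "mod_Y \<gamma> w"] bracket_pos[of "mod_X (z - w)"] bracket_pos[of "snd (z - w)"]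
          by (simp_all flip: powr_add)
        then have "bracket (mod_X z) powr (- c1) * (cmod (fourier u w) * cmod (fourier v (z - w)))
          = (bracket (snd w) powr (- 1/2) * bracket (snd w) powr (1/2)) * (bracket (mod_Y \<gamma> w) powr b * bracket (mod_Y \<gamma> w) powr (- b))
           * (bracket (mod_X (z - w)) powr b1 * bracket (mod_X (z - w)) powr (- b1)) * bracket (snd (z - w)) powr 0
           * (bracket (mod_X z) powr (- c1) * (cmod (fourier u w) * cmod (fourier v (z - w))))" by simp
        also have "\<dots> = (bracket (mod_Y \<gamma> w) powr b * bracket (snd w) powr (- 1/2) * cmod (fourier u w))
            * (bracket (mod_X (z - w)) powr b1 * bracket (snd (z - w)) powr 0 * cmod (fourier v (z - w)))
            * (bracket (snd w) powr (1/2) * bracket (mod_X z) powr (- c1) * bracket (mod_Y \<gamma> w) powr (- b) * bracket (mod_X (z - w)) powr (- b1))"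
          by (simp only: mult_ac)
        finally show "ennreal (bracket (mod_X z) powr (- c1)) * ennreal (cmod (fourier u w) * cmod (fourier v (z - w)))
          = f w * g (z - w) * kern \<gamma> c1 b b1 z w"
          unfolding f_def g_def kern_def by (simp flip: ennreal_mult')
      qed
      finally show ?thesis .
    qed
    have "(\<integral>\<^sup>+z. (ennreal (\<phi> z))\<^sup>2 \<partial>lborel) \<le> ennreal C * (\<integral>\<^sup>+z. (f z)\<^sup>2 \<partial>lborel) * (\<integral>\<^sup>+z. (g z)\<^sup>2 \<partial>lborel)"
    proof (rule nn_integral_power2_le_dual)
      fix h :: "real \<times> real \<Rightarrow> ennreal"
      assume [measurable]: "h \<in> borel_measurable borel"
      have "(\<integral>\<^sup>+z. h z * ennreal (\<phi> z) \<partial>lborel) \<le> (\<integral>\<^sup>+z. h z * (\<integral>\<^sup>+w. f w * g (z - w) * kern \<gamma> c1 b b1 z w \<partial>lborel) \<partial>lborel)"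
        by (intro nn_integral_mono mult_left_mono pw) simp
      also have "\<dots> = (\<integral>\<^sup>+z. \<integral>\<^sup>+w. h z * f w * g (z - w) * kern \<gamma> c1 b b1 z w \<partial>lborel \<partial>lborel)"
        by (subst nn_integral_cmult[symmetric]) (measurable, simp only: mult.assoc)
      finally have "(\<integral>\<^sup>+z. h z * ennreal (\<phi> z) \<partial>lborel)\<^sup>2 \<le> (\<integral>\<^sup>+z. \<integral>\<^sup>+w. h z * f w * g (z - w) * kern \<gamma> c1 b b1 z w \<partial>lborel \<partial>lborel)\<^sup>2"
        by (rule power_mono_ennreal)
      also have "\<dots> \<le> ennreal C * (\<integral>\<^sup>+z. (h z)\<^sup>2 \<partial>lborel) * (\<integral>\<^sup>+z. (f z)\<^sup>2 \<partial>lborel) * (\<integral>\<^sup>+z. (g z)\<^sup>2 \<partial>lborel)"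
        by (rule C) measurable
      finally show "(\<integral>\<^sup>+z. h z * ennreal (\<phi> z) \<partial>lborel)\<^sup>2 \<le> ennreal C * (\<integral>\<^sup>+z. (f z)\<^sup>2 \<partial>lborel) * (\<integral>\<^sup>+z. (g z)\<^sup>2 \<partial>lborel) * (\<integral>\<^sup>+z. (h z)\<^sup>2 \<partial>lborel)"
        by (simp only: mult_ac)
    qed measurable
    from ennreal_sqrt_le_mult[OF this]
    show "X_norm 0 (- c1) (\<lambda>z. u z * v z) \<le> ennreal (sqrt (max 1 C)) * Y_norm \<gamma> (- 1/2) b u * X_norm 0 b1 v"
      unfolding \<phi>_def f_def g_def by (subst X_norm_eq, measurable)+ (subst Y_norm_eq, measurable)
  qed
qed

text \<open>The output frequency is now w, so the dual function takes the slot of f while u and v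
  occupy z and z - w: the transform of the conjugate of v at w - z has the modulus of that of v at z
  - w. The derivative costs |\<xi>| \<le> bracket \<xi>, and - 1/2 + 1 = 1/2 is the weight of the
  kernel.\<close>

lemma bilinear_Y_estimate:
  assumes bound: "form_bound (kern \<gamma> b1 c b1)"
  shows "\<exists>C::real. C > 0 \<and> (\<forall>u v. schwartz u \<longrightarrow> schwartz v \<longrightarrow>
        Y_norm \<gamma> (- 1/2) (- c) (partial_x (\<lambda>z. u z * cnj (v z))) \<le> ennreal C * X_norm 0 b1 u * X_norm 0 b1 v)"
proof -
  obtain C where C: "\<And>f g h. f \<in> borel_measurable borel \<Longrightarrow> g \<in> borel_measurable borel \<Longrightarrow> h \<in> borel_measurable borel \<Longrightarrow>
    (\<integral>\<^sup>+z. \<integral>\<^sup>+w. h z * f w * g (z - w) * kern \<gamma> b1 c b1 z w \<partial>lborel \<partial>lborel)\<^sup>2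
      \<le> ennreal C * (\<integral>\<^sup>+z. (h z)\<^sup>2 \<partial>lborel) * (\<integral>\<^sup>+z. (f z)\<^sup>2 \<partial>lborel) * (\<integral>\<^sup>+z. (g z)\<^sup>2 \<partial>lborel)"
    using bound unfolding form_bound_def by blast
  show ?thesis
  proof (intro exI[of _ "sqrt (max 1 C)"] conjI allI impI)
    show "0 < sqrt (max 1 C)" by auto
    fix u v :: "real \<times> real \<Rightarrow> complex" assume u: "schwartz u" and v: "schwartz v"
    note r = schwartz_imp_rapid[OF u] schwartz_imp_rapid[OF v]
    let ?P = "partial_x (\<lambda>z. u z * cnj (v z))"
    have [measurable]: "u \<in> borel_measurable borel" "v \<in> borel_measurable borel" "?P \<in> borel_measurable borel"
      using r fourier_partial_x_mult_cnj(1)[OF u v] by (auto intro: rapid_measurable)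
    have [measurable]: "fourier u \<in> borel_measurable borel" "fourier v \<in> borel_measurable borel"
      "fourier ?P \<in> borel_measurable borel"
      by measurable
    define \<phi> where "\<phi> w = bracket (mod_Y \<gamma> w) powr (- c) * bracket (snd w) powr (- 1/2) * cmod (fourier ?P w)" for w
    define h where "h z = ennreal (bracket (mod_X z) powr b1 * bracket (snd z) powr 0 * cmod (fourier u z))" for z
    define g where "g z = ennreal (bracket (mod_X z) powr b1 * bracket (snd z) powr 0 * cmod (fourier v z))" for z
    have [measurable]: "\<phi> \<in> borel_measurable borel" "h \<in> borel_measurable borel" "g \<in> borel_measurable borel"
      unfolding \<phi>_def h_def g_def by measurable
    have [measurable]: "(\<lambda>z. kern \<gamma> b1 c b1 z w) \<in> borel_measurable borel" for w
      using measurable_Pair1[OF borel_measurable_kern, of w] by simp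
    have pw: "ennreal (\<phi> w) \<le> (\<integral>\<^sup>+z. h z * g (z - w) * kern \<gamma> b1 c b1 z w \<partial>lborel)" for w
    proof -
      define k where "k = bracket (mod_Y \<gamma> w) powr (- c) * bracket (snd w) powr (1/2)"
      have "cmod (fourier ?P w) = \<bar>snd w\<bar> * cmod (fourier (\<lambda>z. u z * cnj (v z)) w)"
        using fourier_partial_x_mult_cnj(2)[OF u v, of "fst w" "snd w"] by (simp add: norm_mult)
      also have "\<dots> \<le> bracket (snd w) powr 1 * cmod (fourier (\<lambda>z. u z * cnj (v z)) w)"
        using bracket_pos[of "snd w"] by (intro mult_right_mono) (auto simp: bracket_def)
      finally have "\<phi> w \<le> bracket (mod_Y \<gamma> w) powr (- c) * bracket (snd w) powr (- 1/2) * (bracket (snd w) powr 1 * cmod (fourier (\<lambda>z. u z * cnj (v z)) w))"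
        unfolding \<phi>_def by (intro mult_left_mono) auto
      also have "\<dots> = bracket (mod_Y \<gamma> w) powr (- c) * (bracket (snd w) powr (- 1/2) * bracket (snd w) powr 1) * cmod (fourier (\<lambda>z. u z * cnj (v z)) w)"
        by (simp only: mult.assoc)
      also have "bracket (snd w) powr (- 1/2) * bracket (snd w) powr 1 = bracket (snd w) powr (1/2)"
        unfolding powr_add[symmetric] by simp
      finally have "ennreal (\<phi> w) \<le> ennreal k * ennreal (cmod (fourier (\<lambda>z. u z * cnj (v z)) w))"
        unfolding k_def by (simp add: ennreal_leI flip: ennreal_mult')
      also have "\<dots> \<le> ennreal k * (\<integral>\<^sup>+z. ennreal (cmod (fourier u z) * cmod (fourier (\<lambda>z. cnj (v z)) (w - z))) \<partial>lborel)"
        by (intro mult_left_mono cmod_fourier_mult_le u rapid_cnj r) simp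
      also have "\<dots> = ennreal k * (\<integral>\<^sup>+z. ennreal (cmod (fourier u z) * cmod (fourier v (z - w))) \<partial>lborel)"
        unfolding fourier_cnj by simp
      also have "\<dots> = (\<integral>\<^sup>+z. ennreal k * ennreal (cmod (fourier u z) * cmod (fourier v (z - w))) \<partial>lborel)"
        by (rule nn_integral_cmult[symmetric]) measurable
      also have "\<dots> = (\<integral>\<^sup>+z. h z * g (z - w) * kern \<gamma> b1 c b1 z w \<partial>lborel)"
      proof (rule nn_integral_cong)
        fix z
        have "bracket (mod_X z) powr b1 * bracket (mod_X z) powr (- b1) = 1"
          "bracket (mod_X (z - w)) powr b1 * bracket (mod_X (z - w)) powr (- b1) = 1"
          "bracket (snd z) powr 0 = 1" "bracket (snd (z - w)) powr 0 = 1"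
          using bracket_pos[of "snd z"] bracket_pos[of "mod_X z"] bracket_pos[of "mod_X (z - w)"] bracket_pos[of "snd (z - w)"]
          by (simp_all flip: powr_add)
        then have "k * (cmod (fourier u z) * cmod (fourier v (z - w)))
          = (bracket (mod_X z) powr b1 * bracket (mod_X z) powr (- b1)) * bracket (snd z) powr 0
           * (bracket (mod_X (z - w)) powr b1 * bracket (mod_X (z - w)) powr (- b1)) * bracket (snd (z - w)) powr 0
           * (k * (cmod (fourier u z) * cmod (fourier v (z - w))))" by simp
        also have "\<dots> = (bracket (mod_X z) powr b1 * bracket (snd z) powr 0 * cmod (fourier u z))
            * (bracket (mod_X (z - w)) powr b1 * bracket (snd (z - w)) powr 0 * cmod (fourier v (z - w)))
            * (bracket (snd w) powr (1/2) * bracket (mod_X z) powr (- b1) * bracket (mod_Y \<gamma> w) powr (- c) * bracket (mod_X (z - w)) powr (- b1))"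
          unfolding k_def by (simp only: mult_ac)
        finally show "ennreal k * ennreal (cmod (fourier u z) * cmod (fourier v (z - w)))
          = h z * g (z - w) * kern \<gamma> b1 c b1 z w"
          unfolding h_def g_def kern_def by (simp add: k_def flip: ennreal_mult')
      qed
      finally show ?thesis .
    qed
    have "(\<integral>\<^sup>+z. (ennreal (\<phi> z))\<^sup>2 \<partial>lborel) \<le> ennreal C * (\<integral>\<^sup>+z. (h z)\<^sup>2 \<partial>lborel) * (\<integral>\<^sup>+z. (g z)\<^sup>2 \<partial>lborel)"
    proof (rule nn_integral_power2_le_dual)
      fix f :: "real \<times> real \<Rightarrow> ennreal"
      assume [measurable]: "f \<in> borel_measurable borel"
      have "(\<integral>\<^sup>+w. f w * ennreal (\<phi> w) \<partial>lborel) \<le> (\<integral>\<^sup>+w. f w * (\<integral>\<^sup>+z. h z * g (z - w) * kern \<gamma> b1 c b1 z w \<partial>lborel) \<partial>lborel)"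
        by (intro nn_integral_mono mult_left_mono pw) simp
      also have "\<dots> = (\<integral>\<^sup>+w. \<integral>\<^sup>+z. h z * f w * g (z - w) * kern \<gamma> b1 c b1 z w \<partial>lborel \<partial>lborel)"
        by (subst nn_integral_cmult[symmetric]) (measurable, simp only: mult_ac)
      \<comment> \<open>Duality produces the form with the output frequency w outermost; Tonelli
        restores the order of \<open>form_bound\<close>.\<close>
      also have "\<dots> = (\<integral>\<^sup>+z. \<integral>\<^sup>+w. h z * f w * g (z - w) * kern \<gamma> b1 c b1 z w \<partial>lborel \<partial>lborel)"
        by (rule lborel_pair.Fubini') measurable
      finally have "(\<integral>\<^sup>+w. f w * ennreal (\<phi> w) \<partial>lborel)\<^sup>2 \<le> (\<integral>\<^sup>+z. \<integral>\<^sup>+w. h z * f w * g (z - w) * kern \<gamma> b1 c b1 z w \<partial>lborel \<partial>lborel)\<^sup>2"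
        by (rule power_mono_ennreal)
      also have "\<dots> \<le> ennreal C * (\<integral>\<^sup>+z. (h z)\<^sup>2 \<partial>lborel) * (\<integral>\<^sup>+z. (f z)\<^sup>2 \<partial>lborel) * (\<integral>\<^sup>+z. (g z)\<^sup>2 \<partial>lborel)"
        by (rule C) measurable
      finally show "(\<integral>\<^sup>+w. f w * ennreal (\<phi> w) \<partial>lborel)\<^sup>2 \<le> ennreal C * (\<integral>\<^sup>+z. (h z)\<^sup>2 \<partial>lborel) * (\<integral>\<^sup>+z. (g z)\<^sup>2 \<partial>lborel) * (\<integral>\<^sup>+z. (f z)\<^sup>2 \<partial>lborel)"
        by (simp only: mult_ac)
    qed measurable
    from ennreal_sqrt_le_mult[OF this]
    show "Y_norm \<gamma> (- 1/2) (- c) ?P \<le> ennreal (sqrt (max 1 C)) * X_norm 0 b1 u * X_norm 0 b1 v"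
      unfolding \<phi>_def h_def g_def by (subst Y_norm_eq, measurable) (subst X_norm_eq, measurable)+
  qed
qed

theorem proposition3p1:
  fixes \<gamma> b b1 c c1 :: real
  assumes "\<bar>\<gamma>\<bar> \<noteq> 1" and "\<gamma> \<noteq> 0"
    and "b \<in> {1/4<..<1/2}" and "b1 \<in> {1/4<..<1/2}"
    and "c \<in> {1/4<..<1/2}" and "c1 \<in> {1/4<..<1/2}"
  shows "(b + b1 + c1 \<ge> 1 \<longrightarrow>
      (\<exists>C::real. C > 0 \<and> (\<forall>u v. schwartz u \<longrightarrow> schwartz v \<longrightarrow>
        X_norm 0 (- c1) (\<lambda>z. u z * v z)
          \<le> ennreal C * Y_norm \<gamma> (- 1/2) b u * X_norm 0 b1 v)))
    \<and> (2 * b1 + c \<ge> 1 \<longrightarrow>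
      (\<exists>C::real. C > 0 \<and> (\<forall>u v. schwartz u \<longrightarrow> schwartz v \<longrightarrow>
        Y_norm \<gamma> (- 1/2) (- c) (partial_x (\<lambda>z. u z * cnj (v z)))
          \<le> ennreal C * X_norm 0 b1 u * X_norm 0 b1 v)))"
proof (intro conjI impI)
  assume "b + b1 + c1 \<ge> 1"
  then show "\<exists>C::real. C > 0 \<and> (\<forall>u v. schwartz u \<longrightarrow> schwartz v \<longrightarrow>
        X_norm 0 (- c1) (\<lambda>z. u z * v z) \<le> ennreal C * Y_norm \<gamma> (- 1/2) b u * X_norm 0 b1 v)"
    \<comment> \<open>The exponent slots for z, w and z - w receive c1, b and b1.\<close>
    using assms by (intro bilinear_X_estimate form_bound_kern) auto
next
  assume "2 * b1 + c \<ge> 1"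
  then show "\<exists>C::real. C > 0 \<and> (\<forall>u v. schwartz u \<longrightarrow> schwartz v \<longrightarrow>
        Y_norm \<gamma> (- 1/2) (- c) (partial_x (\<lambda>z. u z * cnj (v z))) \<le> ennreal C * X_norm 0 b1 u * X_norm 0 b1 v)"
    \<comment> \<open>Both Schroedinger slots carry b1 and the slot of w carries c, whence the sum 2
      * b1 + c.\<close>
    using assms by (intro bilinear_Y_estimate form_bound_kern) auto
qed

end
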